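(* Let $p\in(1,\infty)$ and let $m$ be a positive integer. Let $E\subset\mathbb{R}$ be a closed set containing at least $m+1$ points. A function $f:E\to\mathbb{R}$ can be extended to a function $F\in L^m_p(\mathbb{R})$ (i.e. there is $F\in L^m_p(\mathbb{R})$ with $F|_E=f$) if and only if the quantity $$\mathcal{L}_{m,p}(f:E)=\sup_{\{x_0,\dots,x_n\}\subset E}\left(\sum_{i=0}^{n-m}(x_{i+m}-x_i)\,|\Delta^m f[x_i,\dots,x_{i+m}]|^p\right)^{1/p}$$ is finite, where the supremum is taken over all integers $n\ge m$ and all strictly increasing sequences $x_0<x_1<\dots<x_n$ of points of $E$. Furthermore, there is a constant $C\ge 1$ depending only on $m$ such that $$C^{-1}\,\mathcal{L}_{m,p}(f:E)\le \|f\|_{L^m_p(\mathbb{R})|_E}\le C\,\mathcal{L}_{m,p}(f:E).$$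
   Context: $L^m_p(\mathbb{R})$ is the homogeneous Sobolev space of all functions $F:\mathbb{R}\to\mathbb{R}$ such that $F^{(m-1)}$ is absolutely continuous on $\mathbb{R}$ and the weak derivative $F^{(m)}$ belongs to $L_p(\mathbb{R})$, with seminorm $\|F\|_{L^m_p(\mathbb{R})}=\|F^{(m)}\|_{L_p(\mathbb{R})}$. The trace seminorm of $f:E\to\mathbb{R}$ is $$\|f\|_{L^m_p(\mathbb{R})|_E}=\inf\{\|F\|_{L^m_p(\mathbb{R})}: F\in L^m_p(\mathbb{R}),\ F|_E=f\}$$ (infimum of the empty set is $+\infty$). For a set $S=\{z_0,\dots,z_m\}$ of $m+1$ distinct points, $\Delta^m f[S]=\Delta^m f[z_0,\dots,z_m]=\sum_{i=0}^m f(z_i)/\prod_{j\ne i}(z_i-z_j)$ is the $m$-th order divided difference of $f$ on $S$. *)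

theory Defs
  imports "HOL-Analysis.Analysis"
begin

definition absolutely_continuous_on :: "real set \<Rightarrow> (real \<Rightarrow> real) \<Rightarrow> bool" where
  "absolutely_continuous_on S u \<longleftrightarrow>
     (\<forall>\<epsilon>>0. \<exists>\<delta>>0. \<forall>(n::nat) (a::nat \<Rightarrow> real) (b::nat \<Rightarrow> real).
        (\<forall>i<n. a i \<le> b i \<and> {a i..b i} \<subseteq> S) \<longrightarrow>
        disjoint_family_on (\<lambda>i. {a i<..<b i}) {..<n} \<longrightarrow>
        (\<Sum>i<n. b i - a i) < \<delta> \<longrightarrow>
        (\<Sum>i<n. \<bar>u (b i) - u (a i)\<bar>) < \<epsilon>)"

definition locally_integrable :: "(real \<Rightarrow> real) \<Rightarrow> bool" where
  "locally_integrable u \<longleftrightarrow> (\<forall>a b. set_integrable lebesgue {a..b} u)"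

definition test_functions :: "(real \<Rightarrow> real) set" where
  "test_functions =
     {\<phi>. (\<forall>k. ((deriv ^^ k) \<phi>) differentiable_on UNIV) \<and> compact (closure {x. \<phi> x \<noteq> 0})}"

definition has_weak_derivative ::
    "nat \<Rightarrow> (real \<Rightarrow> real) \<Rightarrow> (real \<Rightarrow> real) \<Rightarrow> bool" where
  "has_weak_derivative k u g \<longleftrightarrow>
     locally_integrable u \<and> locally_integrable g \<and>
     (\<forall>\<phi>\<in>test_functions.
        (LINT x|lebesgue. u x * (deriv ^^ k) \<phi> x) = (- 1) ^ k * (LINT x|lebesgue. g x * \<phi> x))"

definition Lp_functions :: "real \<Rightarrow> (real \<Rightarrow> real) set" where
  "Lp_functions p =
     {g \<in> borel_measurable lebesgue. integrable lebesgue (\<lambda>x. \<bar>g x\<bar> powr p)}"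

definition Lp_norm :: "real \<Rightarrow> (real \<Rightarrow> real) \<Rightarrow> real" where
  "Lp_norm p g = (LINT x|lebesgue. \<bar>g x\<bar> powr p) powr (1 / p)"

(* For m >= 1. The first conjunct makes the iterated deriv below a genuine derivative; without it
   deriv may take unspecified values. For p > 1, Hoelder's inequality shows that the global form of
   absolute continuity used here is no more restrictive than the local form. *)
definition homogeneous_sobolev :: "nat \<Rightarrow> real \<Rightarrow> (real \<Rightarrow> real) set" where
  "homogeneous_sobolev m p =
     {F. (\<forall>k<m - 1. ((deriv ^^ k) F) differentiable_on UNIV) \<and>
         absolutely_continuous_on UNIV ((deriv ^^ (m - 1)) F) \<and>
         (\<exists>g. has_weak_derivative m F g \<and> g \<in> Lp_functions p)}"

(* The choice of g is immaterial: weak derivatives are unique almost everywhere. *)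
definition sobolev_seminorm :: "nat \<Rightarrow> real \<Rightarrow> (real \<Rightarrow> real) \<Rightarrow> real" where
  "sobolev_seminorm m p F = Lp_norm p (SOME g. has_weak_derivative m F g)"

(* A function on E is represented by a function on the whole line of which only the values on E
   are used. *)
definition trace_seminorm :: "nat \<Rightarrow> real \<Rightarrow> real set \<Rightarrow> (real \<Rightarrow> real) \<Rightarrow> ennreal" where
  "trace_seminorm m p E f =
     (INF F\<in>{F \<in> homogeneous_sobolev m p. \<forall>x\<in>E. F x = f x}. ennreal (sobolev_seminorm m p F))"

(* The order of the divided difference is card S - 1. *)
definition divided_difference :: "(real \<Rightarrow> real) \<Rightarrow> real set \<Rightarrow> real" where
  "divided_difference f S = (\<Sum>z\<in>S. f z / (\<Prod>w\<in>S - {z}. z - w))"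

definition variational_functional ::
    "nat \<Rightarrow> real \<Rightarrow> (real \<Rightarrow> real) \<Rightarrow> real set \<Rightarrow> ennreal" where
  "variational_functional m p f E =
     (SUP (n, x)\<in>{(n::nat, x::nat \<Rightarrow> real). m \<le> n \<and> strict_mono_on {..n} x \<and> x ` {..n} \<subseteq> E}.
        ennreal ((\<Sum>i=0..n - m.
          (x (i + m) - x i) * \<bar>divided_difference f (x ` {i..i + m})\<bar> powr p) powr (1 / p)))"

end

theory Submission
  imports Defs "HOL-Computational_Algebra.Polynomial"
begin

text \<open>
  Necessity. By the recursion for divided differences and the mean value theorem,
  \<open>(x\<^bsub>i+m\<^esub> - x\<^sub>i) |\<Delta>\<^sup>m F[x\<^sub>i, \<dots>, x\<^bsub>i+m\<^esub>]|\<close> is at most the variation of \<open>F\<^bsup>(m-1)\<^esup>\<close> on \<open>[x\<^sub>i, x\<^bsub>i+m\<^esub>]\<close>,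
  hence at most the integral of \<open>|F\<^bsup>(m)\<^esup>|\<close> there; Jensen's inequality and the fact that at most
  \<open>m + 1\<close> of these intervals meet at a point give the bound.

  Sufficiency for a finite set \<open>x\<^sub>0 < \<dots> < x\<^sub>n\<close>. Let \<open>P\<^sub>i\<close> interpolate \<open>f\<close> at \<open>x\<^sub>i, \<dots>, x\<^bsub>i+m-1\<^esub>\<close>, and let the
  smooth step \<open>\<theta>\<^sub>i\<close> climb from 0 to 1 on a longest gap between neighbours among \<open>x\<^sub>i, \<dots>, x\<^bsub>i+m\<^esub>\<close>.
  Then \<open>F = P\<^sub>0 + \<Sum>\<^sub>i \<theta>\<^sub>i (P\<^bsub>i+1\<^esub> - P\<^sub>i)\<close> interpolates \<open>f\<close>, because \<open>P\<^bsub>i+1\<^esub> - P\<^sub>i\<close> vanishes at the inner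
  nodes. As \<open>P\<^bsub>i+1\<^esub> - P\<^sub>i\<close> is \<open>\<Delta>\<^sup>m f[x\<^sub>i, \<dots>, x\<^bsub>i+m\<^esub>] (x\<^bsub>i+m\<^esub> - x\<^sub>i)\<close> times a monic polynomial of degree
  \<open>m - 1\<close>, the Leibniz rule bounds \<open>F\<^bsup>(m)\<^esup>\<close> on that gap by \<open>C |\<Delta>\<^sup>m f[x\<^sub>i, \<dots>, x\<^bsub>i+m\<^esub>]|\<close>.

  Sufficiency for an arbitrary set. Fix \<open>m\<close> points of \<open>E\<close>. That the \<open>m\<close>-fold primitive of \<open>h\<close> agrees with
  \<open>f\<close> on \<open>E\<close> up to a polynomial of degree less than \<open>m\<close> is a family of linear conditions on \<open>h\<close>, one
  for each further point of \<open>E\<close>. Finitely many of them are solvable in a fixed ball of \<open>L\<^sub>p\<close>, so by a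
  compactness argument all of them are.
\<close>

section \<open>Divided differences and Lagrange interpolation\<close>

text \<open>An infinite set need not have neighbouring nodes, so the explicit formula only serves
  finite subsets; what passes to the limit is a bound in L_p for the m-th derivative that is uniform
  over these subsets. The limit is therefore taken for h, with the conditions written as divided
  differences over the m fixed points and one further point, because these do not see the polynomial
  lost in differentiating. Strict convexity of t^p makes near-minimizers converge in measure.

  The constant is independent of p because every loss is a factor K^p inside the integral of
  |F^(m)|^p with K depending on m alone, and the p-th root returns K. With L = x_(i+m) - x_i the
  chosen gap has length at least L/m, so l derivatives of the step cost at most a multiple of
  (m/L)^l; the factor L and the size of the monic polynomial on an interval of length L compensate
  this exactly.

  The weak derivative in the seminorm is an unspecified choice. It is tied to F through the
  increments of F^(m-1), which give its uniqueness as well as the necessity estimate.\<close>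

lemma divided_difference_cong:
  "(\<And>z. z \<in> S \<Longrightarrow> f z = g z) \<Longrightarrow> divided_difference f S = divided_difference g S"
  unfolding divided_difference_def by (intro sum.cong) auto

lemma divided_difference_add:
  "divided_difference (\<lambda>x. f x + g x) S = divided_difference f S + divided_difference g S"
  unfolding divided_difference_def by (simp add: sum.distrib add_divide_distrib)

lemma divided_difference_diff:
  "divided_difference (\<lambda>x. f x - g x) S = divided_difference f S - divided_difference g S"
  unfolding divided_difference_def by (simp add: sum_subtractf diff_divide_distrib)

lemma divided_difference_cmult:
  "divided_difference (\<lambda>x. c * f x) S = c * divided_difference f S"
  unfolding divided_difference_def by (simp add: sum_distrib_left)

text \<open>Removing a node c multiplies the weight of every z by z - c, and this factor also erases
  the term z = c. Subtracting the cases c = a and c = b leaves (z - a) - (z - b) = b - a.\<close>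

lemma divided_difference_recursion:
  assumes "finite S" "a \<in> S" "b \<in> S" "a \<noteq> b"
  shows "(b - a) * divided_difference f S =
    divided_difference f (S - {a}) - divided_difference f (S - {b})"
proof -
  have drop: "divided_difference f (S - {c}) = (\<Sum>z\<in>S. (z - c) * (f z / (\<Prod>w\<in>S - {z}. z - w)))"
    if c: "c \<in> S" for c
  proof -
    have "f z / (\<Prod>w\<in>S - {c} - {z}. z - w) = (z - c) * (f z / (\<Prod>w\<in>S - {z}. z - w))"
      if z: "z \<in> S - {c}" for z
    proof -
      have "S - {z} = insert c (S - {c} - {z})" using c z by auto
      then have "(\<Prod>w\<in>S - {z}. z - w) = (z - c) * (\<Prod>w\<in>S - {c} - {z}. z - w)"
        using assms(1) by simp
      then show ?thesis using z by simp
    qed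
    then have "divided_difference f (S - {c}) = (\<Sum>z\<in>S - {c}. (z - c) * (f z / (\<Prod>w\<in>S - {z}. z - w)))"
      unfolding divided_difference_def by (intro sum.cong) auto
    also have "\<dots> = (\<Sum>z\<in>S. (z - c) * (f z / (\<Prod>w\<in>S - {z}. z - w)))"
      using assms(1) c by (subst sum.remove[of S c]) auto
    finally show ?thesis .
  qed
  show ?thesis
    unfolding drop[OF assms(2)] drop[OF assms(3)] sum_subtractf[symmetric]
    unfolding divided_difference_def sum_distrib_left
    by (intro sum.cong) (auto simp: algebra_simps diff_divide_distrib)
qed

definition lagrange_poly :: "(real \<Rightarrow> real) \<Rightarrow> real set \<Rightarrow> real poly" where
  "lagrange_poly f S =
     (\<Sum>z\<in>S. smult (f z / (\<Prod>w\<in>S - {z}. z - w)) (\<Prod>w\<in>S - {z}. [:- w, 1:]))"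

lemma poly_lagrange_poly:
  "poly (lagrange_poly f S) y =
     (\<Sum>z\<in>S. f z / (\<Prod>w\<in>S - {z}. z - w) * (\<Prod>w\<in>S - {z}. y - w))"
  unfolding lagrange_poly_def by (simp add: poly_sum poly_prod)

lemma degree_prod_linear: "finite A \<Longrightarrow> degree (\<Prod>w\<in>A. [:- w, 1::real:]) = card A"
  by (subst degree_prod_eq_sum_degree) auto

lemma degree_lagrange_poly:
  assumes "finite S"
  shows "degree (lagrange_poly f S) \<le> card S - 1"
  unfolding lagrange_poly_def
proof (rule degree_sum_le[OF assms])
  fix z assume "z \<in> S"
  then have "degree (\<Prod>w\<in>S - {z}. [:- w, 1::real:]) = card S - 1"
    using assms by (subst degree_prod_linear) auto
  then show "degree (smult (f z / (\<Prod>w\<in>S - {z}. z - w)) (\<Prod>w\<in>S - {z}. [:- w, 1:])) \<le> card S - 1"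
    using degree_smult_le by metis
qed

lemma coeff_lagrange_poly:
  assumes "finite S"
  shows "coeff (lagrange_poly f S) (card S - 1) = divided_difference f S"
proof -
  have "coeff (\<Prod>w\<in>S - {z}. [:- w, 1::real:]) (card S - 1) = 1" if "z \<in> S" for z
  proof -
    have "lead_coeff (\<Prod>w\<in>S - {z}. [:- w, 1::real:]) = 1"
      by (simp add: lead_coeff_prod)
    then show ?thesis using assms that by (simp add: degree_prod_linear)
  qed
  then show ?thesis unfolding lagrange_poly_def divided_difference_def coeff_sum
    by (intro sum.cong) auto
qed

lemma poly_lagrange_poly_node:
  assumes "finite S" "y \<in> S"
  shows "poly (lagrange_poly f S) y = f y"
proof -
  have "f z / (\<Prod>w\<in>S - {z}. z - w) * (\<Prod>w\<in>S - {z}. y - w) = 0" if "z \<in> S - {y}" for z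
    using that assms by auto
  then have "(\<Sum>z\<in>S - {y}. f z / (\<Prod>w\<in>S - {z}. z - w) * (\<Prod>w\<in>S - {z}. y - w)) = 0"
    by (intro sum.neutral) auto
  then show ?thesis
    unfolding poly_lagrange_poly using assms by (subst sum.remove[of S y]) auto
qed

text \<open>Multiplying the divided difference on \<open>insert y S\<close> by the node product at y
  turns its y-term into f y and its other terms into the negatives of the Lagrange terms; the sign
  comes from z - y against y - z.\<close>

lemma lagrange_poly_error:
  assumes "finite S" "y \<notin> S"
  shows "f y - poly (lagrange_poly f S) y = divided_difference f (insert y S) * (\<Prod>w\<in>S. y - w)"
proof -
  have nz: "(\<Prod>w\<in>S. y - w) \<noteq> 0" using assms by auto
  have "f z / (\<Prod>w\<in>insert y S - {z}. z - w) * (\<Prod>w\<in>S. y - w) =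
      - (f z / (\<Prod>w\<in>S - {z}. z - w) * (\<Prod>w\<in>S - {z}. y - w))" if z: "z \<in> S" for z
  proof -
    have zy: "z \<noteq> y" using z assms by auto
    have "insert y S - {z} = insert y (S - {z})" using zy by auto
    then have 1: "(\<Prod>w\<in>insert y S - {z}. z - w) = (z - y) * (\<Prod>w\<in>S - {z}. z - w)"
      using assms by simp
    have 2: "(\<Prod>w\<in>S. y - w) = (y - z) * (\<Prod>w\<in>S - {z}. y - w)"
      using assms z by (subst prod.remove[of S z]) auto
    have 3: "(\<Prod>w\<in>S - {z}. z - w) \<noteq> 0" using assms by auto
    show ?thesis unfolding 1 2 using zy 3 by (simp add: field_simps)
  qed
  then have "(\<Sum>z\<in>S. f z / (\<Prod>w\<in>insert y S - {z}. z - w)) * (\<Prod>w\<in>S. y - w) =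
      - poly (lagrange_poly f S) y"
    unfolding poly_lagrange_poly sum_distrib_right sum_negf[symmetric] by (intro sum.cong) auto
  moreover have "insert y S - {y} = S" using assms by auto
  ultimately show ?thesis
    using assms nz unfolding divided_difference_def by (simp add: distrib_right)
qed

text \<open>At a node the claim is trivial or an instance of the error formula. Elsewhere two error
  formulas are subtracted: by the recursion both involve the divided difference on
  \<open>insert y U\<close>, which cancels and leaves that on \<open>insert b U\<close> minus that
  on \<open>insert a U\<close>.\<close>

lemma lagrange_poly_exchange:
  assumes "finite U" "a \<notin> U" "b \<notin> U" "a \<noteq> b"
  shows "poly (lagrange_poly f (insert b U)) y - poly (lagrange_poly f (insert a U)) y =
    divided_difference f (insert a (insert b U)) * (b - a) * (\<Prod>w\<in>U. y - w)"
proof -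
  let ?D = "divided_difference f"
  consider "y \<in> U" | "y = a" | "y = b" | "y \<notin> U" "y \<noteq> a" "y \<noteq> b" by blast
  then show ?thesis
  proof cases
    case 1
    then show ?thesis using assms by (auto simp: poly_lagrange_poly_node)
  next
    case 2
    have "f a - poly (lagrange_poly f (insert b U)) a =
        ?D (insert a (insert b U)) * ((a - b) * (\<Prod>w\<in>U. a - w))"
      using assms by (subst lagrange_poly_error) auto
    moreover have "poly (lagrange_poly f (insert a U)) a = f a"
      using assms by (auto simp: poly_lagrange_poly_node)
    ultimately show ?thesis using 2 by (simp add: algebra_simps)
  next
    case 3
    have "f b - poly (lagrange_poly f (insert a U)) b =
        ?D (insert b (insert a U)) * ((b - a) * (\<Prod>w\<in>U. b - w))"
      using assms by (subst lagrange_poly_error) auto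
    moreover have "poly (lagrange_poly f (insert b U)) b = f b"
      using assms by (auto simp: poly_lagrange_poly_node)
    ultimately show ?thesis using 3 by (simp add: algebra_simps insert_commute)
  next
    case 4
    have a: "f y - poly (lagrange_poly f (insert a U)) y =
        ?D (insert y (insert a U)) * ((y - a) * (\<Prod>w\<in>U. y - w))"
      using assms 4 by (subst lagrange_poly_error) auto
    have b: "f y - poly (lagrange_poly f (insert b U)) y =
        ?D (insert y (insert b U)) * ((y - b) * (\<Prod>w\<in>U. y - w))"
      using assms 4 by (subst lagrange_poly_error) auto
    have "(y - a) * ?D (insert y (insert a U)) = ?D (insert y U) - ?D (insert a U)"
      using assms 4 divided_difference_recursion[of "insert y (insert a U)" a y f]
      by (auto simp: insert_Diff_if)
    moreover have "(y - b) * ?D (insert y (insert b U)) = ?D (insert y U) - ?D (insert b U)"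
      using assms 4 divided_difference_recursion[of "insert y (insert b U)" b y f]
      by (auto simp: insert_Diff_if)
    moreover have "(b - a) * ?D (insert a (insert b U)) = ?D (insert b U) - ?D (insert a U)"
      using assms divided_difference_recursion[of "insert a (insert b U)" a b f]
      by (auto simp: insert_Diff_if)
    ultimately have "(b - a) * ?D (insert a (insert b U)) =
        (y - a) * ?D (insert y (insert a U)) - (y - b) * ?D (insert y (insert b U))" by simp
    then have "((b - a) * ?D (insert a (insert b U))) * (\<Prod>w\<in>U. y - w) =
        ((y - a) * ?D (insert y (insert a U)) - (y - b) * ?D (insert y (insert b U))) * (\<Prod>w\<in>U. y - w)"
      by simp
    then show ?thesis using a b by (simp add: algebra_simps)
  qed
qed

text \<open>Turns a solved moment condition into an extension: equal divided differences make the
  interpolation error of f - g at y vanish. At y in S the interpolant is exact, whence the guard on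
  the second assumption.\<close>

lemma divided_difference_eq_imp_eq_lagrange_poly:
  assumes "finite S"
    and "y \<notin> S \<Longrightarrow> divided_difference f (insert y S) = divided_difference g (insert y S)"
  shows "f y = g y + poly (lagrange_poly (\<lambda>x. f x - g x) S) y"
proof (cases "y \<in> S")
  case True
  then show ?thesis using assms by (simp add: poly_lagrange_poly_node)
next
  case False
  then show ?thesis
    using lagrange_poly_error[OF assms(1) False, of "\<lambda>x. f x - g x"] assms(2)
    by (simp add: divided_difference_diff)
qed

section \<open>Chains of successive derivatives and the mean value theorem for divided
  differences\<close>

text \<open>Derivatives are supplied as an explicit family, since \<open>deriv\<close> is
  unspecified where no derivative exists. Of the last member \<open>G n\<close> only its being the
  derivative of its predecessor is recorded.\<close>

definition deriv_chain :: "nat \<Rightarrow> (nat \<Rightarrow> real \<Rightarrow> real) \<Rightarrow> bool" where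
  "deriv_chain n G \<longleftrightarrow> (\<forall>i<n. \<forall>x. (G i has_real_derivative G (Suc i) x) (at x))"

lemma deriv_chainD: "deriv_chain n G \<Longrightarrow> i < n \<Longrightarrow> (G i has_real_derivative G (Suc i) x) (at x)"
  by (auto simp: deriv_chain_def)

lemma deriv_chain_mono: "deriv_chain n G \<Longrightarrow> k \<le> n \<Longrightarrow> deriv_chain k G"
  by (auto simp: deriv_chain_def)

lemma deriv_chain_shift: "deriv_chain (Suc n) G \<Longrightarrow> deriv_chain n (\<lambda>i. G (Suc i))"
  by (auto simp: deriv_chain_def)

lemma deriv_chain_continuous_on: "deriv_chain n G \<Longrightarrow> i < n \<Longrightarrow> continuous_on A (G i)"
  by (meson DERIV_continuous continuous_at_imp_continuous_on deriv_chainD)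

lemma deriv_chain_deriv:
  assumes "deriv_chain n G" "k \<le> n"
  shows "(deriv ^^ k) (G 0) = G k"
  using assms(2)
proof (induction k)
  case (Suc k)
  then show ?case using assms(1) by (auto intro!: ext DERIV_imp_deriv deriv_chainD)
qed simp

lemma deriv_chain_poly: "deriv_chain n (\<lambda>i. poly ((pderiv ^^ i) q))"
  by (auto simp: deriv_chain_def intro!: derivative_eq_intros)

lemma deriv_chain_add:
  "deriv_chain n G \<Longrightarrow> deriv_chain n H \<Longrightarrow> deriv_chain n (\<lambda>i x. G i x + H i x)"
  unfolding deriv_chain_def by (auto intro!: DERIV_add)

lemma deriv_chain_diff:
  "deriv_chain n G \<Longrightarrow> deriv_chain n H \<Longrightarrow> deriv_chain n (\<lambda>i x. G i x - H i x)"
  unfolding deriv_chain_def by (auto intro!: DERIV_diff)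

text \<open>Induction on the largest zero c: the mean value theorem adds a zero of g' strictly
  between the previous maximum and c. The right end b is generalized so that the earlier zeros stay
  left of that maximum and the new one is distinct from them.\<close>

lemma rolle_zeros:
  fixes g g' :: "real \<Rightarrow> real"
  assumes d: "\<And>x. (g has_real_derivative g' x) (at x)"
    and "finite Z" "card Z = Suc k" "\<And>z. z \<in> Z \<Longrightarrow> g z = 0" "Z \<subseteq> {a..b}"
  shows "\<exists>Z'. finite Z' \<and> card Z' = k \<and> Z' \<subseteq> {a..b} \<and> (\<forall>z\<in>Z'. g' z = 0)"
  using assms(2-)
proof (induction Z arbitrary: k b rule: finite_linorder_max_induct)
  case (insert c Z)
  show ?case
  proof (cases "Z = {}")
    case True
    then show ?thesis using insert.prems by (intro exI[of _ "{}"]) auto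
  next
    case False
    let ?M = "Max Z"
    have M: "?M \<in> Z" "?M < c" using insert.hyps False by auto
    have cZ: "card Z = k" using insert.prems insert.hyps by (auto simp: card_insert_if)
    then obtain k' where k': "k = Suc k'" using False insert.hyps by (cases k) auto
    have "\<exists>Z'. finite Z' \<and> card Z' = k' \<and> Z' \<subseteq> {a..?M} \<and> (\<forall>z\<in>Z'. g' z = 0)"
      using insert.prems cZ k' insert.hyps by (intro insert.IH) auto
    then obtain Z' where Z': "finite Z'" "card Z' = k'" "Z' \<subseteq> {a..?M}" "\<forall>z\<in>Z'. g' z = 0" by blast
    have "\<exists>l z. ?M < z \<and> z < c \<and> DERIV g z :> l \<and> g c - g ?M = (c - ?M) * l"
      using M d by (intro MVT continuous_at_imp_continuous_on)
        (auto intro: DERIV_isCont simp: real_differentiable_def)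
    then obtain z l where z: "?M < z" "z < c" "DERIV g z :> l" "g c - g ?M = (c - ?M) * l" by blast
    have "g' z = 0" using z M insert.prems(2) DERIV_unique[OF z(3) d] by auto
    moreover have "z \<notin> Z'" using Z'(3) z(1) by auto
    moreover have "a \<le> ?M" "c \<le> b" using M(1) insert.prems(3) by auto
    ultimately show ?thesis using Z' z k'
      by (intro exI[of _ "insert z Z'"]) (simp add: subset_iff, fastforce)
  qed
qed auto

lemma generalized_rolle:
  assumes "deriv_chain n G" "finite Z" "card Z = Suc n" "\<And>z. z \<in> Z \<Longrightarrow> G 0 z = 0" "Z \<subseteq> {a..b}"
  shows "\<exists>\<xi>\<in>{a..b}. G n \<xi> = 0"
  using assms
proof (induction n arbitrary: G Z)
  case 0
  then obtain z where "Z = {z}" by (metis One_nat_def card_1_singletonE)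
  then show ?case using 0 by auto
next
  case (Suc n)
  have "\<exists>Z'. finite Z' \<and> card Z' = Suc n \<and> Z' \<subseteq> {a..b} \<and> (\<forall>z\<in>Z'. G (Suc 0) z = 0)"
    using Suc.prems by (intro rolle_zeros[of "G 0" "G (Suc 0)" Z]) (auto intro: deriv_chainD)
  then obtain Z' where "finite Z'" "card Z' = Suc n" "Z' \<subseteq> {a..b}" "\<forall>z\<in>Z'. G (Suc 0) z = 0" by blast
  with Suc.IH[of "\<lambda>i. G (Suc i)" Z'] Suc.prems(1) show ?case by (auto dest: deriv_chain_shift)
qed

lemma poly_pderiv_iterate_degree_le:
  assumes "degree q \<le> n"
  shows "poly ((pderiv ^^ n) q) x = fact n * coeff q n"
proof -
  have "degree ((pderiv ^^ n) q) = 0" using assms by (simp add: degree_higher_pderiv)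
  then obtain c where c: "(pderiv ^^ n) q = [:c:]" by (metis degree_eq_zeroE)
  have "c = coeff ((pderiv ^^ n) q) 0" by (simp add: c)
  also have "\<dots> = fact n * coeff q n" by (simp add: coeff_higher_pderiv pochhammer_fact)
  finally show ?thesis by (simp add: c)
qed

text \<open>\<open>G 0\<close> minus its interpolant has n + 1 zeros, so its n-th derivative
  vanishes somewhere in the interval, while the n-th derivative of the interpolant is constantly n!
  times its top coefficient.\<close>

lemma divided_difference_mean_value:
  assumes "deriv_chain n G" "finite S" "card S = Suc n" "S \<subseteq> {a..b}"
  shows "\<exists>\<xi>\<in>{a..b}. G n \<xi> = fact n * divided_difference (G 0) S"
proof -
  let ?q = "lagrange_poly (G 0) S"
  have "\<exists>\<xi>\<in>{a..b}. G n \<xi> - poly ((pderiv ^^ n) ?q) \<xi> = 0"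
    using assms
    by (intro generalized_rolle[of n "\<lambda>i x. G i x - poly ((pderiv ^^ i) ?q) x" S])
      (auto intro: deriv_chain_diff deriv_chain_poly simp: poly_lagrange_poly_node)
  moreover have "poly ((pderiv ^^ n) ?q) x = fact n * divided_difference (G 0) S" for x
    using degree_lagrange_poly[of S "G 0"] coeff_lagrange_poly[of S "G 0"] assms
    by (subst poly_pderiv_iterate_degree_le) auto
  ultimately show ?thesis by auto
qed

section \<open>A smooth step function\<close>

text \<open>\<open>exp_inv k\<close> is the \<open>k\<close>-th derivative of \<open>exp (- 1 / x)\<close>, extended by 0 to \<open>x \<le> 0\<close>; the recursion
  for the polynomials comes from differentiating \<open>q (1 / x) * exp (- 1 / x)\<close>.\<close>

fun exp_inv_poly :: "nat \<Rightarrow> real poly" where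
  "exp_inv_poly 0 = 1"
| "exp_inv_poly (Suc k) = [:0, 0, 1:] * (exp_inv_poly k - pderiv (exp_inv_poly k))"

definition exp_inv :: "nat \<Rightarrow> real \<Rightarrow> real" where
  "exp_inv k x = (if x \<le> 0 then 0 else poly (exp_inv_poly k) (1 / x) * exp (- (1 / x)))"

lemma tendsto_poly_times_exp_minus:
  fixes q :: "real poly"
  shows "((\<lambda>x. poly q x * exp (- x)) \<longlongrightarrow> 0) at_top"
proof -
  have "((\<lambda>x. \<Sum>i\<le>degree q. coeff q i * (x ^ i / exp x)) \<longlongrightarrow> (\<Sum>i\<le>degree q. coeff q i * 0)) at_top"
    by (intro tendsto_intros tendsto_power_div_exp_0)
  moreover have "(\<lambda>x. \<Sum>i\<le>degree q. coeff q i * (x ^ i / exp x)) = (\<lambda>x. poly q x * exp (- x))"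
    by (rule ext) (simp add: poly_altdef sum_distrib_right exp_minus divide_inverse mult.assoc)
  ultimately show ?thesis by simp
qed

lemma exp_inv_deriv: "(exp_inv k has_real_derivative exp_inv (Suc k) x) (at x)"
proof -
  consider "x < 0" | "x = 0" | "0 < x" by linarith
  then show ?thesis
  proof cases
    case 1
    have "((\<lambda>_. 0) has_real_derivative exp_inv (Suc k) x) (at x)" using 1 by (simp add: exp_inv_def)
    then show ?thesis
      by (rule has_field_derivative_transform_within_open[of _ _ x "{..<0}"]) (use 1 in \<open>auto simp: exp_inv_def\<close>)
  next
    case 2
    have "filterlim (\<lambda>h::real. 1 / h) at_top (at_right 0)"
      using filterlim_inverse_at_top_right by (simp add: inverse_eq_divide)
    \<comment> \<open>The difference quotient at 0 is the function itself divided by h, which is one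
      more factor 1/h in the polynomial: hence the product with \<open>[:0, 1:]\<close>.\<close>
    from filterlim_compose[OF tendsto_poly_times_exp_minus[of "[:0, 1:] * exp_inv_poly k"] this]
    have "((\<lambda>h. poly ([:0, 1:] * exp_inv_poly k) (1 / h) * exp (- (1 / h))) \<longlongrightarrow> 0) (at_right 0)" .
    then have "((\<lambda>h. (exp_inv k h - exp_inv k 0) / h) \<longlongrightarrow> 0) (at_right 0)"
      by (rule Lim_transform_eventually)
        (auto simp: exp_inv_def eventually_at_right_field intro!: exI[of _ 1])
    moreover have "((\<lambda>h. (exp_inv k h - exp_inv k 0) / h) \<longlongrightarrow> 0) (at_left 0)"
      by (rule Lim_transform_eventually[OF tendsto_const])
        (auto simp: exp_inv_def eventually_at_left_field intro!: exI[of _ "-1"])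
    ultimately have "((\<lambda>h. (exp_inv k h - exp_inv k 0) / h) \<longlongrightarrow> 0) (at 0)"
      by (simp add: filterlim_split_at)
    then show ?thesis using 2 by (simp add: DERIV_def exp_inv_def)
  next
    case 3
    let ?q = "exp_inv_poly k"
    have inv: "((\<lambda>x. 1 / x) has_real_derivative - (1 / x\<^sup>2)) (at x)"
      using 3 by (auto intro!: derivative_eq_intros simp: power2_eq_square)
    have "((\<lambda>x. poly ?q (1 / x)) has_real_derivative poly (pderiv ?q) (1 / x) * (- (1 / x\<^sup>2))) (at x)"
      by (rule DERIV_chain2[OF poly_DERIV inv])
    moreover have "((\<lambda>x. exp (- (1 / x))) has_real_derivative exp (- (1 / x)) * (- (- (1 / x\<^sup>2)))) (at x)"
      by (rule DERIV_chain2[OF DERIV_exp DERIV_minus[OF inv]])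
    ultimately have "((\<lambda>x. poly ?q (1 / x) * exp (- (1 / x))) has_real_derivative
        poly (pderiv ?q) (1 / x) * (- (1 / x\<^sup>2)) * exp (- (1 / x)) +
        exp (- (1 / x)) * (- (- (1 / x\<^sup>2))) * poly ?q (1 / x)) (at x)"
      by (rule DERIV_mult)
    moreover have "poly (pderiv ?q) (1 / x) * (- (1 / x\<^sup>2)) * exp (- (1 / x)) +
        exp (- (1 / x)) * (- (- (1 / x\<^sup>2))) * poly ?q (1 / x) = exp_inv (Suc k) x"
      using 3 by (simp add: exp_inv_def power2_eq_square algebra_simps)
    ultimately have "((\<lambda>x. poly ?q (1 / x) * exp (- (1 / x))) has_real_derivative exp_inv (Suc k) x) (at x)"
      by simp
    then show ?thesis
      by (rule has_field_derivative_transform_within_open[of _ _ x "{0<..}"]) (use 3 in \<open>auto simp: exp_inv_def\<close>)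
  qed
qed

lemma deriv_chain_exp_inv: "deriv_chain n exp_inv"
  by (simp add: deriv_chain_def exp_inv_deriv)

section \<open>Products and affine rescalings of derivative chains; the smooth step\<close>

definition leibniz :: "(nat \<Rightarrow> real \<Rightarrow> real) \<Rightarrow> (nat \<Rightarrow> real \<Rightarrow> real) \<Rightarrow> nat \<Rightarrow> real \<Rightarrow> real" where
  "leibniz G H n x = (\<Sum>i\<le>n. real (n choose i) * (G i x * H (n - i) x))"

text \<open>Pascal's rule in the shape of the product rule: the additional derivative falls either
  on G or on H.\<close>

lemma leibniz_Suc:
  "leibniz G H (Suc n) x = leibniz (\<lambda>i. G (Suc i)) H n x + leibniz G (\<lambda>i. H (Suc i)) n x"
proof -
  have "leibniz G H (Suc n) x = G 0 x * H (Suc n) x +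
      (\<Sum>i\<le>n. real (n choose i) * (G (Suc i) x * H (n - i) x)) +
      (\<Sum>i\<le>n. real (n choose Suc i) * (G (Suc i) x * H (n - i) x))"
    unfolding leibniz_def
    by (simp del: sum.atMost_Suc add: sum.atMost_Suc_shift sum.distrib algebra_simps)
  also have "(\<Sum>i\<le>n. real (n choose Suc i) * (G (Suc i) x * H (n - i) x)) =
      (\<Sum>i<n. real (n choose Suc i) * (G (Suc i) x * H (n - i) x))"
    by (simp add: lessThan_Suc_atMost[symmetric])
  also have "G 0 x * H (Suc n) x + A + (\<Sum>i<n. real (n choose Suc i) * (G (Suc i) x * H (n - i) x)) =
      A + (\<Sum>i<Suc n. real (n choose i) * (G i x * H (Suc n - i) x))" for A
    by (subst sum.lessThan_Suc_shift) simp
  also have "(\<Sum>i<Suc n. real (n choose i) * (G i x * H (Suc n - i) x)) =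
      (\<Sum>i\<le>n. real (n choose i) * (G i x * H (Suc (n - i)) x))"
    unfolding lessThan_Suc_atMost by (intro sum.cong) (auto simp: Suc_diff_le)
  finally show ?thesis by (simp add: leibniz_def)
qed

lemma leibniz_deriv:
  assumes "deriv_chain (Suc n) G" "deriv_chain (Suc n) H"
  shows "(leibniz G H n has_real_derivative leibniz G H (Suc n) x) (at x)"
proof -
  have "((\<lambda>x. leibniz G H n x) has_real_derivative
      (\<Sum>i\<le>n. real (n choose i) * (G (Suc i) x * H (n - i) x + H (Suc (n - i)) x * G i x))) (at x)"
    unfolding leibniz_def using assms
    by (intro DERIV_sum DERIV_cmult DERIV_mult) (auto intro: deriv_chainD)
  moreover have "(\<Sum>i\<le>n. real (n choose i) * (G (Suc i) x * H (n - i) x + H (Suc (n - i)) x * G i x)) =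
      leibniz G H (Suc n) x"
    unfolding leibniz_Suc by (simp add: leibniz_def sum.distrib algebra_simps)
  ultimately show ?thesis by simp
qed

lemma deriv_chain_leibniz:
  assumes "deriv_chain n G" "deriv_chain n H"
  shows "deriv_chain n (leibniz G H)"
  unfolding deriv_chain_def
  using assms by (auto intro!: leibniz_deriv deriv_chain_mono[OF _ Suc_leI])

lemma leibniz_0 [simp]: "leibniz G H 0 x = G 0 x * H 0 x"
  by (simp add: leibniz_def)

lemma deriv_chain_affine:
  assumes "deriv_chain n G"
  shows "deriv_chain n (\<lambda>i x. c ^ i * G i (c * x + d))"
  unfolding deriv_chain_def
proof (intro allI impI)
  fix i x assume "i < n"
  from deriv_chainD[OF assms this]
  have "((\<lambda>x. G i (c * x + d)) has_real_derivative G (Suc i) (c * x + d) * c) (at x)"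
    by (rule DERIV_chain2) (auto intro!: derivative_eq_intros)
  from DERIV_cmult[OF this, of "c ^ i"]
  show "((\<lambda>x. c ^ i * G i (c * x + d)) has_real_derivative c ^ Suc i * G (Suc i) (c * x + d)) (at x)"
    by (simp add: mult_ac)
qed

text \<open>The normalized primitive of exp(-1/x) exp(-1/(1-x)). The bounds on the derivatives come
  from compactness of [0, 1]; they depend on no data, which lets the final constant depend on m
  alone.\<close>

lemma ex_smooth_step:
  "\<exists>\<Theta>. (\<forall>n. deriv_chain n \<Theta>) \<and> (\<forall>x\<le>0. \<Theta> 0 x = 0) \<and> (\<forall>x\<ge>1. \<Theta> 0 x = (1::real)) \<and>
     (\<forall>k x. x \<le> 0 \<or> 1 \<le> x \<longrightarrow> \<Theta> (Suc k) x = 0) \<and> (\<forall>x. 0 \<le> \<Theta> 0 x \<and> \<Theta> 0 x \<le> 1) \<and>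
     (\<exists>B. \<forall>k x. \<bar>\<Theta> k x\<bar> \<le> B k)"
proof -
  define \<psi> where "\<psi> = leibniz exp_inv (\<lambda>i x. (-1) ^ i * exp_inv i ((-1) * x + 1))"
  have chain: "deriv_chain n \<psi>" for n
    unfolding \<psi>_def by (intro deriv_chain_leibniz deriv_chain_affine deriv_chain_exp_inv)
  have out: "\<psi> k x = 0" if "x \<le> 0 \<or> 1 \<le> x" for k x
    using that by (auto simp: \<psi>_def leibniz_def exp_inv_def)
  have pos: "0 \<le> \<psi> 0 x" for x by (auto simp: \<psi>_def exp_inv_def)
  have cont: "continuous_on A (\<psi> k)" for A k
    using deriv_chain_continuous_on[OF chain, of k "Suc k"] by simp
  \<comment> \<open>Integration starts at -1 rather than 0, so that 0 is an interior point of the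
    range in which the fundamental theorem yields a two-sided derivative.\<close>
  define I where "I x = integral {-1..x} (\<psi> 0)" for x
  have I_der: "(I has_real_derivative \<psi> 0 x) (at x)" if "-1 < x" for x
  proof -
    have "(I has_real_derivative \<psi> 0 x) (at x within {-1..x + 1})"
      unfolding I_def using that by (intro integral_has_real_derivative cont) auto
    then show ?thesis using that by (simp add: at_within_Icc_at)
  qed
  have I_neg: "I x = 0" if "x \<le> 0" for x
  proof -
    have "I x = integral {-1..x} (\<lambda>_. 0)"
      unfolding I_def using that out by (intro integral_cong) auto
    then show ?thesis by simp
  qed
  have I_der': "(I has_real_derivative \<psi> 0 x) (at x)" for x
  proof (cases "x < 0")
    case True
    have "((\<lambda>_. 0) has_real_derivative \<psi> 0 x) (at x)" using True out by simp
    then show ?thesis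
      by (rule has_field_derivative_transform_within_open[of _ _ x "{..<0}"]) (use True I_neg in auto)
  qed (auto intro: I_der)
  have I_mono: "I x \<le> I y" if "x \<le> y" for x y
    by (rule DERIV_nonneg_imp_nondecreasing[OF that]) (use I_der' pos in blast)
  have I_ge1: "I x = I 1" if "1 \<le> x" for x
  proof (cases "x = 1")
    case False
    have "\<exists>z. 1 < z \<and> z < x \<and> I x - I 1 = (x - 1) * \<psi> 0 z"
      using False that I_der' by (intro MVT2) auto
    then show ?thesis using out by auto
  qed simp
  have "0 < I 1"
  proof -
    have "\<exists>z. 1/4 < z \<and> z < 1/2 \<and> I (1/2) - I (1/4) = (1/2 - 1/4) * \<psi> 0 z"
      using I_der' by (intro MVT2) auto
    then obtain z where z: "1/4 < z" "z < 1/2" "I (1/2) - I (1/4) = (1/2 - 1/4) * \<psi> 0 z" by blast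
    have "0 < \<psi> 0 z" using z by (auto simp: \<psi>_def exp_inv_def)
    then have "I (1/4) < I (1/2)" using z by simp
    then show ?thesis using I_mono[of 0 "1/4"] I_mono[of "1/2" 1] I_neg[of 0] by simp
  qed
  define \<Theta> where "\<Theta> k x = (case k of 0 \<Rightarrow> I x | Suc j \<Rightarrow> \<psi> j x) / I 1" for k x
  have "deriv_chain n \<Theta>" for n
    unfolding deriv_chain_def
  proof (intro allI impI)
    fix i x
    show "(\<Theta> i has_real_derivative \<Theta> (Suc i) x) (at x)"
      unfolding \<Theta>_def using I_der' deriv_chainD[OF chain lessI]
      by (cases i) (auto intro!: DERIV_cdivide)
  qed
  moreover have "\<exists>b. \<forall>x. \<bar>\<Theta> k x\<bar> \<le> b" for k
  proof -
    have "compact ((\<Theta> k) ` {0..1})"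
      using deriv_chain_continuous_on[OF \<open>\<And>n. deriv_chain n \<Theta>\<close>, of k "Suc k"]
      by (intro compact_continuous_image) auto
    from compact_imp_bounded[OF this] obtain b where "\<forall>y\<in>\<Theta> k ` {0..1}. norm y \<le> b"
      unfolding bounded_iff ..
    then have b: "\<bar>\<Theta> k x\<bar> \<le> b" if "x \<in> {0..1}" for x using that by auto
    have "\<bar>\<Theta> k x\<bar> \<le> max b 1" for x
    proof (cases "x \<in> {0..1}")
      case False
      then show ?thesis using out[of x] I_neg[of x] I_ge1[of x] \<open>0 < I 1\<close>
        by (cases k) (auto simp: \<Theta>_def)
    qed (use b[of x] in auto)
    then show ?thesis by blast
  qed
  then have "\<exists>B. \<forall>k x. \<bar>\<Theta> k x\<bar> \<le> B k" by metis
  moreover have "0 \<le> \<Theta> 0 x \<and> \<Theta> 0 x \<le> 1" for x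
  proof -
    have "0 \<le> I x" using I_mono[of "min x 0" x] I_neg[of "min x 0"] by simp
    moreover have "I x \<le> I 1" using I_mono[of x "max x 1"] I_ge1[of "max x 1"] by simp
    ultimately show ?thesis using \<open>0 < I 1\<close> by (simp add: \<Theta>_def)
  qed
  moreover have "\<forall>x\<le>0. \<Theta> 0 x = 0" using I_neg by (simp add: \<Theta>_def)
  moreover have "\<forall>x\<ge>1. \<Theta> 0 x = 1"
  proof (intro allI impI)
    fix x :: real assume "1 \<le> x"
    from I_ge1[OF this] show "\<Theta> 0 x = 1" using \<open>0 < I 1\<close> by (simp add: \<Theta>_def)
  qed
  moreover have "\<forall>k x. x \<le> 0 \<or> 1 \<le> x \<longrightarrow> \<Theta> (Suc k) x = 0"
  proof (intro allI impI)
    fix k and x :: real assume "x \<le> 0 \<or> 1 \<le> x"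
    from out[OF this] show "\<Theta> (Suc k) x = 0" by (simp add: \<Theta>_def)
  qed
  ultimately show ?thesis using \<open>\<And>n. deriv_chain n \<Theta>\<close> by blast
qed

section \<open>Test functions and integration by parts\<close>

lemma integral_by_parts_vanishing:
  fixes f f' v v' :: "real \<Rightarrow> real"
  assumes "\<And>x. (f has_real_derivative f' x) (at x)" "\<And>x. (v has_real_derivative v' x) (at x)"
    and "continuous_on UNIV f'" "continuous_on UNIV v'"
    and "A \<le> B" "\<And>x. x \<notin> {A<..<B} \<Longrightarrow> v x = 0" "\<And>x. x \<notin> {A<..<B} \<Longrightarrow> v' x = 0"
  shows "(LINT x|lborel. f x * v' x) = - (LINT x|lborel. f' x * v x)"
proof -
  have "(LINT x|lborel. (f x * v' x) * indicator {A..B} x) =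
      f B * v B - f A * v A - (LINT x|lborel. (f' x * v x) * indicator {A..B} x)"
    using assms by (intro integral_by_parts) (auto simp: continuous_on_eq_continuous_at)
  moreover have "(\<lambda>x. (f x * v' x) * indicator {A..B} x) = (\<lambda>x. f x * v' x)"
  proof
    fix x show "(f x * v' x) * indicator {A..B} x = f x * v' x"
      using assms(7)[of x] by (cases "x \<in> {A..B}") auto
  qed
  moreover have "(\<lambda>x. (f' x * v x) * indicator {A..B} x) = (\<lambda>x. f' x * v x)"
  proof
    fix x show "(f' x * v x) * indicator {A..B} x = f' x * v x"
      using assms(6)[of x] by (cases "x \<in> {A..B}") auto
  qed
  ultimately show ?thesis using assms(6) by simp
qed

text \<open>All boundary terms vanish through v. The offset j permits stopping before every
  derivative has left v; j = 1 is used where f can be differentiated classically only m - 1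
  times.\<close>

lemma integral_by_parts_deriv_chain:
  assumes "deriv_chain n f" "continuous_on UNIV (f n)" "\<And>k. deriv_chain k v"
    and "A \<le> B" "\<And>k x. x \<notin> {A<..<B} \<Longrightarrow> v k x = 0"
  shows "(LINT x|lborel. f 0 x * v (n + j) x) = (- 1) ^ n * (LINT x|lborel. f n x * v j x)"
  using assms(1,2)
proof (induction n arbitrary: f)
  case (Suc n)
  have v: "(v k has_real_derivative v (Suc k) x) (at x)" for k x
    using deriv_chainD[OF assms(3), of k "Suc k"] by simp
  have f1: "continuous_on UNIV (f (Suc 0))"
    using Suc.prems deriv_chain_continuous_on[OF Suc.prems(1), of "Suc 0"] by (cases n) auto
  have "(LINT x|lborel. f 0 x * v (Suc (n + j)) x) = - (LINT x|lborel. f (Suc 0) x * v (n + j) x)"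
    using deriv_chainD[OF Suc.prems(1), of 0] f1 v assms(4,5)
      deriv_chain_continuous_on[OF assms(3), of "Suc (n + j)" "Suc (Suc (n + j))"]
    by (intro integral_by_parts_vanishing) auto
  also have "(LINT x|lborel. f (Suc 0) x * v (n + j) x) =
      (- 1) ^ n * (LINT x|lborel. f (Suc n) x * v j x)"
    using Suc.IH[of "\<lambda>i. f (Suc i)"] Suc.prems by (auto dest: deriv_chain_shift)
  finally show ?case by simp
qed simp

lemma test_function_deriv_chain:
  assumes "\<phi> \<in> test_functions"
  shows "deriv_chain n (\<lambda>k. (deriv ^^ k) \<phi>)"
  using assms
  by (auto simp: deriv_chain_def test_functions_def differentiable_on_def DERIV_deriv_iff_real_differentiable)

text \<open>One interval serves all derivatives at once: the function vanishes on the open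
  complement of [-R, R], hence so does each derivative. The ends are moved by 1 so that everything
  outside the open interval lies in that open complement.\<close>

lemma test_function_support:
  assumes "\<phi> \<in> test_functions"
  shows "\<exists>A B. A \<le> B \<and> (\<forall>k x. x \<notin> {A<..<B} \<longrightarrow> (deriv ^^ k) \<phi> x = 0)"
proof -
  have "bounded {x. \<phi> x \<noteq> 0}"
    using assms by (auto simp: test_functions_def intro: bounded_subset[OF compact_imp_bounded closure_subset])
  then obtain R where R: "\<And>x. \<phi> x \<noteq> 0 \<Longrightarrow> \<bar>x\<bar> \<le> R" unfolding bounded_iff by auto
  define S where "S = - {-R..R}"
  have "\<forall>x\<in>S. (deriv ^^ k) \<phi> x = 0" for k
  proof (induction k)
    case 0
    have "\<phi> x = 0" if "x \<in> S" for x using R[of x] that by (cases "\<phi> x = 0") (auto simp: S_def)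
    then show ?case by simp
  next
    case (Suc k)
    show ?case
    proof
      fix x assume x: "x \<in> S"
      have "((deriv ^^ k) \<phi> has_real_derivative 0) (at x)"
        by (rule has_field_derivative_transform_within_open[of "\<lambda>_. 0" 0 x S])
          (use x Suc in \<open>auto simp: S_def\<close>)
      then show "(deriv ^^ Suc k) \<phi> x = 0" by (simp add: DERIV_imp_deriv)
    qed
  qed
  moreover have "x \<in> S" if "x \<notin> {- \<bar>R\<bar> - 1<..<\<bar>R\<bar> + 1}" for x using that by (auto simp: S_def)
  ultimately show ?thesis
    by (intro exI[of _ "- \<bar>R\<bar> - 1"] exI[of _ "\<bar>R\<bar> + 1"]) simp
qed

lemma deriv_chain_test_function:
  assumes "\<And>n. deriv_chain n v" "\<And>x. x \<notin> {A..B} \<Longrightarrow> v 0 x = 0"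
  shows "v 0 \<in> test_functions"
proof -
  have "(deriv ^^ k) (v 0) differentiable_on UNIV" for k
    using deriv_chain_deriv[OF assms(1)[of k]] deriv_chainD[OF assms(1)[of "Suc k"], of k]
    by (auto simp: differentiable_on_def real_differentiable_def intro: field_differentiable_imp_differentiable)
  moreover have "bounded {x. v 0 x \<noteq> 0}"
    by (rule bounded_subset[of "{A..B}"]) (simp, use assms(2) in blast)
  ultimately show ?thesis by (simp add: test_functions_def compact_closure)
qed

lemma LINT_lebesgue_eq_lborel:
  fixes f :: "real \<Rightarrow> real"
  assumes "f \<in> borel_measurable borel"
  shows "(LINT x|lebesgue. f x) = (LINT x|lborel. f x)"
  using assms by (intro integral_completion) simp

text \<open>Moving m - 1 derivatives back to F by classical integration by parts reduces the weak
  derivative of order m to a first-order relation for F^(m-1).\<close>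

lemma weak_derivative_first_order:
  assumes "has_weak_derivative m F g" "m \<ge> 1"
    and chain: "deriv_chain (m - 1) (\<lambda>k. (deriv ^^ k) F)"
    and cont: "continuous_on UNIV ((deriv ^^ (m - 1)) F)"
    and v: "\<And>n. deriv_chain n v" "A \<le> B" "\<And>k x. x \<notin> {A<..<B} \<Longrightarrow> v k x = 0"
  shows "(LINT x|lborel. (deriv ^^ (m - 1)) F x * v 1 x) = - (LINT x|lebesgue. g x * v 0 x)"
proof -
  have "v 0 \<in> test_functions"
    using v by (intro deriv_chain_test_function[of v A B]) auto
  with assms(1) have "(LINT x|lebesgue. F x * (deriv ^^ m) (v 0) x) = (- 1) ^ m * (LINT x|lebesgue. g x * v 0 x)"
    by (auto simp: has_weak_derivative_def)
  moreover have "(deriv ^^ m) (v 0) = v m" by (rule deriv_chain_deriv[OF v(1)[of m]]) simp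
  moreover have "continuous_on UNIV F" using chain cont
    deriv_chain_continuous_on[OF chain, of 0] by (cases "m = 1") (use assms(2) in auto)
  moreover have "continuous_on UNIV (v m)" using deriv_chain_continuous_on[OF v(1)[of "Suc m"]] by simp
  ultimately have "(LINT x|lborel. F x * v m x) = (- 1) ^ m * (LINT x|lebesgue. g x * v 0 x)"
    by (subst LINT_lebesgue_eq_lborel[symmetric])
      (auto intro!: borel_measurable_continuous_onI continuous_intros)
  moreover have "(LINT x|lborel. F x * v m x) = (- 1) ^ (m - 1) * (LINT x|lborel. (deriv ^^ (m - 1)) F x * v 1 x)"
    using integral_by_parts_deriv_chain[OF chain cont v, of 1] assms(2) by simp
  moreover have "(- 1 :: real) ^ m = - ((- 1) ^ (m - 1))" using assms(2) by (cases m) auto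
  ultimately have "(- 1 :: real) ^ (m - 1) * (LINT x|lborel. (deriv ^^ (m - 1)) F x * v 1 x) =
      (- 1) ^ (m - 1) * (- (LINT x|lebesgue. g x * v 0 x))" by simp
  then show ?thesis by (subst (asm) mult_cancel_left) simp
qed

section \<open>Moment problems in balls of Lp spaces\<close>

text \<open>The mean value theorem compares the slope of the chord with that at c, as t^(p-1) is
  strictly increasing. The strict form drives the compactness argument, the weak form gives Jensen's
  inequality.\<close>

lemma powr_tangent_less:
  fixes x c p :: real
  assumes "1 < p" "0 < c" "0 \<le> x" "x \<noteq> c"
  shows "c powr p + p * c powr (p - 1) * (x - c) < x powr p"
proof (cases "x = 0")
  case True
  have "c powr (p - 1) * c = c powr p" using assms by (simp add: powr_mult_base mult.commute)
  then have "c powr p + p * c powr (p - 1) * (x - c) = (1 - p) * c powr p"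
    using True by (simp add: algebra_simps)
  also have "\<dots> < 0" using assms by (intro mult_neg_pos) auto
  finally show ?thesis using True by simp
next
  case False
  then have x: "0 < x" using assms by simp
  show ?thesis
  proof (cases "x < c")
    case True
    have "\<exists>z. x < z \<and> z < c \<and> c powr p - x powr p = (c - x) * (p * z powr (p - 1))"
      using True x by (intro MVT2) (auto intro!: derivative_eq_intros)
    then obtain z where z: "x < z" "z < c" "c powr p - x powr p = (c - x) * (p * z powr (p - 1))" by blast
    have "z powr (p - 1) < c powr (p - 1)" using z x assms by (intro powr_less_mono2) auto
    then have "(c - x) * (p * z powr (p - 1)) < (c - x) * (p * c powr (p - 1))"
      using True assms by (intro mult_strict_left_mono) auto
    then show ?thesis using z by (simp add: algebra_simps)
  next
    case False
    then have cx: "c < x" using assms by auto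
    have "\<exists>z. c < z \<and> z < x \<and> x powr p - c powr p = (x - c) * (p * z powr (p - 1))"
      using cx assms by (intro MVT2) (auto intro!: derivative_eq_intros)
    then obtain z where z: "c < z" "z < x" "x powr p - c powr p = (x - c) * (p * z powr (p - 1))" by blast
    have "c powr (p - 1) < z powr (p - 1)" using z assms by (intro powr_less_mono2) auto
    then have "(x - c) * (p * c powr (p - 1)) < (x - c) * (p * z powr (p - 1))"
      using cx assms by (intro mult_strict_left_mono) auto
    then show ?thesis using z by (simp add: algebra_simps)
  qed
qed

lemma powr_tangent_le:
  fixes x c p :: real
  assumes "1 < p" "0 < c" "0 \<le> x"
  shows "c powr p + p * c powr (p - 1) * (x - c) \<le> x powr p"
  using powr_tangent_less[OF assms] by (cases "x = c") auto

text \<open>Tangents are taken at the mean c of |a| and |b|, where the linear terms cancel. If |a| =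
  |b| but a and b differ, then a = - b and the midpoint is 0.\<close>

lemma abs_powr_midpoint_less:
  fixes a b p :: real
  assumes "1 < p" "a \<noteq> b"
  shows "\<bar>(a + b) / 2\<bar> powr p < (\<bar>a\<bar> powr p + \<bar>b\<bar> powr p) / 2"
proof (cases "\<bar>a\<bar> = \<bar>b\<bar>")
  case True
  then have "a = - b" "b \<noteq> 0" using assms by auto
  then show ?thesis by simp
next
  case False
  define c where "c = (\<bar>a\<bar> + \<bar>b\<bar>) / 2"
  have c: "0 < c" "\<bar>a\<bar> \<noteq> c" "\<bar>b\<bar> \<noteq> c" "(\<bar>a\<bar> - c) + (\<bar>b\<bar> - c) = 0"
    using False by (auto simp: c_def field_simps)
  have "\<bar>(a + b) / 2\<bar> powr p \<le> c powr p"
    using assms unfolding c_def by (intro powr_mono2) auto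
  moreover have "c powr p + p * c powr (p - 1) * (\<bar>a\<bar> - c) < \<bar>a\<bar> powr p"
      "c powr p + p * c powr (p - 1) * (\<bar>b\<bar> - c) < \<bar>b\<bar> powr p"
    using assms c by (auto intro!: powr_tangent_less)
  moreover have "p * c powr (p - 1) * (\<bar>a\<bar> - c) + p * c powr (p - 1) * (\<bar>b\<bar> - c) = 0"
    unfolding distrib_left[symmetric] c(4) by simp
  ultimately show ?thesis by argo
qed

lemma abs_powr_midpoint_le:
  fixes a b p :: real
  assumes "1 < p"
  shows "\<bar>(a + b) / 2\<bar> powr p \<le> (\<bar>a\<bar> powr p + \<bar>b\<bar> powr p) / 2"
  using abs_powr_midpoint_less[OF assms, of a b] by (cases "a = b") auto

text \<open>The convexity gap is continuous and positive on the compact set of admissible pairs, so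
  it has a positive minimum. This plays the part of a Clarkson inequality on bounded values.\<close>

lemma abs_powr_midpoint_gap:
  fixes p R d :: real
  assumes "1 < p" "0 < d"
  shows "\<exists>c>0. \<forall>a b. \<bar>a\<bar> \<le> R \<longrightarrow> \<bar>b\<bar> \<le> R \<longrightarrow> d \<le> \<bar>a - b\<bar> \<longrightarrow>
    c \<le> (\<bar>a\<bar> powr p + \<bar>b\<bar> powr p) / 2 - \<bar>(a + b) / 2\<bar> powr p"
proof -
  define S where "S = ({-R..R} \<times> {-R..R}) \<inter> {z::real \<times> real. d \<le> \<bar>fst z - snd z\<bar>}"
  define G where "G z = (\<bar>fst z\<bar> powr p + \<bar>snd z\<bar> powr p) / 2 - \<bar>(fst z + snd z) / 2\<bar> powr p"
    for z :: "real \<times> real"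
  have "compact S" unfolding S_def
    by (intro compact_Int_closed compact_Times closed_Collect_le) (auto intro!: continuous_intros)
  moreover have "continuous_on S G"
    unfolding G_def using assms by (intro continuous_intros continuous_on_powr') auto
  ultimately have "S \<noteq> {} \<Longrightarrow> \<exists>z\<in>S. \<forall>y\<in>S. G z \<le> G y" by (intro continuous_attains_inf) auto
  then show ?thesis
  proof (cases "S = {}")
    case True
    then have "\<not> (\<bar>a\<bar> \<le> R \<and> \<bar>b\<bar> \<le> R \<and> d \<le> \<bar>a - b\<bar>)" for a b
      by (auto simp: S_def abs_le_iff dest!: equalityD1[THEN subsetD, where c = "(a, b)"])
    then show ?thesis by (intro exI[of _ 1]) auto
  next
    case False
    then obtain z where z: "z \<in> S" "\<forall>y\<in>S. G z \<le> G y" using \<open>S \<noteq> {} \<Longrightarrow> _\<close> by blast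
    have "G z > 0" using z(1) assms abs_powr_midpoint_less[of p "fst z" "snd z"]
      by (auto simp: S_def G_def)
    moreover have "G z \<le> (\<bar>a\<bar> powr p + \<bar>b\<bar> powr p) / 2 - \<bar>(a + b) / 2\<bar> powr p"
      if "\<bar>a\<bar> \<le> R" "\<bar>b\<bar> \<le> R" "d \<le> \<bar>a - b\<bar>" for a b
      using z(2)[rule_format, of "(a, b)"] that by (auto simp: S_def G_def abs_le_iff)
    ultimately show ?thesis by blast
  qed
qed

text \<open>Truncation at height R: because p > 1, the factor R^(1-p) is as small as desired for
  large R. It stands in for Hoelder's inequality throughout.\<close>

lemma le_const_add_powr:
  fixes t R p :: real
  assumes "1 < p" "0 < R" "0 \<le> t"
  shows "t \<le> min t R + R powr (1 - p) * t powr p"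
proof (cases "t \<le> R")
  case False
  then have t: "0 < t" using assms by auto
  have "t = t powr (1 - p) * t powr p" using t by (simp add: powr_add[symmetric])
  also have "\<dots> \<le> R powr (1 - p) * t powr p"
    using False assms by (intro mult_right_mono powr_mono2') auto
  finally show ?thesis using False assms by simp
qed (use assms in simp)

text \<open>K bounds the integral of |h|^p, that is, the p-th power of the norm. The members are
  functions, not classes modulo null sets, since point evaluations of their primitives are
  needed.\<close>

definition Lp_ball :: "'a measure \<Rightarrow> real \<Rightarrow> real \<Rightarrow> ('a \<Rightarrow> real) set" where
  "Lp_ball M p K = {h \<in> borel_measurable M.
     integrable M (\<lambda>x. \<bar>h x\<bar> powr p) \<and> (LINT x|M. \<bar>h x\<bar> powr p) \<le> K}"

lemma Lp_ballD:
  assumes "h \<in> Lp_ball M p K"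
  shows "h \<in> borel_measurable M" "integrable M (\<lambda>x. \<bar>h x\<bar> powr p)"
    "(LINT x|M. \<bar>h x\<bar> powr p) \<le> K"
  using assms by (auto simp: Lp_ball_def)

lemma Lp_ball_midpoint:
  assumes "1 < p" "a \<in> Lp_ball M p K" "b \<in> Lp_ball M p K"
  shows "(\<lambda>x. (a x + b x) / 2) \<in> Lp_ball M p K"
proof -
  note [measurable] = Lp_ballD(1)[OF assms(2)] Lp_ballD(1)[OF assms(3)]
  have i: "integrable M (\<lambda>x. (\<bar>a x\<bar> powr p + \<bar>b x\<bar> powr p) / 2)"
    using Lp_ballD(2)[OF assms(2)] Lp_ballD(2)[OF assms(3)] by simp
  have j: "integrable M (\<lambda>x. \<bar>(a x + b x) / 2\<bar> powr p)"
    by (rule Bochner_Integration.integrable_bound[OF i])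
      (use abs_powr_midpoint_le[OF assms(1)] in auto)
  have "(LINT x|M. \<bar>(a x + b x) / 2\<bar> powr p) \<le> (LINT x|M. (\<bar>a x\<bar> powr p + \<bar>b x\<bar> powr p) / 2)"
    using i j abs_powr_midpoint_le[OF assms(1)] by (intro integral_mono) auto
  also have "\<dots> \<le> K" using Lp_ballD[OF assms(2)] Lp_ballD[OF assms(3)] by simp
  finally show ?thesis using j by (simp add: Lp_ball_def)
qed

text \<open>Chebyshev's inequality in two regions: where |a| and |b| are at most R, the pointwise
  convexity gap is at least c; elsewhere |a|^p + |b|^p is at least R^p = Q. The threshold is uniform
  over the ball.\<close>

lemma emeasure_abs_diff_ge_le:
  fixes p d e K :: real
  assumes "1 < p" "0 < d" "0 < e"
  shows "\<exists>\<eta>>0. \<forall>a\<in>Lp_ball M p K. \<forall>b\<in>Lp_ball M p K.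
    ((LINT x|M. \<bar>a x\<bar> powr p) + (LINT x|M. \<bar>b x\<bar> powr p)) / 2
      - (LINT x|M. \<bar>(a x + b x) / 2\<bar> powr p) \<le> \<eta> \<longrightarrow>
    emeasure M {x \<in> space M. d \<le> \<bar>a x - b x\<bar>} \<le> ennreal e"
proof -
  \<comment> \<open>Chosen so that the region of large values has measure at most 2|K|/Q, which is
    at most e/2; the other half of e is left to the convexity gap.\<close>
  define Q where "Q = 4 * (\<bar>K\<bar> + 1) / e"
  define R where "R = Q powr (1 / p)"
  have Q: "0 < Q" using assms by (simp add: Q_def)
  have R: "0 < R" "R powr p = Q" using Q assms by (auto simp: R_def powr_powr)
  obtain c where c: "0 < c" "\<And>a b. \<bar>a\<bar> \<le> R \<Longrightarrow> \<bar>b\<bar> \<le> R \<Longrightarrow> d \<le> \<bar>a - b\<bar> \<Longrightarrow>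
    c \<le> (\<bar>a\<bar> powr p + \<bar>b\<bar> powr p) / 2 - \<bar>(a + b) / 2\<bar> powr p"
    using abs_powr_midpoint_gap[OF assms(1,2), of R] by blast
  show ?thesis
  proof (intro exI[of _ "c * e / 2"] conjI ballI impI)
    show "0 < c * e / 2" using c assms by simp
    fix a b assume a: "a \<in> Lp_ball M p K" and b: "b \<in> Lp_ball M p K"
    let ?gap = "\<lambda>x. (\<bar>a x\<bar> powr p + \<bar>b x\<bar> powr p) / 2 - \<bar>(a x + b x) / 2\<bar> powr p"
    let ?g = "\<lambda>x. (\<bar>a x\<bar> powr p + \<bar>b x\<bar> powr p) / Q + ?gap x / c"
    let ?A = "{x \<in> space M. d \<le> \<bar>a x - b x\<bar>}"
    assume gap: "((LINT x|M. \<bar>a x\<bar> powr p) + (LINT x|M. \<bar>b x\<bar> powr p)) / 2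
      - (LINT x|M. \<bar>(a x + b x) / 2\<bar> powr p) \<le> c * e / 2"
    note [measurable] = Lp_ballD(1)[OF a] Lp_ballD(1)[OF b]
    note int = Lp_ballD(2)[OF a] Lp_ballD(2)[OF b] Lp_ballD(2)[OF Lp_ball_midpoint[OF assms(1) a b]]
    have gap0: "0 \<le> ?gap x" for x using abs_powr_midpoint_le[OF assms(1), of "a x" "b x"] by simp
    have g0: "0 \<le> ?g x" for x using gap0 Q c by (intro add_nonneg_nonneg divide_nonneg_pos) auto
    have pt: "1 \<le> ?g x" if "d \<le> \<bar>a x - b x\<bar>" for x
    proof (cases "\<bar>a x\<bar> \<le> R \<and> \<bar>b x\<bar> \<le> R")
      case True
      then have "1 \<le> ?gap x / c" using c that by simp
      moreover have "0 \<le> (\<bar>a x\<bar> powr p + \<bar>b x\<bar> powr p) / Q" using Q by simp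
      ultimately show ?thesis by linarith
    next
      case False
      then have "R powr p \<le> \<bar>a x\<bar> powr p \<or> R powr p \<le> \<bar>b x\<bar> powr p"
        using R assms by (auto intro!: powr_mono2)
      then have "Q \<le> \<bar>a x\<bar> powr p + \<bar>b x\<bar> powr p" unfolding R
        by (smt (verit) powr_ge_zero)
      then have "1 \<le> (\<bar>a x\<bar> powr p + \<bar>b x\<bar> powr p) / Q" using Q by simp
      moreover have "0 \<le> ?gap x / c" using gap0 c by (intro divide_nonneg_pos) auto
      ultimately show ?thesis by linarith
    qed
    have "emeasure M ?A = (\<integral>\<^sup>+x. indicator ?A x \<partial>M)" by simp
    also have "\<dots> \<le> (\<integral>\<^sup>+x. ennreal (?g x) \<partial>M)"
      using pt g0 by (intro nn_integral_mono) (auto simp: indicator_def simp flip: ennreal_1 intro!: ennreal_leI)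
    also have "\<dots> = ennreal (LINT x|M. ?g x)"
      using int g0 by (intro nn_integral_eq_integral) auto
    also have "(LINT x|M. ?g x) = ((LINT x|M. \<bar>a x\<bar> powr p) + (LINT x|M. \<bar>b x\<bar> powr p)) / Q +
        (((LINT x|M. \<bar>a x\<bar> powr p) + (LINT x|M. \<bar>b x\<bar> powr p)) / 2
      - (LINT x|M. \<bar>(a x + b x) / 2\<bar> powr p)) / c"
      using int by simp
    also have "\<dots> \<le> 2 * \<bar>K\<bar> / Q + (c * e / 2) / c"
      using Lp_ballD(3)[OF a] Lp_ballD(3)[OF b] gap Q c by (intro add_mono divide_right_mono) auto
    also have "\<dots> \<le> e"
    proof -
      have "2 * \<bar>K\<bar> / Q \<le> e / 2" using assms by (auto simp: Q_def field_simps)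
      then show ?thesis using c by simp
    qed
    finally show "emeasure M ?A \<le> ennreal e" by (simp add: ennreal_leI)
  qed
qed

lemma AE_eventually_less_half_power:
  fixes u :: "nat \<Rightarrow> 'a \<Rightarrow> real"
  assumes [measurable]: "\<And>n. u n \<in> borel_measurable M"
    and le: "\<And>n. emeasure M {x \<in> space M. (1/2)^n \<le> \<bar>u n x\<bar>} \<le> ennreal ((1/2)^n)"
  shows "AE x in M. eventually (\<lambda>n. \<bar>u n x\<bar> < (1/2)^n) sequentially"
proof -
  have "AE x in M. eventually (\<lambda>n. x \<in> space M - {x \<in> space M. (1/2)^n \<le> \<bar>u n x\<bar>}) sequentially"
  proof (rule borel_cantelli_AE1)
    show "emeasure M {x \<in> space M. (1/2)^n \<le> \<bar>u n x\<bar>} < \<infinity>" for n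
      using le[of n] by (auto simp: less_top[symmetric] top_unique)
    show "summable (\<lambda>n. measure M {x \<in> space M. (1/2)^n \<le> \<bar>u n x\<bar>})"
    proof (rule summable_comparison_test')
      show "summable (\<lambda>n. (1/2::real)^n)" by (simp add: summable_geometric)
      show "norm (measure M {x \<in> space M. (1/2)^n \<le> \<bar>u n x\<bar>}) \<le> (1/2)^n" for n
        using le[of n] by (auto simp: measure_def enn2real_leI)
    qed
  qed measurable
  then show ?thesis by (auto elim!: eventually_mono)
qed

text \<open>Fatou's lemma applied to |hs n|^p.\<close>

lemma Lp_ball_AE_limit:
  assumes h: "\<And>n. hs n \<in> Lp_ball M p K" and [measurable]: "h \<in> borel_measurable M"
    and lim: "AE x in M. (\<lambda>n. hs n x) \<longlonglongrightarrow> h x" and p: "0 < p"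
  shows "h \<in> Lp_ball M p K"
proof -
  note [measurable] = Lp_ballD(1)[OF h]
  have "0 \<le> (LINT x|M. \<bar>hs 0 x\<bar> powr p)" by (intro integral_nonneg_AE) auto
  then have K: "0 \<le> K" using Lp_ballD(3)[OF h[of 0]] by linarith
  have "(\<integral>\<^sup>+x. ennreal (\<bar>h x\<bar> powr p) \<partial>M) \<le> (\<integral>\<^sup>+x. liminf (\<lambda>n. ennreal (\<bar>hs n x\<bar> powr p)) \<partial>M)"
    using lim
  proof (intro nn_integral_mono_AE, eventually_elim)
    case (elim x)
    have "(\<lambda>n. \<bar>hs n x\<bar> powr p) \<longlonglongrightarrow> \<bar>h x\<bar> powr p"
      using elim p by (intro tendsto_powr' tendsto_intros) auto
    then have "(\<lambda>n. ennreal (\<bar>hs n x\<bar> powr p)) \<longlonglongrightarrow> ennreal (\<bar>h x\<bar> powr p)" by (rule tendsto_ennrealI)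
    then show ?case 
      by (simp only: lim_imp_Liminf[OF sequentially_bot] order_refl)
  qed
  also have "\<dots> \<le> liminf (\<lambda>n. (\<integral>\<^sup>+x. ennreal (\<bar>hs n x\<bar> powr p) \<partial>M))"
    by (intro nn_integral_liminf) measurable
  also have "\<dots> \<le> ennreal K"
  proof -
    have "(\<integral>\<^sup>+x. ennreal (\<bar>hs n x\<bar> powr p) \<partial>M) \<le> ennreal K" for n
      using Lp_ballD[OF h[of n]] by (subst nn_integral_eq_integral) (auto intro!: ennreal_leI)
    then show ?thesis by (intro Liminf_le) auto
  qed
  finally have le: "(\<integral>\<^sup>+x. ennreal (\<bar>h x\<bar> powr p) \<partial>M) \<le> ennreal K" .
  have i: "integrable M (\<lambda>x. \<bar>h x\<bar> powr p)"
  proof (rule integrableI_bounded)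
    show "(\<integral>\<^sup>+x. ennreal (norm (\<bar>h x\<bar> powr p)) \<partial>M) < \<infinity>"
      using le_less_trans[OF le ennreal_less_top] by simp
  qed measurable
  moreover have "(LINT x|M. \<bar>h x\<bar> powr p) \<le> K"
    using le K nn_integral_eq_integral[OF i] by (simp add: ennreal_le_iff)
  ultimately show ?thesis by (simp add: Lp_ball_def)
qed

lemma Lp_set_integrable:
  fixes h :: "'a \<Rightarrow> real"
  assumes [measurable]: "h \<in> borel_measurable M" and "integrable M (\<lambda>x. \<bar>h x\<bar> powr p)" "1 < p"
    and [measurable]: "A \<in> sets M" and "emeasure M A < \<infinity>"
  shows "set_integrable M A h"
  unfolding set_integrable_def
proof (rule Bochner_Integration.integrable_bound)
  show "integrable M (\<lambda>x. indicator A x + \<bar>h x\<bar> powr p)"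
    using assms by (intro Bochner_Integration.integrable_add integrable_real_indicator) auto
  have "\<bar>h x\<bar> \<le> 1 + \<bar>h x\<bar> powr p" for x
    using le_const_add_powr[of p 1 "\<bar>h x\<bar>"] assms by simp
  then show "AE x in M. norm (indicat_real A x *\<^sub>R h x) \<le> norm (indicator A x + \<bar>h x\<bar> powr p)"
    by (auto simp: indicator_def)
qed simp

text \<open>A bound in L_p with p > 1 supplies uniform integrability: differences truncated at R
  converge by dominated convergence on a set of finite measure, and the excess is at most R^(1-p)
  times the integral of the p-th power.\<close>

lemma Lp_ball_tendsto_L1:
  assumes h: "\<And>n. hs n \<in> Lp_ball M p K" "h \<in> Lp_ball M p K"
    and lim: "AE x in M. (\<lambda>n. hs n x) \<longlonglongrightarrow> h x" and p: "1 < p"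
    and [measurable]: "A \<in> sets M" and fin: "emeasure M A < \<infinity>"
  shows "(\<lambda>n. LINT x:A|M. \<bar>hs n x - h x\<bar>) \<longlonglongrightarrow> 0"
proof (rule LIMSEQ_I)
  note [measurable] = Lp_ballD(1)[OF h(1)] Lp_ballD(1)[OF h(2)]
  fix e :: real assume e: "0 < e"
  have neg: "(\<lambda>x. - h x) \<in> Lp_ball M p K" using h(2) by (simp add: Lp_ball_def)
  have mid: "(\<lambda>x. (hs n x + (- h x)) / 2) \<in> Lp_ball M p K" for n
    by (rule Lp_ball_midpoint[OF p h(1) neg])
  \<comment> \<open>Half of the difference is the midpoint of \<open>hs n\<close> and - h, so it
    lies in the ball; undoing the factor 1/2 costs 2^p.\<close>
  define P where "P = 2 powr p * (\<bar>K\<bar> + 1)"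
  have P: "0 < P" by (simp add: P_def add_nonneg_pos)
  have dn: "integrable M (\<lambda>x. \<bar>hs n x - h x\<bar> powr p)" "(LINT x|M. \<bar>hs n x - h x\<bar> powr p) \<le> P" for n
  proof -
    have eq: "\<bar>hs n x - h x\<bar> powr p = 2 powr p * \<bar>(hs n x + (- h x)) / 2\<bar> powr p" for x
      by (simp add: powr_mult[symmetric] abs_divide)
    show "integrable M (\<lambda>x. \<bar>hs n x - h x\<bar> powr p)" unfolding eq
      using Lp_ballD(2)[OF mid[of n]] by simp
    show "(LINT x|M. \<bar>hs n x - h x\<bar> powr p) \<le> P" unfolding eq
      using Lp_ballD(3)[OF mid[of n]] by (simp add: P_def mult_left_mono)
  qed
  \<comment> \<open>The solution of R^(1-p) = e / (4 P), so that the excess contributes at most e/4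
    next to the e/2 of the truncated part.\<close>
  define R where "R = (e / (4 * P)) powr (1 / (1 - p))"
  have R: "0 < R" "R powr (1 - p) = e / (4 * P)" using P e p by (auto simp: R_def powr_powr)
  have "(\<lambda>n. LINT x|M. indicator A x * min \<bar>hs n x - h x\<bar> R) \<longlonglongrightarrow> (LINT x|M. 0)"
  proof (rule integral_dominated_convergence[where w = "\<lambda>x. R * indicator A x"])
    show "integrable M (\<lambda>x. R * indicator A x)" using fin by simp
    show "AE x in M. (\<lambda>n. indicator A x * min \<bar>hs n x - h x\<bar> R) \<longlonglongrightarrow> 0"
      using lim
    proof eventually_elim
      case (elim x)
      have "(\<lambda>n. indicator A x * min \<bar>hs n x - h x\<bar> R) \<longlonglongrightarrow> indicator A x * min \<bar>h x - h x\<bar> R"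
        using elim by (intro tendsto_intros)
      then show ?case using R by simp
    qed
    show "AE x in M. norm (indicat_real A x * min \<bar>hs n x - h x\<bar> R) \<le> R * indicator A x" for n
      using R by (auto simp: indicator_def)
  qed measurable
  from LIMSEQ_D[OF this, of "e / 2"] e obtain N where
    N: "\<And>n. n \<ge> N \<Longrightarrow> \<bar>LINT x|M. indicator A x * min \<bar>hs n x - h x\<bar> R\<bar> < e / 2" by auto
  have "\<bar>LINT x:A|M. \<bar>hs n x - h x\<bar>\<bar> < e" if "n \<ge> N" for n
  proof -
    have i1: "integrable M (\<lambda>x. indicator A x * min \<bar>hs n x - h x\<bar> R)"
    proof (rule Bochner_Integration.integrable_bound)
      show "integrable M (\<lambda>x. R * indicator A x)" using fin by simp
      show "AE x in M. norm (indicat_real A x * min \<bar>hs n x - h x\<bar> R) \<le> norm (R * indicator A x)"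
        using R by (auto simp: indicator_def)
    qed measurable
    have "(LINT x:A|M. \<bar>hs n x - h x\<bar>) \<le>
        (LINT x|M. indicator A x * min \<bar>hs n x - h x\<bar> R + R powr (1 - p) * \<bar>hs n x - h x\<bar> powr p)"
      unfolding set_lebesgue_integral_def
    proof (rule integral_mono')
      show "integrable M (\<lambda>x. indicator A x * min \<bar>hs n x - h x\<bar> R + R powr (1 - p) * \<bar>hs n x - h x\<bar> powr p)"
        using i1 dn by simp
      show "indicat_real A x *\<^sub>R \<bar>hs n x - h x\<bar>
          \<le> indicator A x * min \<bar>hs n x - h x\<bar> R + R powr (1 - p) * \<bar>hs n x - h x\<bar> powr p" for x
        using le_const_add_powr[OF p R(1), of "\<bar>hs n x - h x\<bar>"] by (auto simp: indicator_def)
      show "0 \<le> indicator A x * min \<bar>hs n x - h x\<bar> R + R powr (1 - p) * \<bar>hs n x - h x\<bar> powr p" for x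
        using R(1) by (intro add_nonneg_nonneg mult_nonneg_nonneg) simp_all
    qed
    also have "\<dots> = (LINT x|M. indicator A x * min \<bar>hs n x - h x\<bar> R)
        + R powr (1 - p) * (LINT x|M. \<bar>hs n x - h x\<bar> powr p)" using i1 dn by simp
    also have "R powr (1 - p) * (LINT x|M. \<bar>hs n x - h x\<bar> powr p) \<le> e / (4 * P) * P"
      unfolding R using dn e P by (intro mult_left_mono) auto
    also have "e / (4 * P) * P = e / 4" using P by simp
    finally have "(LINT x:A|M. \<bar>hs n x - h x\<bar>) < e" using N[OF that] e by linarith
    moreover have "0 \<le> (LINT x:A|M. \<bar>hs n x - h x\<bar>)"
      unfolding set_lebesgue_integral_def by (intro integral_nonneg_AE) auto
    ultimately show ?thesis by simp
  qed
  then show "\<exists>N. \<forall>n\<ge>N. norm ((LINT x:A|M. \<bar>hs n x - h x\<bar>) - 0) < e" by auto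
qed

lemma Lp_ball_tendsto_set_integral:
  fixes hs :: "nat \<Rightarrow> 'a \<Rightarrow> real"
  assumes h: "\<And>n. hs n \<in> Lp_ball M p K" "h \<in> Lp_ball M p K"
    and lim: "AE x in M. (\<lambda>n. hs n x) \<longlonglongrightarrow> h x" and p: "1 < p"
    and A: "A \<in> sets M" and fin: "emeasure M A < \<infinity>"
  shows "(\<lambda>n. LINT x:A|M. hs n x) \<longlonglongrightarrow> (LINT x:A|M. h x)"
proof -
  have i: "set_integrable M A (hs n)" "set_integrable M A h" for n
    using h A fin p by (auto intro!: Lp_set_integrable dest: Lp_ballD)
  have "\<bar>(LINT x:A|M. hs n x) - (LINT x:A|M. h x)\<bar> \<le> (LINT x:A|M. \<bar>hs n x - h x\<bar>)" for n
    using i set_integral_norm_bound[of M A "\<lambda>x. hs n x - h x"] by (simp add: set_integral_diff)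
  then have "(\<lambda>n. (LINT x:A|M. hs n x) - (LINT x:A|M. h x)) \<longlonglongrightarrow> 0"
    by (intro Lim_null_comparison[OF _ Lp_ball_tendsto_L1[OF assms]]) auto
  then show ?thesis by (simp add: LIM_zero_iff)
qed

text \<open>Near-minimizers of the \<open>L\<^sub>p\<close> norm over larger and larger finite sets of conditions have
  almost maximal norm at their midpoints, so by strict convexity they converge in measure. Adding one
  more condition \<open>i\<close> to each of the finite sets does not change the limit.\<close>

lemma Lp_moment_compactness:
  fixes M :: "'a measure" and \<Lambda> :: "'i \<Rightarrow> ('a \<Rightarrow> real) \<Rightarrow> real" and c :: "'i \<Rightarrow> real"
  assumes p: "1 < p"
    and mid: "\<And>i a b. i \<in> X \<Longrightarrow> a \<in> Lp_ball M p K \<Longrightarrow> b \<in> Lp_ball M p K \<Longrightarrow>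
      \<Lambda> i (\<lambda>x. (a x + b x) / 2) = (\<Lambda> i a + \<Lambda> i b) / 2"
    and cont: "\<And>i hs h. i \<in> X \<Longrightarrow> (\<And>n. hs n \<in> Lp_ball M p K) \<Longrightarrow> h \<in> Lp_ball M p K \<Longrightarrow>
      AE x in M. (\<lambda>n. hs n x) \<longlonglongrightarrow> h x \<Longrightarrow> (\<lambda>n. \<Lambda> i (hs n)) \<longlonglongrightarrow> \<Lambda> i h"
    and fin: "\<And>S. finite S \<Longrightarrow> S \<subseteq> X \<Longrightarrow> \<exists>h\<in>Lp_ball M p K. \<forall>i\<in>S. \<Lambda> i h = c i"
  shows "\<exists>h\<in>Lp_ball M p K. \<forall>i\<in>X. \<Lambda> i h = c i"
proof -
  define N where "N h = (LINT x|M. \<bar>h x\<bar> powr p)" for h :: "'a \<Rightarrow> real"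
  define F where "F S = {h \<in> Lp_ball M p K. \<forall>i\<in>S. \<Lambda> i h = c i}" for S
  define I where "I S = Inf (N ` F S)" for S
  let ?Fin = "{S. finite S \<and> S \<subseteq> X}"
  have N0: "0 \<le> N h" for h unfolding N_def by (intro integral_nonneg_AE) auto
  have NK: "N h \<le> K" if "h \<in> F S" for h S using that by (auto simp: N_def F_def dest: Lp_ballD)
  have Fne: "F S \<noteq> {}" if "S \<in> ?Fin" for S using fin[of S] that by (auto simp: F_def)
  have bb: "bdd_below (N ` F S)" for S using N0 by (intro bdd_belowI[of _ 0]) auto
  have I_le: "I S \<le> N h" if "h \<in> F S" for S h unfolding I_def using bb that by (intro cInf_lower) auto
  have I_mono: "I S \<le> I T" if "S \<subseteq> T" "T \<in> ?Fin" for S T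
  proof -
    have "F T \<subseteq> F S" unfolding F_def using that(1) by blast
    then show ?thesis unfolding I_def
      by (rule cInf_superset_mono[OF _ bb image_mono, rotated]) (simp add: Fne[OF that(2)])
  qed
  have IK: "I S \<le> K" if S: "S \<in> ?Fin" for S
  proof -
    obtain h where "h \<in> F S" using Fne[OF S] by blast
    then show ?thesis using I_le NK order_trans by blast
  qed
  \<comment> \<open>The infima grow with the set of conditions and stay below K, so s is finite and
    is approached along finite sets.\<close>
  define s where "s = Sup (I ` ?Fin)"
  have bs: "bdd_above (I ` ?Fin)" using IK by (intro bdd_aboveI[of _ K]) auto
  have Is: "I S \<le> s" if "S \<in> ?Fin" for S unfolding s_def using that bs by (intro cSup_upper) auto
  have "\<forall>n. \<exists>\<eta>>0. \<forall>a\<in>Lp_ball M p K. \<forall>b\<in>Lp_ball M p K. (N a + N b) / 2 - N (\<lambda>x. (a x + b x) / 2) \<le> \<eta> \<longrightarrow>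
    emeasure M {x \<in> space M. (1/2)^n \<le> \<bar>a x - b x\<bar>} \<le> ennreal ((1/2)^n)"
    unfolding N_def using p by (intro allI emeasure_abs_diff_ge_le) simp_all
  from choice[OF this] obtain \<epsilon> :: "nat \<Rightarrow> real" where \<epsilon>: "\<And>n. 0 < \<epsilon> n"
    "\<And>n a b. a \<in> Lp_ball M p K \<Longrightarrow> b \<in> Lp_ball M p K \<Longrightarrow>
      (N a + N b) / 2 - N (\<lambda>x. (a x + b x) / 2) \<le> \<epsilon> n \<Longrightarrow>
      emeasure M {x \<in> space M. (1/2)^n \<le> \<bar>a x - b x\<bar>} \<le> ennreal ((1/2)^n)" by blast
  \<comment> \<open>Half, because at a midpoint the average is below s + \<eta> and the value above
    s - \<eta>, a defect of less than 2 \<eta>. The minimum over \<open>{..n}\<close> makes \<eta>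
    decreasing, so that a near-minimizer of stage n + 1 also counts at stage n.\<close>
  define \<eta> where "\<eta> n = Min (\<epsilon> ` {..n}) / 2" for n
  have \<eta>0: "0 < \<eta> n" for n unfolding \<eta>_def using \<epsilon>(1) by (auto simp: Min_gr_iff)
  have \<eta>\<epsilon>: "2 * \<eta> n \<le> \<epsilon> n" for n unfolding \<eta>_def by auto
  have \<eta>mono: "\<eta> (Suc n) \<le> \<eta> n" for n unfolding \<eta>_def by (intro divide_right_mono Min_antimono) auto
  have "\<forall>n. \<exists>S. S \<in> ?Fin \<and> s - \<eta> n < I S"
  proof
    fix n
    have "s - \<eta> n < Sup (I ` ?Fin)" "I ` ?Fin \<noteq> {}" using \<eta>0[of n] by (simp_all add: s_def, blast)
    from less_cSupD[OF this(2,1)] show "\<exists>S. S \<in> ?Fin \<and> s - \<eta> n < I S" by blast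
  qed
  from choice[OF this] obtain T where T: "\<And>n. T n \<in> ?Fin" "\<And>n. s - \<eta> n < I (T n)" by blast
  \<comment> \<open>Unions make the finite sets increase, so that \<open>hs (Suc n)\<close> also
    meets the conditions of stage n.\<close>
  define S where "S n = (\<Union>j\<le>n. T j)" for n
  have S: "S n \<in> ?Fin" for n using T(1) unfolding S_def by auto
  have IS: "s - \<eta> n < I (S n)" for n
  proof -
    have "T n \<subseteq> S n" by (auto simp: S_def)
    from I_mono[OF this S] show ?thesis using T(2)[of n] by linarith
  qed
  have near: "\<exists>h\<in>F U. N h < s + \<eta> n" if U: "U \<in> ?Fin" for U n
  proof -
    have "Inf (N ` F U) < s + \<eta> n" using Is[OF U] \<eta>0[of n] unfolding I_def by linarith
    then show ?thesis using cInf_less_iff[of "N ` F U" "s + \<eta> n"] Fne[OF U] bb by auto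
  qed
  have close: "emeasure M {x \<in> space M. (1/2)^n \<le> \<bar>a x - b x\<bar>} \<le> ennreal ((1/2)^n)"
    if a: "a \<in> F (S n)" "N a < s + \<eta> n" and b: "b \<in> F (S n)" "N b < s + \<eta> n" for a b n
  proof (rule \<epsilon>(2))
    have B: "a \<in> Lp_ball M p K" "b \<in> Lp_ball M p K" using a b by (auto simp: F_def)
    have "\<Lambda> i (\<lambda>x. (a x + b x) / 2) = c i" if i: "i \<in> S n" for i
    proof -
      have "i \<in> X" using S[of n] i by auto
      from mid[OF this B] show ?thesis using a(1) b(1) i by (simp add: F_def)
    qed
    then have "(\<lambda>x. (a x + b x) / 2) \<in> F (S n)"
      using Lp_ball_midpoint[OF p B] by (simp add: F_def)
    then have "s - \<eta> n < N (\<lambda>x. (a x + b x) / 2)" using IS[of n] I_le by force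
    then show "(N a + N b) / 2 - N (\<lambda>x. (a x + b x) / 2) \<le> \<epsilon> n" using a b \<eta>\<epsilon>[of n] by argo
  qed (use a b in \<open>auto simp: F_def\<close>)
  have "\<forall>n. \<exists>h. h \<in> F (S n) \<and> N h < s + \<eta> n" using near[OF S] by blast
  from choice[OF this] obtain hs where
    hs: "\<And>n. hs n \<in> F (S n)" "\<And>n. N (hs n) < s + \<eta> n" by blast
  have hsB: "hs n \<in> Lp_ball M p K" for n using hs(1) by (auto simp: F_def)
  note [measurable] = Lp_ballD(1)[OF hsB]
  have "AE x in M. eventually (\<lambda>n. \<bar>hs (Suc n) x - hs n x\<bar> < (1/2)^n) sequentially"
  proof (rule AE_eventually_less_half_power)
    fix n
    have "hs (Suc n) \<in> F (S n)" using hs(1)[of "Suc n"] by (auto simp: F_def S_def)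
    moreover have "N (hs (Suc n)) < s + \<eta> n" using hs(2)[of "Suc n"] \<eta>mono[of n] by linarith
    ultimately show "emeasure M {x \<in> space M. (1/2)^n \<le> \<bar>hs (Suc n) x - hs n x\<bar>} \<le> ennreal ((1/2)^n)"
      using hs by (intro close)
  qed measurable
  then have conv: "AE x in M. convergent (\<lambda>n. hs n x)"
  proof eventually_elim
    case (elim x)
    have "summable (\<lambda>n. hs (Suc n) x - hs n x)"
      by (rule summable_comparison_test_ev[where g = "\<lambda>n. (1/2)^n"])
        (use elim in \<open>auto elim!: eventually_mono simp: summable_geometric\<close>)
    then have "convergent (\<lambda>n. \<Sum>k<n. hs (Suc k) x - hs k x)" by (simp add: summable_iff_convergent)
    then have "convergent (\<lambda>n. hs n x - hs 0 x)" 
      by (subst (asm) sum_lessThan_telescope[of "\<lambda>n. hs n x"])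
    then show ?case using convergent_diff_const_right_iff[of "\<lambda>n. hs n x" "hs 0 x"] by simp
  qed
  define h where "h x = lim (\<lambda>n. hs n x)" for x
  have [measurable]: "h \<in> borel_measurable M" unfolding h_def by measurable
  have lim: "AE x in M. (\<lambda>n. hs n x) \<longlonglongrightarrow> h x"
    using conv by eventually_elim (simp add: h_def convergent_LIMSEQ_iff)
  have hB: "h \<in> Lp_ball M p K" using p by (intro Lp_ball_AE_limit[OF hsB _ lim]) auto
  have "\<Lambda> i h = c i" if i: "i \<in> X" for i
  proof -
    \<comment> \<open>The competitors \<open>ks n\<close> satisfy condition i exactly and are still
      near-minimizers for \<open>S n\<close>; being close to \<open>hs n\<close> they share the
      limit h, and continuity of \<open>\<Lambda> i\<close> transfers the condition.\<close>
    have U: "insert i (S n) \<in> ?Fin" for n using S i by auto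
    have "\<forall>n. \<exists>h. h \<in> F (insert i (S n)) \<and> N h < s + \<eta> n" using near[OF U] by blast
    from choice[OF this] obtain ks where
      ks: "\<And>n. ks n \<in> F (insert i (S n))" "\<And>n. N (ks n) < s + \<eta> n" by blast
    have ksB: "ks n \<in> Lp_ball M p K" for n using ks(1) by (auto simp: F_def)
    note [measurable] = Lp_ballD(1)[OF ksB]
    have "AE x in M. eventually (\<lambda>n. \<bar>ks n x - hs n x\<bar> < (1/2)^n) sequentially"
    proof (rule AE_eventually_less_half_power)
      fix n
      have "ks n \<in> F (S n)" using ks(1)[of n] by (auto simp: F_def)
      then show "emeasure M {x \<in> space M. (1/2)^n \<le> \<bar>ks n x - hs n x\<bar>} \<le> ennreal ((1/2)^n)"
        using hs ks by (intro close)
    qed measurable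
    then have "AE x in M. (\<lambda>n. ks n x) \<longlonglongrightarrow> h x"
      using lim
    proof eventually_elim
      case (elim x)
      have "(\<lambda>n. ks n x - hs n x) \<longlonglongrightarrow> 0"
        by (rule Lim_null_comparison[where g = "\<lambda>n. (1/2)^n"])
          (use elim in \<open>auto elim!: eventually_mono intro!: LIMSEQ_power_zero\<close>)
      from tendsto_add[OF this elim(2)] show ?case by simp
    qed
    then have "(\<lambda>n. \<Lambda> i (ks n)) \<longlonglongrightarrow> \<Lambda> i h" by (intro cont i ksB hB)
    moreover have "\<Lambda> i (ks n) = c i" for n using ks(1)[of n] by (auto simp: F_def)
    ultimately show ?thesis by (simp add: LIMSEQ_const_iff)
  qed
  then show ?thesis using hB by blast
qed

section \<open>Weak derivatives on the line\<close>

lemma integrable_continuous_vanishing: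
  fixes f :: "real \<Rightarrow> real"
  assumes "continuous_on UNIV f" "\<And>x. x \<notin> {A..B} \<Longrightarrow> f x = 0"
  shows "integrable lborel f"
proof -
  have "integrable lborel (\<lambda>x. indicator {A..B} x *\<^sub>R f x)"
    by (intro borel_integrable_compact continuous_on_subset[OF assms(1)]) auto
  moreover have "(\<lambda>x. indicator {A..B} x *\<^sub>R f x) = f"
  proof
    fix x show "indicator {A..B} x *\<^sub>R f x = f x" using assms(2)[of x] by (cases "x \<in> {A..B}") auto
  qed
  ultimately show ?thesis by simp
qed

text \<open>Substituting x = a + y / (n + 1) moves the scaling into u. As \<rho> lives on [0, 1],
  the mass sits to the right of a and a bound for u on [a, a + 1] gives domination.\<close>

lemma mollifier_tendsto:
  fixes u \<rho> :: "real \<Rightarrow> real"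
  assumes u: "continuous_on UNIV u" and \<rho>: "continuous_on UNIV \<rho>" "\<And>x. x \<notin> {0..1} \<Longrightarrow> \<rho> x = 0"
  shows "(\<lambda>n. LINT x|lborel. u x * (real (Suc n) * \<rho> (real (Suc n) * x + - real (Suc n) * a)))
    \<longlonglongrightarrow> u a * (LINT x|lborel. \<rho> x)"
proof -
  have [measurable]: "u \<in> borel_measurable borel" "\<rho> \<in> borel_measurable borel"
    using u \<rho> by (auto intro: borel_measurable_continuous_onI)
  have eq: "(LINT x|lborel. u x * (real (Suc n) * \<rho> (real (Suc n) * x + - real (Suc n) * a))) =
      (LINT x|lborel. u (a + (1 / real (Suc n)) * x) * \<rho> x)" for n
  proof -
    let ?c = "real (Suc n)"
    have "(LINT x|lborel. u x * (?c * \<rho> (?c * x + - ?c * a))) =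
        \<bar>1 / ?c\<bar> *\<^sub>R (LINT x|lborel. u (a + (1 / ?c) * x) * (?c * \<rho> (?c * (a + (1 / ?c) * x) + - ?c * a)))"
      by (rule lborel_integral_real_affine) simp
    also have "(\<lambda>x. u (a + (1 / ?c) * x) * (?c * \<rho> (?c * (a + (1 / ?c) * x) + - ?c * a))) =
        (\<lambda>x. ?c * (u (a + (1 / ?c) * x) * \<rho> x))"
    proof
      fix x
      have "?c * (a + (1 / ?c) * x) + - ?c * a = x" by (simp add: field_simps del: of_nat_Suc)
      then show "u (a + (1 / ?c) * x) * (?c * \<rho> (?c * (a + (1 / ?c) * x) + - ?c * a)) =
        ?c * (u (a + (1 / ?c) * x) * \<rho> x)" by (simp only: mult_ac)
    qed
    finally show ?thesis by (simp del: of_nat_Suc)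
  qed
  have "\<exists>M. \<forall>y\<in>{a..a+1}. norm (u y) \<le> M"
  proof -
    have "compact (u ` {a..a+1})" by (intro compact_continuous_image continuous_on_subset[OF u]) auto
    from compact_imp_bounded[OF this] show ?thesis unfolding bounded_iff by auto
  qed
  then obtain M where "\<forall>y\<in>{a..a+1}. norm (u y) \<le> M" ..
  then have M: "\<bar>u y\<bar> \<le> M" if "y \<in> {a..a+1}" for y using that by simp
  have "(\<lambda>n. LINT x|lborel. u (a + (1 / real (Suc n)) * x) * \<rho> x) \<longlonglongrightarrow> (LINT x|lborel. u a * \<rho> x)"
  proof (rule integral_dominated_convergence[where w = "\<lambda>x. M * \<bar>\<rho> x\<bar>"])
    have "integrable lborel \<rho>" using \<rho> by (rule integrable_continuous_vanishing)
    then show "integrable lborel (\<lambda>x. M * \<bar>\<rho> x\<bar>)" by simp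
    have "(\<lambda>n. u (a + (1 / real (Suc n)) * x) * \<rho> x) \<longlonglongrightarrow> u a * \<rho> x" for x
    proof (rule tendsto_mult_right)
      have "(\<lambda>n. a + (1 / real (Suc n)) * x) \<longlonglongrightarrow> a + 0 * x"
        by (intro tendsto_intros lim_1_over_n[THEN LIMSEQ_Suc])
      moreover have "isCont u a" using u by (simp add: continuous_on_eq_continuous_at)
      ultimately show "(\<lambda>n. u (a + (1 / real (Suc n)) * x)) \<longlonglongrightarrow> u a"
        using isCont_tendsto_compose[of a u "\<lambda>n. a + (1 / real (Suc n)) * x" sequentially] by simp
    qed
    then show "AE x in lborel. (\<lambda>n. u (a + (1 / real (Suc n)) * x) * \<rho> x) \<longlonglongrightarrow> u a * \<rho> x" by simp
    have "norm (u (a + (1 / real (Suc n)) * x) * \<rho> x) \<le> M * \<bar>\<rho> x\<bar>" for n x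
    proof (cases "x \<in> {0..1}")
      case True
      then have "0 \<le> (1 / real (Suc n)) * x" "(1 / real (Suc n)) * x \<le> 1"
        by (auto simp: field_simps intro: order_trans[OF _ le_add_same_cancel1[THEN iffD2]])
      then have "\<bar>u (a + (1 / real (Suc n)) * x)\<bar> \<le> M" by (intro M) auto
      then show ?thesis by (simp add: abs_mult mult_right_mono)
    qed (use \<rho> in auto)
    then show "AE x in lborel. norm (u (a + (1 / real (Suc n)) * x) * \<rho> x) \<le> M * \<bar>\<rho> x\<bar>" for n by simp
  qed measurable
  then show ?thesis unfolding eq by simp
qed

lemma measurable_ident_lebesgue: "(\<lambda>x::real. x) \<in> borel_measurable lebesgue"
  by (rule measurable_completion) simp

lemma locally_integrable_measurable:
  assumes "locally_integrable g"
  shows "g \<in> borel_measurable lebesgue"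
proof (rule borel_measurable_LIMSEQ_real)
  show "(\<lambda>x. indicator {- real n..real n} x * g x) \<in> borel_measurable lebesgue" for n
    using borel_measurable_integrable[OF assms[unfolded locally_integrable_def set_integrable_def,
      rule_format, of "- real n" "real n"]] by simp
  fix x :: real
  obtain N where N: "\<bar>x\<bar> < real N" using reals_Archimedean2 by blast
  have "indicator {- real n..real n} x * g x = g x" if "n \<ge> N" for n
    using that N by (auto simp: indicator_def)
  then show "(\<lambda>n. indicator {- real n..real n} x * g x) \<longlonglongrightarrow> g x"
    by (intro tendsto_eventually) (auto simp: eventually_sequentially)
qed

text \<open>Test functions increasing from 0 to 1 next to \<open>a\<close> and decreasing to 0 next to \<open>b\<close> approximate
  the indicator of \<open>(a, b]\<close>, while their derivatives approximate a difference of point masses.\<close>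

lemma weak_derivative_increment:
  assumes wd: "has_weak_derivative m F g" "m \<ge> 1"
    and chain: "deriv_chain (m - 1) (\<lambda>k. (deriv ^^ k) F)"
    and cont: "continuous_on UNIV ((deriv ^^ (m - 1)) F)"
    and ab: "a \<le> b"
  shows "(deriv ^^ (m - 1)) F b - (deriv ^^ (m - 1)) F a = (LINT x:{a..b}|lebesgue. g x)"
proof -
  obtain \<Theta> where \<Theta>: "\<And>n. deriv_chain n \<Theta>" "\<And>x. x \<le> 0 \<Longrightarrow> \<Theta> 0 x = 0" "\<And>x. 1 \<le> x \<Longrightarrow> \<Theta> 0 x = (1::real)"
    "\<And>k x. x \<le> 0 \<or> 1 \<le> x \<Longrightarrow> \<Theta> (Suc k) x = 0" "\<And>x. 0 \<le> \<Theta> 0 x" "\<And>x. \<Theta> 0 x \<le> 1"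
    using ex_smooth_step by blast
  let ?u = "(deriv ^^ (m - 1)) F"
  let ?\<rho> = "\<Theta> (Suc 0)"
  \<comment> \<open>The steps climb on intervals of length 1 / (n + 1) to the right of a and of b.
    Both on the right side: therefore the pointwise limit excludes a and includes b.\<close>
  define v where "v n k x = real (Suc n) ^ k * \<Theta> k (real (Suc n) * x + - real (Suc n) * a)
    - real (Suc n) ^ k * \<Theta> k (real (Suc n) * x + - real (Suc n) * b)" for n k x
  have \<rho>: "continuous_on UNIV ?\<rho>" using deriv_chain_continuous_on[OF \<Theta>(1)[of 2], of 1] by simp
  have \<rho>0: "?\<rho> x = 0" if "x \<notin> {0..1}" for x using that \<Theta>(4)[of x 0] by auto
  have intrho: "(LINT x|lborel. ?\<rho> x) = 1"
  proof -
    have "(LINT x|lborel. ?\<rho> x) = (LINT x|lborel. indicator {0..1} x *\<^sub>R ?\<rho> x)"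
    proof (rule Bochner_Integration.integral_cong[OF refl])
      fix x show "?\<rho> x = indicator {0..1} x *\<^sub>R ?\<rho> x" using \<rho>0[of x] by (cases "x \<in> {0..1}") auto
    qed
    also have "\<dots> = \<Theta> 0 1 - \<Theta> 0 0"
    proof (rule integral_FTC_atLeastAtMost)
      show "(\<Theta> 0 has_vector_derivative ?\<rho> x) (at x within {0..1})" for x
        using deriv_chainD[OF \<Theta>(1)[of 1], of 0 x]
        by (simp add: has_real_derivative_iff_has_vector_derivative has_vector_derivative_at_within)
    qed (auto intro: continuous_on_subset[OF \<rho>])
    finally show ?thesis using \<Theta>(2)[of 0] \<Theta>(3)[of 1] by simp
  qed
  have chv: "deriv_chain k (v n)" for k n
    unfolding v_def by (intro deriv_chain_diff deriv_chain_affine \<Theta>(1))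
  have scale: "real (Suc n) * x + - real (Suc n) * y = real (Suc n) * (x - y)" for n x y
    by (simp add: algebra_simps)
  have pos: "0 < real (Suc n)" for n by simp
  have step: "real (Suc n) * (x - y) \<le> 0" if "x \<le> y" for n x y
    using that pos[of n] by (intro mult_nonneg_nonpos) auto
  have step1: "1 \<le> real (Suc n) * (x - y)" if "y + 1 \<le> x" for n x y
    using that mult_mono[of 1 "real (Suc n)" 1 "x - y"] by simp
  have v0: "v n k x = 0" if "x \<notin> {a - 1<..<b + 2}" for n k x
  proof (cases "x \<le> a")
    case True
    then show ?thesis using step[of x a n] step[of x b n] ab \<Theta>(2) \<Theta>(4)
      unfolding v_def scale by (cases k) auto
  next
    case False
    then have "b + 1 \<le> x" "a + 1 \<le> x" using that ab by auto
    then show ?thesis using step1[of a x n] step1[of b x n] \<Theta>(3) \<Theta>(4)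
      unfolding v_def scale by (cases k) auto
  qed
  have eq: "(LINT x|lborel. ?u x * v n 1 x) = - (LINT x|lebesgue. g x * v n 0 x)" for n
    using ab by (intro weak_derivative_first_order[OF wd chain cont chv _ v0]) auto
  have loc: "locally_integrable g" using wd by (simp add: has_weak_derivative_def)
  note [measurable] = locally_integrable_measurable[OF loc] measurable_ident_lebesgue
  have lim1: "(\<lambda>n. LINT x|lborel. ?u x * v n 1 x) \<longlonglongrightarrow> ?u a - ?u b"
  proof -
    let ?w = "\<lambda>n y x. ?u x * (real (Suc n) * ?\<rho> (real (Suc n) * x + - real (Suc n) * y))"
    have i: "integrable lborel (?w n y)" for n y
    proof (rule integrable_continuous_vanishing)
      show "continuous_on UNIV (?w n y)"
        by (intro continuous_on_mult cont continuous_on_const continuous_on_compose2[OF \<rho>] continuous_intros) auto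
      show "?w n y x = 0" if "x \<notin> {y..y+1}" for x
      proof -
        have "real (Suc n) * (x - y) \<le> 0 \<or> 1 \<le> real (Suc n) * (x - y)"
          using that step[of x y n] step1[of y x n] by auto
        then show ?thesis unfolding scale using \<Theta>(4) by simp
      qed
    qed
    have "(LINT x|lborel. ?u x * v n 1 x) = (LINT x|lborel. ?w n a x) - (LINT x|lborel. ?w n b x)" for n
      unfolding Bochner_Integration.integral_diff[OF i i, symmetric]
      by (simp add: v_def right_diff_distrib)
    then show ?thesis
      using tendsto_diff[OF mollifier_tendsto[OF cont \<rho> \<rho>0, of a] mollifier_tendsto[OF cont \<rho> \<rho>0, of b]]
      by (simp add: intrho)
  qed
  have lim2: "(\<lambda>n. LINT x|lebesgue. g x * v n 0 x) \<longlonglongrightarrow> (LINT x|lebesgue. indicator {a<..b} x * g x)"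
  proof (rule integral_dominated_convergence[where w = "\<lambda>x. \<bar>indicator {a-1..b+2} x * g x\<bar>"])
    have gi: "integrable lebesgue (\<lambda>x. indicator {a-1..b+2} x * g x)"
      using loc by (simp add: locally_integrable_def set_integrable_def)
    then show "integrable lebesgue (\<lambda>x. \<bar>indicator {a-1..b+2} x * g x\<bar>)" by simp
    show "(\<lambda>x. indicator {a<..b} x * g x) \<in> borel_measurable lebesgue" by measurable
    have vb: "\<bar>v n 0 x\<bar> \<le> 1" for n x
      using \<Theta>(5)[of "real (Suc n) * (x - a)"] \<Theta>(5)[of "real (Suc n) * (x - b)"]
        \<Theta>(6)[of "real (Suc n) * (x - a)"] \<Theta>(6)[of "real (Suc n) * (x - b)"]
      unfolding v_def scale by (simp add: abs_le_iff)
    have geq: "g x * v n 0 x = (indicator {a-1..b+2} x * g x) * v n 0 x" for n x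
      using v0[of x n 0] by (cases "x \<in> {a-1..b+2}") auto
    have "v n 0 \<in> borel_measurable borel" for n
      using deriv_chain_continuous_on[OF chv[of 1], of 0] by (intro borel_measurable_continuous_onI) auto
    then have [measurable]: "v n 0 \<in> borel_measurable lebesgue" for n
      by (auto intro: measurable_completion)
    show "(\<lambda>x. g x * v n 0 x) \<in> borel_measurable lebesgue" for n unfolding geq by measurable
    show "AE x in lebesgue. norm (g x * v n 0 x) \<le> \<bar>indicator {a-1..b+2} x * g x\<bar>" for n
      unfolding geq using vb mult_left_mono[OF vb] by (auto simp: abs_mult)
    have "(\<lambda>n. v n 0 x) \<longlonglongrightarrow> indicator {a<..b} x" for x
    proof -
      have lim1: "(\<lambda>n. \<Theta> 0 (real (Suc n) * (x - y))) \<longlonglongrightarrow> (if x \<le> y then 0 else 1)" for y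
      proof (cases "x \<le> y")
        case True
        then show ?thesis using \<Theta>(2) step[OF True] by simp
      next
        case False
        obtain N where N: "1 / (x - y) < real N" using reals_Archimedean2 by blast
        have "\<Theta> 0 (real (Suc n) * (x - y)) = 1" if "n \<ge> N" for n
        proof (rule \<Theta>(3))
          have "1 / (x - y) \<le> real (Suc n)" using N that by linarith
          then show "1 \<le> real (Suc n) * (x - y)" using False by (simp add: divide_le_eq)
        qed
        then have "eventually (\<lambda>n. \<Theta> 0 (real (Suc n) * (x - y)) = 1) sequentially"
          by (auto simp: eventually_sequentially)
        then show ?thesis using False by (simp add: tendsto_eventually)
      qed
      have "(\<lambda>n. v n 0 x) \<longlonglongrightarrow> (if x \<le> a then 0 else 1) - (if x \<le> b then 0 else 1)"
        unfolding v_def scale by (simp only: power_0 mult_1) (intro tendsto_diff lim1)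
      also have "(if x \<le> a then 0 else 1) - (if x \<le> b then 0 else 1) = (indicator {a<..b} x :: real)"
        using ab by auto
      finally show ?thesis .
    qed
    then have "(\<lambda>n. g x * v n 0 x) \<longlonglongrightarrow> g x * indicator {a<..b} x" for x by (intro tendsto_intros)
    then show "AE x in lebesgue. (\<lambda>n. g x * v n 0 x) \<longlonglongrightarrow> indicator {a<..b} x * g x"
      by (simp add: mult.commute)
  qed
  have "?u a - ?u b = - (LINT x|lebesgue. indicator {a<..b} x * g x)"
    using LIMSEQ_unique[OF lim1[unfolded eq] tendsto_minus[OF lim2]] .
  moreover have "(LINT x|lebesgue. indicator {a<..b} x * g x) = (LINT x:{a..b}|lebesgue. g x)"
    unfolding set_lebesgue_integral_def
  proof (rule integral_cong_AE)
    have "AE x in lebesgue. x \<noteq> a" by (rule AE_completion[OF AE_lborel_singleton])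
    then show "AE x in lebesgue. indicator {a<..b} x * g x = indicator {a..b} x *\<^sub>R g x"
      by eventually_elim (auto simp: indicator_def)
  qed measurable
  ultimately show ?thesis by simp
qed

section \<open>Functions determined by their interval integrals\<close>

text \<open>On [-N, N] the positive and negative parts of d are densities of finite measures that
  agree on all rays, hence are equal almost everywhere. As one of the two is always 0, both
  vanish.\<close>

lemma AE_eq_0_if_interval_integrals_eq_0:
  fixes d :: "real \<Rightarrow> real"
  assumes [measurable]: "d \<in> borel_measurable borel"
    and int: "\<And>a b. set_integrable lborel {a..b} d"
    and zero: "\<And>a b. a \<le> b \<Longrightarrow> (LINT x:{a..b}|lborel. d x) = 0"
  shows "AE x in lborel. d x = 0"
proof -
  have "AE x in lborel. x \<in> {- real N..real N} \<longrightarrow> d x = 0" for N :: nat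
  proof -
    let ?I = "{- real N..real N}"
    define p where "p x = indicator ?I x * max 0 (d x)" for x
    define q where "q x = indicator ?I x * max 0 (- d x)" for x
    have [measurable]: "p \<in> borel_measurable borel" "q \<in> borel_measurable borel"
      unfolding p_def q_def by measurable
    have i: "integrable lborel (\<lambda>x. indicator ?I x * d x)"
      using int[of "- real N" "real N"] by (simp add: set_integrable_def)
    have ip: "integrable lborel p" "integrable lborel q"
      by (rule Bochner_Integration.integrable_bound[OF i]; auto simp: p_def q_def indicator_def)+
    have pq0: "0 \<le> p x" "0 \<le> q x" for x by (auto simp: p_def q_def)
    have ip': "integrable lborel (\<lambda>x. p x * indicator {y<..} x)" "integrable lborel (\<lambda>x. q x * indicator {y<..} x)" for y
      using integrable_mult_indicator[OF _ ip(1), of "{y<..}"] integrable_mult_indicator[OF _ ip(2), of "{y<..}"]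
      by (simp_all add: mult.commute)
    have em: "emeasure (density lborel f) {y<..} = ennreal (LINT x|lborel. f x * indicator {y<..} x)"
      if [measurable]: "f \<in> borel_measurable borel" and "integrable lborel (\<lambda>x. f x * indicator {y<..} x)" "\<And>x. 0 \<le> f x"
      for f :: "real \<Rightarrow> real" and y :: real
    proof -
      have "emeasure (density lborel f) {y<..} = (\<integral>\<^sup>+x. ennreal (f x) * indicator {y<..} x \<partial>lborel)"
        by (rule emeasure_density) auto
      also have "\<dots> = (\<integral>\<^sup>+x. ennreal (f x * indicator {y<..} x) \<partial>lborel)"
        by (intro nn_integral_cong) (auto simp: indicator_def)
      also have "\<dots> = ennreal (LINT x|lborel. f x * indicator {y<..} x)"
        using that by (intro nn_integral_eq_integral) auto
      finally show ?thesis .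
    qed
    have "(LINT x|lborel. p x * indicator {y<..} x) = (LINT x|lborel. q x * indicator {y<..} x)" for y
    proof -
      have "(LINT x|lborel. p x * indicator {y<..} x) - (LINT x|lborel. q x * indicator {y<..} x) =
          (LINT x|lborel. p x * indicator {y<..} x - q x * indicator {y<..} x)"
        using ip' by (intro Bochner_Integration.integral_diff[symmetric])
      also have "\<dots> = (LINT x:{max y (- real N)..real N}|lborel. d x)"
        unfolding set_lebesgue_integral_def
      proof (rule integral_cong_AE)
        have "AE x in lborel. x \<noteq> y" by (rule AE_lborel_singleton)
        then show "AE x in lborel. p x * indicator {y<..} x - q x * indicator {y<..} x =
            indicator {max y (- real N)..real N} x *\<^sub>R d x"
          by eventually_elim (auto simp: p_def q_def indicator_def)
      qed measurable
      also have "\<dots> = 0"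
      proof (cases "max y (- real N) \<le> real N")
        case False
        then have "{max y (- real N)..real N} = {}" by auto
        then show ?thesis by (simp add: set_lebesgue_integral_def)
      qed (rule zero)
      finally show ?thesis by simp
    qed
    then have "density lborel p = density lborel q"
      using ip' pq0 by (intro measure_eqI_lessThan) (simp_all add: em)
    moreover have "(\<integral>\<^sup>+x. ennreal (p x) \<partial>lborel) \<noteq> \<infinity>"
      using ip pq0 by (simp add: nn_integral_eq_integral)
    ultimately have "AE x in lborel. ennreal (p x) = ennreal (q x)"
      by (subst (asm) finite_density_unique) auto
    then show ?thesis
    proof eventually_elim
      case (elim x)
      then have "p x = q x" using pq0 by simp
      then show ?case by (auto simp: p_def q_def max_def split: if_splits)
    qed
  qed
  then have "AE x in lborel. \<forall>N::nat. x \<in> {- real N..real N} \<longrightarrow> d x = 0"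
    unfolding AE_all_countable by blast
  then show ?thesis
  proof eventually_elim
    case (elim x)
    obtain N where "\<bar>x\<bar> < real N" using reals_Archimedean2 by blast
    then have "x \<in> {- real N..real N}" by auto
    then show ?case using elim by blast
  qed
qed

text \<open>The difference is replaced by a Borel representative, to which the statement for
  \<open>lborel\<close> applies, and the result is carried back to the completion.\<close>

lemma AE_eq_if_interval_integrals_eq:
  assumes g: "locally_integrable g" and g': "locally_integrable g'"
    and eq: "\<And>a b. a \<le> b \<Longrightarrow> (LINT x:{a..b}|lebesgue. g x) = (LINT x:{a..b}|lebesgue. g' x)"
  shows "AE x in lebesgue. g x = g' x"
proof -
  note [measurable] = locally_integrable_measurable[OF g] locally_integrable_measurable[OF g']
    measurable_ident_lebesgue
  have "(\<lambda>x. g x - g' x) \<in> borel_measurable lebesgue" by measurable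
  from completion_ex_borel_measurable_real[OF this] obtain d where
    d: "d \<in> borel_measurable lborel" "AE x in lborel. g x - g' x = d x" by blast
  have [measurable]: "d \<in> borel_measurable borel" "d \<in> borel_measurable lebesgue"
    using d(1) measurable_completion[OF d(1)] by simp_all
  have ae: "AE x in lebesgue. g x - g' x = d x" by (rule AE_completion[OF d(2)])
  have i: "set_integrable lebesgue {a..b} (\<lambda>x. g x - g' x)" for a b
    using g g' by (auto simp: locally_integrable_def intro: set_integral_diff)
  have id: "set_integrable lebesgue {a..b} d" for a b
    using i[of a b] unfolding set_integrable_def
    by (rule integrable_cong_AE_imp) (use ae in \<open>auto elim!: eventually_mono\<close>)
  have "AE x in lborel. d x = 0"
  proof (rule AE_eq_0_if_interval_integrals_eq_0)
    show "set_integrable lborel {a..b} d" for a b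
      using id[of a b] unfolding set_integrable_def by (subst (asm) integrable_completion) auto
    fix a b :: real assume "a \<le> b"
    have "(LINT x:{a..b}|lborel. d x) = (LINT x:{a..b}|lebesgue. d x)"
      unfolding set_lebesgue_integral_def by (rule LINT_lebesgue_eq_lborel[symmetric]) measurable
    also have "\<dots> = (LINT x:{a..b}|lebesgue. g x - g' x)"
      unfolding set_lebesgue_integral_def
      by (rule integral_cong_AE) (use ae in \<open>auto elim!: eventually_mono\<close>)
    also have "\<dots> = 0"
      using g g' eq[OF \<open>a \<le> b\<close>] by (simp add: locally_integrable_def set_integral_diff)
    finally show "(LINT x:{a..b}|lborel. d x) = 0" .
  qed measurable
  from AE_completion[OF this] ae show ?thesis by eventually_elim simp
qed

section \<open>Iterated primitives\<close>

text \<open>The oriented integral covers negative x as well. The base point 0 is a normalization: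
  another one changes the m-fold primitive by a polynomial of degree less than m.\<close>

definition prim :: "(real \<Rightarrow> real) \<Rightarrow> real \<Rightarrow> real" where
  "prim h x = (LBINT t=0..ereal x. h t)"

lemma prim_diff:
  assumes "\<And>a b. set_integrable lborel {a..b} h" "a \<le> b"
  shows "prim h b - prim h a = (LINT t:{a..b}|lborel. h t)"
proof -
  define c d where "c = min 0 (min a b)" and "d = max 0 (max a b)"
  have "c \<le> d" by (simp add: c_def d_def)
  have "set_integrable lborel {c<..<d} h"
    by (rule set_integrable_subset[OF assms(1)[of c d]]) auto
  then have "interval_lebesgue_integrable lborel (ereal c) (ereal d) h"
    using \<open>c \<le> d\<close> by (simp add: interval_lebesgue_integrable_def)
  moreover have "ereal c = min (ereal 0) (min (ereal a) (ereal b))"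
    "ereal d = max (ereal 0) (max (ereal a) (ereal b))"
    by (simp_all add: c_def d_def)
  ultimately have "interval_lebesgue_integrable lborel (min (ereal 0) (min (ereal a) (ereal b)))
      (max (ereal 0) (max (ereal a) (ereal b))) h" by simp
  then have "prim h a + (LBINT t=ereal a..ereal b. h t) = prim h b"
    unfolding prim_def zero_ereal_def by (rule interval_integral_sum)
  then show ?thesis using interval_integral_Icc[OF assms(2), of h] by simp
qed

lemma prim_has_derivative:
  assumes "continuous_on UNIV h"
  shows "(prim h has_real_derivative h x) (at x)"
proof -
  let ?a = "min x 0 - 1" and ?b = "max x 0 + 1"
  have "((\<lambda>u. LBINT y=ereal 0..ereal u. h y) has_vector_derivative h x) (at x within {?a..?b})"
    by (rule interval_integral_FTC2) (auto intro: continuous_on_subset[OF assms])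
  moreover have "at x within {?a..?b} = at x" by (rule at_within_Icc_at) auto
  ultimately show ?thesis
    by (simp add: prim_def[abs_def] zero_ereal_def has_real_derivative_iff_has_vector_derivative)
qed

text \<open>Bounded overlap. It is used with N = 1 for disjoint intervals and with N = m + 1 for the
  intervals spanned by m + 1 successive nodes.\<close>

lemma sum_set_integral_le:
  fixes f :: "'a \<Rightarrow> real"
  assumes "finite I" and f: "integrable M f" "\<And>x. 0 \<le> f x" and [measurable]: "\<And>i. i \<in> I \<Longrightarrow> A i \<in> sets M"
    and N: "\<And>x. (\<Sum>i\<in>I. indicator (A i) x) \<le> N"
  shows "(\<Sum>i\<in>I. LINT x:A i|M. f x) \<le> N * (LINT x|M. f x)"
proof -
  have i: "integrable M (\<lambda>x. indicator (A i) x *\<^sub>R f x)" if "i \<in> I" for i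
    using that f by (intro integrable_mult_indicator) auto
  have "(\<Sum>i\<in>I. LINT x:A i|M. f x) = (LINT x|M. (\<Sum>i\<in>I. indicator (A i) x *\<^sub>R f x))"
    unfolding set_lebesgue_integral_def using i by (intro Bochner_Integration.integral_sum[symmetric]) auto
  also have "\<dots> \<le> (LINT x|M. N * f x)"
  proof (rule integral_mono)
    show "integrable M (\<lambda>x. \<Sum>i\<in>I. indicator (A i) x *\<^sub>R f x)" using i by auto
    show "(\<Sum>i\<in>I. indicat_real (A i) x *\<^sub>R f x) \<le> N * f x" for x
      using mult_right_mono[OF N[of x] f(2)[of x]] by (simp add: sum_distrib_right)
  qed (use f in auto)
  finally show ?thesis by simp
qed

text \<open>Integrating |h| \<le> R + R^(1-p) |h|^p bounds the sum of increments by R times the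
  total length plus R^(1-p) times the whole integral of |h|^p. Hence a single \<delta> works on the
  entire line.\<close>

lemma absolutely_continuous_prim:
  assumes h: "h \<in> Lp_ball lborel p K" and p: "1 < p"
  shows "absolutely_continuous_on UNIV (prim h)"
  unfolding absolutely_continuous_on_def
proof (intro allI impI)
  fix e :: real assume e: "0 < e"
  note hD = Lp_ballD[OF h]
  have int: "set_integrable lborel {a..b} h" for a b
    using hD p by (intro Lp_set_integrable) (auto simp: emeasure_lborel_Icc_eq)
  define P where "P = \<bar>K\<bar> + 1"
  \<comment> \<open>Gives the second part the size e/4; with \<delta> = e / (2 R) the first stays
    below e/2.\<close>
  define R where "R = (e / (4 * P)) powr (1 / (1 - p))"
  have P: "0 < P" by (simp add: P_def)
  have R: "0 < R" "R powr (1 - p) = e / (4 * P)" using P e p by (auto simp: R_def powr_powr)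
  show "\<exists>\<delta>>0. \<forall>(n::nat) a b. (\<forall>i<n. a i \<le> b i \<and> {a i..b i} \<subseteq> UNIV) \<longrightarrow>
      disjoint_family_on (\<lambda>i. {a i<..<b i}) {..<n} \<longrightarrow> (\<Sum>i<n. b i - a i) < \<delta> \<longrightarrow>
      (\<Sum>i<n. \<bar>prim h (b i) - prim h (a i)\<bar>) < e"
  proof (intro exI[of _ "e / (2 * R)"] conjI allI impI)
    show "0 < e / (2 * R)" using e R by simp
    fix n :: nat and a b :: "nat \<Rightarrow> real"
    assume ab: "\<forall>i<n. a i \<le> b i \<and> {a i..b i} \<subseteq> UNIV"
      and disj: "disjoint_family_on (\<lambda>i. {a i<..<b i}) {..<n}"
      and small: "(\<Sum>i<n. b i - a i) < e / (2 * R)"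
    have "\<bar>prim h (b i) - prim h (a i)\<bar> \<le>
        R * (b i - a i) + R powr (1 - p) * (LINT t:{a i<..<b i}|lborel. \<bar>h t\<bar> powr p)"
      if i: "i < n" for i
    proof -
      let ?I = "{a i<..<b i}"
      have ip: "set_integrable lborel ?I (\<lambda>t. \<bar>h t\<bar> powr p)"
        using hD(2) unfolding set_integrable_def by (intro integrable_mult_indicator) auto
      have ih: "set_integrable lborel ?I h"
        by (rule set_integrable_subset[OF int[of "a i" "b i"]]) auto
      have ic: "set_integrable lborel ?I (\<lambda>_. R)" 

      proof -
        have "integrable lborel (indicat_real ?I)"
          using ab i by (intro integrable_real_indicator) auto
        then show ?thesis unfolding set_integrable_def by (simp only: real_scaleR_def) simp
      qed
      have "(LINT t:{a i..b i}|lborel. h t) = (LINT t:?I|lborel. h t)"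
        unfolding set_lebesgue_integral_def
      proof (rule integral_cong_AE)
        have "AE t in lborel. t \<noteq> a i" "AE t in lborel. t \<noteq> b i" by (rule AE_lborel_singleton)+
        then show "AE t in lborel. indicator {a i..b i} t *\<^sub>R h t = indicator ?I t *\<^sub>R h t"
          by eventually_elim (auto simp: indicator_def)
      qed (use hD(1) in \<open>auto intro: borel_measurable_times\<close>)
      then have "\<bar>prim h (b i) - prim h (a i)\<bar> \<le> (LINT t:?I|lborel. \<bar>h t\<bar>)"
        using prim_diff[OF int, of "a i" "b i"] ab i set_integral_norm_bound[OF ih] by simp
      also have "\<dots> \<le> (LINT t:?I|lborel. R + R powr (1 - p) * \<bar>h t\<bar> powr p)"
      proof (rule set_integral_mono)
        show "set_integrable lborel ?I (\<lambda>t. \<bar>h t\<bar>)" using ih by (rule set_integrable_abs)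
        show "set_integrable lborel ?I (\<lambda>t. R + R powr (1 - p) * \<bar>h t\<bar> powr p)"
          using ip ic by auto
        show "\<bar>h t\<bar> \<le> R + R powr (1 - p) * \<bar>h t\<bar> powr p" for t
          using le_const_add_powr[OF p R(1), of "\<bar>h t\<bar>"] by linarith
      qed
      also have "\<dots> = (LINT t:?I|lborel. R) + R powr (1 - p) * (LINT t:?I|lborel. \<bar>h t\<bar> powr p)"
        using ip ic by (subst set_integral_add) auto
      also have "(LINT t:?I|lborel. R) = R * (b i - a i)"
        using ab i by (simp add: set_lebesgue_integral_def)
      finally show ?thesis .
    qed
    then have "(\<Sum>i<n. \<bar>prim h (b i) - prim h (a i)\<bar>) \<le>
        (\<Sum>i<n. R * (b i - a i) + R powr (1 - p) * (LINT t:{a i<..<b i}|lborel. \<bar>h t\<bar> powr p))"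
      by (intro sum_mono) auto
    also have "\<dots> = R * (\<Sum>i<n. b i - a i) + R powr (1 - p) * (\<Sum>i<n. LINT t:{a i<..<b i}|lborel. \<bar>h t\<bar> powr p)"
      by (simp add: sum.distrib sum_distrib_left)
    also have "\<dots> \<le> R * (\<Sum>i<n. b i - a i) + R powr (1 - p) * P"
    proof (intro add_left_mono mult_left_mono)
      have "(\<Sum>i<n. LINT t:{a i<..<b i}|lborel. \<bar>h t\<bar> powr p) \<le> 1 * (LINT t|lborel. \<bar>h t\<bar> powr p)"
      proof (rule sum_set_integral_le)
        fix x
        have "(\<Sum>i<n. indicat_real {a i<..<b i} x) = indicator (\<Union>i<n. {a i<..<b i}) x"
          using disj by (intro indicator_UN_disjoint[symmetric]) auto
        then show "(\<Sum>i<n. indicat_real {a i<..<b i} x) \<le> 1" by (simp add: indicator_def)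
      qed (use hD(2) in auto)
      also have "\<dots> \<le> P" using hD(3) by (simp add: P_def)
      finally show "(\<Sum>i<n. LINT t:{a i<..<b i}|lborel. \<bar>h t\<bar> powr p) \<le> P" .
    qed simp
    also have "\<dots> < R * (e / (2 * R)) + R powr (1 - p) * P"
      using small R by (intro add_strict_right_mono mult_strict_left_mono)
    also have "\<dots> = e / 2 + e / 4" using P R by simp
    also have "\<dots> < e" using e by simp
    finally show "(\<Sum>i<n. \<bar>prim h (b i) - prim h (a i)\<bar>) < e" .
  qed
qed

lemma absolutely_continuous_on_UNIV_imp_continuous:
  assumes "absolutely_continuous_on UNIV u"
  shows "continuous_on UNIV u"
  unfolding continuous_on_iff
proof (intro ballI allI impI)
  fix x :: real and e :: real assume "0 < e"
  then obtain d where d: "0 < d" "\<And>(n::nat) a b. (\<forall>i<n. a i \<le> b i \<and> {a i..b i} \<subseteq> UNIV) \<Longrightarrow>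
        disjoint_family_on (\<lambda>i. {a i<..<b i}) {..<n} \<Longrightarrow>
        (\<Sum>i<n. b i - a i) < d \<Longrightarrow> (\<Sum>i<n. \<bar>u (b i) - u (a i)\<bar>) < e"
    using assms unfolding absolutely_continuous_on_def by meson
  have "dist (u y) (u x) < e" if "dist y x < d" for y
    using d(2)[of 1 "\<lambda>_. min x y" "\<lambda>_. max x y"] that
    by (auto simp: disjoint_family_on_def dist_real_def min_def max_def abs_if split: if_splits)
  then show "\<exists>d>0. \<forall>x'\<in>UNIV. dist x' x < d \<longrightarrow> dist (u x') (u x) < e" using d(1) by blast
qed

text \<open>As h need not be continuous, integration by parts is obtained from Fubini's theorem on
  the region t \<le> x.\<close>

lemma integral_prim_times_deriv:
  fixes h v v' :: "real \<Rightarrow> real"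
  assumes [measurable]: "h \<in> borel_measurable borel"
    and int: "\<And>a b. set_integrable lborel {a..b} h" and cont: "continuous_on UNIV (prim h)"
    and v: "\<And>x. (v has_real_derivative v' x) (at x)" "continuous_on UNIV v'" "A \<le> B"
      "\<And>x. x \<notin> {A<..<B} \<Longrightarrow> v x = 0" "\<And>x. x \<notin> {A<..<B} \<Longrightarrow> v' x = 0"
  shows "(LINT x|lborel. prim h x * v' x) = - (LINT x|lborel. h x * v x)"
proof -
  have [measurable]: "v' \<in> borel_measurable borel" "v \<in> borel_measurable borel"
    using v by (auto intro!: borel_measurable_continuous_onI DERIV_continuous_on)
  define b where "b t = indicator {A..B} t * h t" for t
  have [measurable]: "b \<in> borel_measurable borel" unfolding b_def by measurable
  have bi: "integrable lborel b" using int[of A B] by (simp add: b_def[abs_def] set_integrable_def)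
  have v'i: "integrable lborel v'" by (rule integrable_continuous_vanishing[OF v(2), of A B]) (use v(5) in auto)
  have ftc: "(LINT x|lborel. indicator {s..B} x *\<^sub>R v' x) = v B - v s" if "s \<le> B" for s
    using that v by (intro integral_FTC_atLeastAtMost)
      (auto intro: continuous_on_subset has_vector_derivative_at_within
        simp: has_real_derivative_iff_has_vector_derivative)
  have v'0: "(LINT x|lborel. v' x) = 0"
  proof -
    have "(LINT x|lborel. v' x) = (LINT x|lborel. indicator {A..B} x *\<^sub>R v' x)"
    proof (rule Bochner_Integration.integral_cong[OF refl])
      fix x show "v' x = indicator {A..B} x *\<^sub>R v' x" using v(5)[of x] by (cases "x \<in> {A..B}") auto
    qed
    then show ?thesis using ftc[of A] v by simp
  qed
  \<comment> \<open>Integrating over x first produces v B - v t = - v t; integrating over t first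
    produces the increment of the primitive from A.\<close>
  define f where "f x t = (if t \<le> x then v' x * b t else 0)" for x t
  have prod: "integrable (lborel \<Otimes>\<^sub>M lborel) (\<lambda>z. v' (fst z) * b (snd z))"
    by (rule lborel_pair.Fubini_integrable) (use bi v'i in \<open>auto simp: abs_mult\<close>)
  have [measurable]: "case_prod f \<in> borel_measurable (lborel \<Otimes>\<^sub>M lborel)"
    unfolding f_def by measurable
  have "integrable (lborel \<Otimes>\<^sub>M lborel) (case_prod f)"
    by (rule Bochner_Integration.integrable_bound[OF prod]) (auto simp: f_def)
  then have "(LINT t|lborel. (LINT x|lborel. f x t)) = (LINT x|lborel. (LINT t|lborel. f x t))"
    by (rule lborel_pair.Fubini_integral)
  moreover have "(LINT t|lborel. f x t) = v' x * (prim h x - prim h A)" for x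
  proof (cases "x \<in> {A<..<B}")
    case True
    have "(LINT t|lborel. f x t) = (LINT t|lborel. v' x * (indicator {A..x} t *\<^sub>R h t))"
      using True by (intro Bochner_Integration.integral_cong) (auto simp: f_def b_def indicator_def)
    also have "\<dots> = v' x * (LINT t:{A..x}|lborel. h t)" by (simp add: set_lebesgue_integral_def)
    finally show ?thesis using prim_diff[OF int, of A x] True by simp
  next
    case False
    then show ?thesis using v(5)[OF False] by (simp add: f_def cong: if_cong)
  qed
  moreover have "(LINT x|lborel. f x t) = - (h t * v t)" for t
  proof (cases "t \<in> {A..B}")
    case True
    have "f x t = h t * (indicator {t..B} x *\<^sub>R v' x)" for x
      using True v(5)[of x] by (auto simp: f_def b_def indicator_def)
    then show ?thesis using ftc[of t] True v by simp
  next
    case False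
    then have "v t = 0" by (intro v(4)) auto
    then show ?thesis using False by (simp add: f_def b_def cong: if_cong)
  qed
  \<comment> \<open>The constant \<open>prim h A\<close> drops out because v' has integral
    0.\<close>
  moreover have "(LINT x|lborel. v' x * (prim h x - prim h A)) = (LINT x|lborel. prim h x * v' x)"
  proof -
    have "integrable lborel (\<lambda>x. prim h x * v' x)"
      by (rule integrable_continuous_vanishing[of _ A B]) (use cont v(2,5) in \<open>auto intro!: continuous_intros\<close>)
    then show ?thesis using v'i v'0 by (simp add: right_diff_distrib mult.commute)
  qed
  ultimately show ?thesis by simp
qed

lemma set_integrable_lebesgue_eq_lborel:
  fixes f :: "real \<Rightarrow> real"
  assumes [measurable]: "f \<in> borel_measurable borel" and [measurable]: "A \<in> sets borel"
  shows "set_integrable lebesgue A f \<longleftrightarrow> set_integrable lborel A f"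
  unfolding set_integrable_def by (rule integrable_completion) measurable

lemma locally_integrable_continuous:
  assumes "continuous_on UNIV f"
  shows "locally_integrable f"
proof -
  have "f \<in> borel_measurable borel" using assms by (rule borel_measurable_continuous_onI)
  then show ?thesis unfolding locally_integrable_def
    using borel_integrable_atLeastAtMost'[OF continuous_on_subset[OF assms]]
    by (simp add: set_integrable_lebesgue_eq_lborel)
qed

lemma Lp_ball_set_integrable:
  assumes "h \<in> Lp_ball lborel p K" "1 < p"
  shows "set_integrable lborel {a..b::real} h"
  using Lp_ballD[OF assms(1)] assms(2) by (intro Lp_set_integrable) (auto simp: emeasure_lborel_Icc_eq)

lemma continuous_on_prim:
  assumes "h \<in> Lp_ball lborel p K" "1 < p"
  shows "continuous_on UNIV (prim h)"
  by (rule absolutely_continuous_on_UNIV_imp_continuous[OF absolutely_continuous_prim[OF assms]])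

lemma continuous_on_prim_iterate:
  assumes "h \<in> Lp_ball lborel p K" "1 < p"
  shows "continuous_on UNIV ((prim ^^ Suc j) h)"
proof (induction j)
  case 0
  then show ?case using continuous_on_prim[OF assms] by simp
next
  case (Suc j)
  have "continuous_on UNIV (prim ((prim ^^ Suc j) h))"
    using prim_has_derivative[OF Suc] by (intro DERIV_continuous_on) auto
  then show ?case by simp
qed

text \<open>The chain stops at m - 1: the next derivative would be that of \<open>prim h\<close>,
  which may fail to exist at some points.\<close>

lemma deriv_chain_prim_iterate:
  assumes "h \<in> Lp_ball lborel p K" "1 < p"
  shows "deriv_chain (m - 1) (\<lambda>i x. poly ((pderiv ^^ i) q) x + (prim ^^ (m - i)) h x)"
proof (rule deriv_chain_add[OF deriv_chain_poly])
  show "deriv_chain (m - 1) (\<lambda>i. (prim ^^ (m - i)) h)"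
    unfolding deriv_chain_def
  proof (intro allI impI)
    fix i x assume i: "i < m - 1"
    then obtain j where j: "m - i = Suc (Suc j)" "m - Suc i = Suc j"
      by (metis Suc_diff_Suc Suc_lessD less_diff_conv add.commute plus_1_eq_Suc)
    show "((prim ^^ (m - i)) h has_real_derivative (prim ^^ (m - Suc i)) h x) (at x)"
      unfolding j using prim_has_derivative[OF continuous_on_prim_iterate[OF assms, of j]] by simp
  qed
qed

text \<open>As the degree of q is below m, F^(m-1) is a constant plus \<open>prim h\<close>. Against
  a test function, m - 1 derivatives are moved classically and the last one by
  \<open>integral_prim_times_deriv\<close>.\<close>

lemma iterated_primitive_sobolev:
  assumes m: "m \<ge> 1" and p: "1 < p" and h: "h \<in> Lp_ball lborel p K" and q: "degree q < m"
  defines "F \<equiv> (\<lambda>x. poly q x + (prim ^^ m) h x)"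
  shows "F \<in> homogeneous_sobolev m p" "has_weak_derivative m F h"
proof -
  let ?G = "\<lambda>i x. poly ((pderiv ^^ i) q) x + (prim ^^ (m - i)) h x"
  note hD = Lp_ballD[OF h]
  have hb: "h \<in> borel_measurable borel" using hD(1) by simp
  have hl: "h \<in> borel_measurable lebesgue" using measurable_completion[OF hD(1)] .
  have chain: "deriv_chain (m - 1) ?G" by (rule deriv_chain_prim_iterate[OF h p])
  have dF: "(deriv ^^ k) F = ?G k" if "k \<le> m - 1" for k
    using deriv_chain_deriv[OF chain that] by (simp add: F_def)
  obtain c where c: "(pderiv ^^ (m - 1)) q = [:c:]"
  proof -
    have "degree ((pderiv ^^ (m - 1)) q) = 0" using q by (simp add: degree_higher_pderiv)
    then show ?thesis using that by (metis degree_eq_zeroE)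
  qed
  have "m - (m - 1) = 1" using m by simp
  then have top: "?G (m - 1) = (\<lambda>x. c + prim h x)" using c by simp
  then have top': "?G (m - 1) x = c + prim h x" for x by (rule fun_cong)
  have cG: "continuous_on UNIV (?G (m - 1))" unfolding top
    by (intro continuous_intros continuous_on_prim[OF h p])
  have cF: "continuous_on UNIV F"
    unfolding F_def using m continuous_on_prim_iterate[OF h p, of "m - 1"] by (intro continuous_intros) simp
  have hli: "locally_integrable h"
    unfolding locally_integrable_def using Lp_ball_set_integrable[OF h p] hb
    by (simp add: set_integrable_lebesgue_eq_lborel)
  show wd: "has_weak_derivative m F h"
    unfolding has_weak_derivative_def
  proof (intro conjI ballI hli locally_integrable_continuous cF)
    fix \<phi> assume \<phi>: "\<phi> \<in> test_functions"
    let ?v = "\<lambda>k. (deriv ^^ k) \<phi>"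
    obtain A B where AB: "A \<le> B" "\<And>k x. x \<notin> {A<..<B} \<Longrightarrow> ?v k x = 0"
      using test_function_support[OF \<phi>] by blast
    have v: "deriv_chain k ?v" for k by (rule test_function_deriv_chain[OF \<phi>])
    have vd: "(?v k has_real_derivative ?v (Suc k) x) (at x)" for k x
      using deriv_chainD[OF v[of "Suc k"], of k] by simp
    have vc: "continuous_on UNIV (?v k)" for k
      using vd by (intro DERIV_continuous_on) auto
    have [measurable]: "F \<in> borel_measurable borel" "?v k \<in> borel_measurable borel" for k
      using cF vc by (auto intro: borel_measurable_continuous_onI)
    note [measurable] = hb
    have "(LINT x|lebesgue. F x * ?v m x) = (LINT x|lborel. F x * ?v m x)"
      by (rule LINT_lebesgue_eq_lborel) measurable
    also have "\<dots> = (- 1) ^ (m - 1) * (LINT x|lborel. ?G (m - 1) x * ?v 1 x)"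
      using integral_by_parts_deriv_chain[of "m - 1" ?G ?v A B 1, OF chain cG v AB] m
      by (simp add: F_def)
    also have "(LINT x|lborel. ?G (m - 1) x * ?v 1 x) = - (LINT x|lborel. h x * ?v 0 x)"
    proof -
      have "(LINT x|lborel. c * ?v (Suc 0) x) = - (LINT x|lborel. 0 * ?v 0 x)"
        by (rule integral_by_parts_vanishing[of "\<lambda>_. c" "\<lambda>_. 0" "?v 0" "?v (Suc 0)" A B, OF _ vd _ vc AB(1) AB(2) AB(2)])
          auto
      moreover have "(LINT x|lborel. prim h x * ?v (Suc 0) x) = - (LINT x|lborel. h x * ?v 0 x)"
        by (rule integral_prim_times_deriv[OF hb Lp_ball_set_integrable[OF h p] continuous_on_prim[OF h p] vd vc AB(1) AB(2) AB(2)])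
      moreover have "integrable lborel (\<lambda>x. c * ?v (Suc 0) x)"
        by (rule integrable_continuous_vanishing[of _ A B])
          (use AB(2)[of _ 1] in \<open>auto intro!: continuous_intros vc[of 1, simplified]\<close>)
      moreover have "integrable lborel (\<lambda>x. prim h x * ?v (Suc 0) x)"
        by (rule integrable_continuous_vanishing[of _ A B])
          (use AB(2)[of _ 1] in \<open>auto intro!: continuous_intros vc[of 1, simplified] continuous_on_prim[OF h p]\<close>)
      ultimately show ?thesis unfolding top' by (simp add: distrib_right)
    qed
    also have "(LINT x|lborel. h x * ?v 0 x) = (LINT x|lebesgue. h x * ?v 0 x)"
      by (rule LINT_lebesgue_eq_lborel[symmetric]) measurable
    also have "(- 1) ^ (m - 1) * (- (LINT x|lebesgue. h x * ?v 0 x)) = (- 1) ^ m * (LINT x|lebesgue. h x * \<phi> x)"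
      using m by (cases m) auto
    finally show "(LINT x|lebesgue. F x * ?v m x) = (- 1) ^ m * (LINT x|lebesgue. h x * \<phi> x)" .
  qed
  show "F \<in> homogeneous_sobolev m p"
    unfolding homogeneous_sobolev_def
  proof (intro CollectI conjI allI impI)
    fix k assume k: "k < m - 1"
    show "(deriv ^^ k) F differentiable_on UNIV"
      using dF[of k] k deriv_chainD[OF chain k]
      by (auto simp: differentiable_on_def real_differentiable_def)
  next
    show "absolutely_continuous_on UNIV ((deriv ^^ (m - 1)) F)"
      using absolutely_continuous_prim[OF h p] unfolding dF[OF order_refl] top
      by (simp add: absolutely_continuous_on_def)
  next
    have "h \<in> Lp_functions p" using hD hl hb by (simp add: Lp_functions_def integrable_completion)
    then show "\<exists>g. has_weak_derivative m F g \<and> g \<in> Lp_functions p" using wd by blast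
  qed
qed

section \<open>Extension from a finite set\<close>

lemma higher_pderiv_linear_mult:
  "(pderiv ^^ j) ([:- w, 1:] * q) = [:- w, 1:] * (pderiv ^^ j) q + smult (of_nat j) ((pderiv ^^ (j - 1)) q)"
  for q :: "real poly"
proof (induction j)
  case (Suc j)
  have "pderiv ([:- w, 1:] * r) = [:- w, 1:] * pderiv r + r" for r :: "real poly"
    by (simp add: pderiv_diff pderiv_smult pderiv_pCons)
  moreover have "smult (of_nat j) (pderiv ((pderiv ^^ (j - 1)) q)) = smult (of_nat j) ((pderiv ^^ j) q)"
    by (cases j) auto
  ultimately show ?case
    unfolding funpow.simps comp_def Suc by (simp add: pderiv_add pderiv_smult smult_add_left)
qed simp

text \<open>The weight (b - a)^j makes the estimate scale invariant. Each linear factor splits the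
  derivative in two, one part bounded with the length b - a and one with j times a lower derivative,
  hence a factor (1 + m)(b - a) per node.\<close>

lemma higher_pderiv_node_poly_bound:
  assumes "finite U" "U \<subseteq> {a..b}" "y \<in> {a..b}" "j \<le> m"
  shows "\<bar>poly ((pderiv ^^ j) (\<Prod>w\<in>U. [:- w, 1:])) y\<bar> * (b - a) ^ j \<le> (1 + real m) ^ card U * (b - a) ^ card U"
  using assms(1,2,4)
proof (induction U arbitrary: j rule: finite_induct)
  case empty
  have "(pderiv ^^ j) 1 = (if j = 0 then 1 else 0 :: real poly)"
    by (induction j) (auto simp: pderiv_1)
  then show ?case by simp
next
  case (insert w U)
  let ?L = "b - a" and ?q = "\<lambda>j. poly ((pderiv ^^ j) (\<Prod>w\<in>U. [:- w, 1:])) y"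
  let ?K = "(1 + real m) ^ card U * ?L ^ card U"
  have L: "0 \<le> ?L" using assms(3) by simp
  have yw: "\<bar>y - w\<bar> \<le> ?L" using assms(3) insert.prems by auto
  have "\<bar>poly ((pderiv ^^ j) (\<Prod>w\<in>insert w U. [:- w, 1:])) y\<bar> = \<bar>(y - w) * ?q j + real j * ?q (j - 1)\<bar>"
    unfolding prod.insert[OF insert.hyps] higher_pderiv_linear_mult by (simp add: algebra_simps)
  also have "\<dots> \<le> \<bar>y - w\<bar> * \<bar>?q j\<bar> + real j * \<bar>?q (j - 1)\<bar>"
    by (rule order_trans[OF abs_triangle_ineq]) (simp add: abs_mult)
  finally have "\<bar>poly ((pderiv ^^ j) (\<Prod>w\<in>insert w U. [:- w, 1:])) y\<bar> * ?L ^ j \<le>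
      (\<bar>y - w\<bar> * \<bar>?q j\<bar> + real j * \<bar>?q (j - 1)\<bar>) * ?L ^ j"
    using L by (intro mult_right_mono) auto
  also have "\<dots> = \<bar>y - w\<bar> * (\<bar>?q j\<bar> * ?L ^ j) + real j * (\<bar>?q (j - 1)\<bar> * ?L ^ j)"
    by (simp add: algebra_simps)
  also have "\<dots> \<le> ?L * ?K + real m * (?L * ?K)"
  proof (rule add_mono)
    have IH: "\<bar>?q i\<bar> * ?L ^ i \<le> ?K" if "i \<le> m" for i using insert that by auto
    show "\<bar>y - w\<bar> * (\<bar>?q j\<bar> * ?L ^ j) \<le> ?L * ?K"
      by (rule mult_mono[OF yw IH]) (use L insert.prems in auto)
    show "real j * (\<bar>?q (j - 1)\<bar> * ?L ^ j) \<le> real m * (?L * ?K)"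
    proof (cases j)
      case (Suc i)
      have "\<bar>?q (j - 1)\<bar> * ?L ^ j = ?L * (\<bar>?q i\<bar> * ?L ^ i)" using Suc by simp
      also have "\<dots> \<le> ?L * ?K" using IH[of i] Suc insert.prems L by (intro mult_left_mono) auto
      finally have "\<bar>?q (j - 1)\<bar> * ?L ^ j \<le> ?L * ?K" .
      then show ?thesis by (rule mult_mono[rotated]) (use L insert.prems in auto)
    qed (use L in simp)
  qed
  also have "\<dots> = (1 + real m) ^ card (insert w U) * ?L ^ card (insert w U)"
    using insert.hyps by (simp add: algebra_simps)
  finally show ?case .
qed

text \<open>An averaging argument; a gap of at least the mean length is what the cutoff functions
  require.\<close>

lemma ex_long_gap:
  fixes x :: "nat \<Rightarrow> real"
  assumes "m \<ge> 1"
  shows "\<exists>k\<in>{i..<i + m}. (x (i + m) - x i) / real m \<le> x (Suc k) - x k"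
proof (rule ccontr)
  assume "\<not> ?thesis"
  then have "x (Suc k) - x k < (x (i + m) - x i) / real m" if "k \<in> {i..<i + m}" for k
    using that by force
  then have "(\<Sum>k\<in>{i..<i + m}. x (Suc k) - x k) < (\<Sum>k\<in>{i..<i + m}. (x (i + m) - x i) / real m)"
    using assms by (intro sum_strict_mono) auto
  then show False using assms by (simp add: sum_Suc_diff')
qed

text \<open>If i0 is the least such index, i > i0 + m would give x (i0 + m) < x i, separating y from
  one of the two intervals.\<close>

lemma card_overlap_le:
  fixes x :: "nat \<Rightarrow> real"
  assumes x: "strict_mono_on {..n} x" and "m \<le> n"
  shows "card {i. i \<le> n - m \<and> y \<in> {x i..x (i + m)}} \<le> Suc m"
proof -
  let ?S = "{i. i \<le> n - m \<and> y \<in> {x i..x (i + m)}}"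
  show ?thesis
  proof (cases "?S = {}")
    case False
    have fin: "finite ?S" by simp
    have "?S \<subseteq> {Min ?S..Min ?S + m}"
    proof
      fix i assume i: "i \<in> ?S"
      have M: "Min ?S \<in> ?S" using fin False by (rule Min_in)
      have "\<not> Min ?S + m < i"
      proof
        assume lt: "Min ?S + m < i"
        have "x (Min ?S + m) < x i"
          by (rule strict_mono_onD[OF x]) (use i lt in auto)
        then show False using i M by auto
      qed
      moreover have "Min ?S \<le> i" using fin i by (rule Min_le)
      ultimately show "i \<in> {Min ?S..Min ?S + m}" by auto
    qed
    then have "card ?S \<le> card {Min ?S..Min ?S + m}" by (intro card_mono) auto
    then show ?thesis by simp
  qed (simp only: card.empty)
qed

text \<open>The sum is at most N times its largest term. The factor N^p becomes N after the p-th
  root, independently of p.\<close>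

lemma powr_sum_le:
  fixes a :: "'i \<Rightarrow> real"
  assumes "finite S" "card S \<le> N" "\<And>i. i \<in> S \<Longrightarrow> 0 \<le> a i" "0 < p"
  shows "(\<Sum>i\<in>S. a i) powr p \<le> real N powr p * (\<Sum>i\<in>S. a i powr p)"
proof (cases "S = {}")
  case False
  define M where "M = Max (a ` S)"
  have "M \<in> a ` S" unfolding M_def using assms False by (intro Max_in) auto
  then obtain j where j: "j \<in> S" "M = a j" by auto
  have "(\<Sum>i\<in>S. a i) \<le> real (card S) * M"
    using assms unfolding M_def by (intro sum_bounded_above) auto
  also have "\<dots> \<le> real N * M" using assms j by (intro mult_right_mono) auto
  finally have "(\<Sum>i\<in>S. a i) powr p \<le> (real N * M) powr p"
    using assms by (intro powr_mono2 sum_nonneg) auto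
  also have "\<dots> = real N powr p * (a j powr p)" using assms j by (simp add: powr_mult)
  also have "\<dots> \<le> real N powr p * (\<Sum>i\<in>S. a i powr p)"
    using assms j by (intro mult_left_mono member_le_sum) auto
  finally show ?thesis .
qed simp

text \<open>Both functions have the m-th derivative \<open>G m\<close>, so the mean value theorem
  applied to their difference gives the value 0.\<close>

lemma divided_difference_prim_iterate:
  assumes chain: "\<And>k. deriv_chain k G" and S: "finite S" "card S = Suc m"
  shows "divided_difference ((prim ^^ m) (G m)) S = divided_difference (G 0) S"
proof -
  have cont: "continuous_on UNIV ((prim ^^ j) (G m))" for j
  proof (induction j)
    case 0
    then show ?case using deriv_chain_continuous_on[OF chain[of "Suc m"]] by simp
  next
    case (Suc j)
    then show ?case using prim_has_derivative[OF Suc] by (auto intro: DERIV_continuous_on)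
  qed
  have "deriv_chain m (\<lambda>i. (prim ^^ (m - i)) (G m))"
    unfolding deriv_chain_def
  proof (intro allI impI)
    fix i x assume "i < m"
    then have "m - i = Suc (m - Suc i)" by simp
    then show "((prim ^^ (m - i)) (G m) has_real_derivative (prim ^^ (m - Suc i)) (G m) x) (at x)"
      using prim_has_derivative[OF cont] by simp
  qed
  then have E: "deriv_chain m (\<lambda>i x. G i x - (prim ^^ (m - i)) (G m) x)"
    by (intro deriv_chain_diff chain)
  have "S \<noteq> {}" using S by auto
  then have "S \<subseteq> {Min S..Max S}" using S by auto
  from divided_difference_mean_value[OF E S this]
  show ?thesis by (simp add: divided_difference_diff)
qed

text \<open>The solution is the m-th derivative of the explicit interpolant. Interpolation is
  recorded as equality of divided differences of order m, the form that survives the loss of a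
  polynomial of degree less than m.\<close>

lemma finite_moment_solution:
  assumes m: "m \<ge> 1"
  shows "\<exists>C\<ge>1. \<forall>p f n x. 1 < p \<longrightarrow> m \<le> n \<longrightarrow> strict_mono_on {..n} x \<longrightarrow>
    (\<exists>h\<in>Lp_ball lborel p (C powr p *
        (\<Sum>i=0..n - m. (x (i + m) - x i) * \<bar>divided_difference f (x ` {i..i + m})\<bar> powr p)).
      \<forall>S\<subseteq>x ` {..n}. card S = Suc m \<longrightarrow>
        divided_difference ((prim ^^ m) h) S = divided_difference f S)"
proof -
  obtain \<Theta> B where \<Theta>: "\<And>n. deriv_chain n \<Theta>" "\<And>x. x \<le> 0 \<Longrightarrow> \<Theta> 0 x = 0" "\<And>x. 1 \<le> x \<Longrightarrow> \<Theta> 0 x = (1::real)"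
    "\<And>k x. x \<le> 0 \<or> 1 \<le> x \<Longrightarrow> \<Theta> (Suc k) x = 0" and B: "\<And>k x. \<bar>\<Theta> k x\<bar> \<le> B k"
    using ex_smooth_step by blast
  have B0: "0 \<le> B k" for k using B[of k 0] by linarith
  \<comment> \<open>The Leibniz sum for one summand: the l-th derivative of the step gives
    \<open>B l\<close> and, after scaling, m^l; the power of 1 + m comes from the m - 1 inner
    nodes.\<close>
  define C0 where "C0 = (\<Sum>l\<le>m. real (m choose l) * (real m ^ l * B l * (1 + real m) ^ (m - 1)))"
  have C0: "0 \<le> C0" unfolding C0_def using B0 by (intro sum_nonneg mult_nonneg_nonneg) auto
  \<comment> \<open>The 1 is added to ensure C \<ge> 1; the factor m + 1 counts the summands that
    can be active at one point.\<close>
  define C where "C = (C0 + 1) * real (Suc m)"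
  have "1 \<le> C" unfolding C_def using C0 mult_mono[of 1 "C0 + 1" 1 "real (Suc m)"] by simp
  moreover have "\<exists>h\<in>Lp_ball lborel p (C powr p *
        (\<Sum>i=0..n - m. (x (i + m) - x i) * \<bar>divided_difference f (x ` {i..i + m})\<bar> powr p)).
      \<forall>S\<subseteq>x ` {..n}. card S = Suc m \<longrightarrow>
        divided_difference ((prim ^^ m) h) S = divided_difference f S"
    if p: "1 < p" and mn: "m \<le> n" and x: "strict_mono_on {..n} x" for p f n x
  proof -
    have x_less: "x i < x j" if "i < j" "j \<le> n" for i j
      using x that by (auto simp: strict_mono_on_def)
    have x_le: "x i \<le> x j" if "i \<le> j" "j \<le> n" for i j
      using x_less[of i j] that by (cases "i = j") auto
    have inj: "inj_on x {..n}" using x by (rule strict_mono_on_imp_inj_on)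
    let ?N = "n - m"
    define D where "D i = divided_difference f (x ` {i..i + m})" for i
    define U where "U i = x ` {i + 1..<i + m}" for i
    define L where "L i = x (i + m) - x i" for i
    have L: "0 < L i" if "i \<le> ?N" for i using x_less[of i "i + m"] that m mn by (simp add: L_def)
    obtain k where k: "\<And>i. k i \<in> {i..<i + m}" "\<And>i. L i / real m \<le> x (Suc (k i)) - x (k i)"
      using ex_long_gap[OF m, of _ x] unfolding L_def by metis
    \<comment> \<open>The reciprocal gap length, so that y maps to c (y - x (k i)) in [0, 1] exactly
      on the gap.\<close>
    define c where "c i = 1 / (x (Suc (k i)) - x (k i))" for i
    have gap: "x (k i) < x (Suc (k i))" if "i \<le> ?N" for i
      using k(1)[of i] that mn by (intro x_less) auto
    have c: "0 < c i" "c i * L i \<le> real m" if i: "i \<le> ?N" for i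
    proof -
      show "0 < c i" using gap[OF i] by (simp add: c_def)
      have "L i \<le> real m * (x (Suc (k i)) - x (k i))" using k(2)[of i] m by (simp add: field_simps)
      then show "c i * L i \<le> real m" using gap[OF i] by (simp add: c_def field_simps)
    qed
    \<comment> \<open>\<open>P i\<close> interpolates at \<open>x i, \<dots>, x (i + m - 1)\<close> and \<open>Q i = P (i + 1) - P i\<close>; the cutoff \<open>\<theta> i\<close> switches from
      \<open>P i\<close> to \<open>P (i + 1)\<close> on the long gap \<open>[x (k i), x (k i + 1)]\<close>, which contains no node.\<close>
    define \<theta> where "\<theta> i l y = c i ^ l * \<Theta> l (c i * y + - c i * x (k i))" for i l y
    define W where "W i = (\<Prod>w\<in>U i. [:- w, 1::real:])" for i
    define Q where "Q i = smult (D i * L i) (W i)" for i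
    define P where "P i = lagrange_poly f (x ` {i..<i + m})" for i
    have finU: "finite (U i)" for i by (simp add: U_def)
    have cardU: "card (U i) = m - 1" if "i \<le> ?N" for i
    proof -
      have "inj_on x {i + 1..<i + m}" by (rule inj_on_subset[OF inj]) (use that mn in auto)
      then show ?thesis by (simp add: U_def card_image)
    qed
    have exch: "poly (P (Suc i)) y - poly (P i) y = poly (Q i) y" if i: "i \<le> ?N" for i y
    proof -
      have im: "i + m \<le> n" using i mn by simp
      have nin: "x j \<notin> U i" if "j \<le> n" "j \<notin> {i + 1..<i + m}" for j
        unfolding U_def using that i mn m by (subst inj_on_image_mem_iff[OF inj]) auto
      have "{Suc i..<Suc i + m} = insert (i + m) {i + 1..<i + m}" using m by auto
      then have 1: "x ` {Suc i..<Suc i + m} = insert (x (i + m)) (U i)" by (simp add: U_def)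
      have "{i..<i + m} = insert i {i + 1..<i + m}" using m by auto
      then have 2: "x ` {i..<i + m} = insert (x i) (U i)" by (simp add: U_def)
      have "{i..i + m} = insert i (insert (i + m) {i + 1..<i + m})" using m by auto
      then have 3: "x ` {i..i + m} = insert (x i) (insert (x (i + m)) (U i))" by (simp add: U_def)
      have "poly (P (Suc i)) y - poly (P i) y = D i * (x (i + m) - x i) * (\<Prod>w\<in>U i. y - w)"
        unfolding P_def D_def 1 2 3
        using im m x_less[of i "i + m", OF _ im] by (intro lagrange_poly_exchange finU nin) auto
      then show ?thesis by (simp add: Q_def W_def L_def poly_prod)
    qed
    define G where "G l y = poly ((pderiv ^^ l) (P 0)) y +
        (\<Sum>i\<le>?N. leibniz (\<theta> i) (\<lambda>j. poly ((pderiv ^^ j) (Q i))) l y)" for l y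
    have chain: "deriv_chain l G" for l
    proof -
      have "deriv_chain l (leibniz (\<theta> i) (\<lambda>j. poly ((pderiv ^^ j) (Q i))))" for i
        unfolding \<theta>_def by (intro deriv_chain_leibniz deriv_chain_poly deriv_chain_affine \<Theta>(1))
      then have "deriv_chain l (\<lambda>l y. \<Sum>i\<le>?N. leibniz (\<theta> i) (\<lambda>j. poly ((pderiv ^^ j) (Q i))) l y)"
        unfolding deriv_chain_def by (auto intro!: DERIV_sum)
      then show ?thesis unfolding G_def by (intro deriv_chain_add deriv_chain_poly)
    qed
    have arg: "c i * y + - c i * x (k i) = c i * (y - x (k i))" for i y by (simp add: algebra_simps)
    have arg0: "c i * (y - x (k i)) \<le> 0" if "i \<le> ?N" "y \<le> x (k i)" for i y
      using c(1)[of i] that by (intro mult_nonneg_nonpos) auto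
    have arg1: "1 \<le> c i * (y - x (k i))" if "i \<le> ?N" "x (Suc (k i)) \<le> y" for i y
      using gap[of i] that by (simp add: c_def field_simps)
    have interp: "G 0 (x j) = f (x j)" if j: "j \<le> n" for j
    proof -
      \<comment> \<open>Node x j lies to the right of the gap, to its left, or is an inner node,
        where Q vanishes whatever the step is worth.\<close>
      have "\<theta> i 0 (x j) * poly (Q i) (x j) = (if i + m \<le> j then poly (Q i) (x j) else 0)" if i: "i \<le> ?N" for i
      proof -
        consider "i + m \<le> j" | "j \<le> i" | "i < j" "j < i + m" by linarith
        then show ?thesis
        proof cases
          case 1
          then have "x (Suc (k i)) \<le> x j" using k(1)[of i] j by (intro x_le) auto
          then show ?thesis using 1 \<Theta>(3)[OF arg1[OF i]] by (simp add: \<theta>_def arg[simplified])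
        next
          case 2
          then have "x j \<le> x (k i)" using k(1)[of i] i mn by (intro x_le) auto
          then show ?thesis using 2 m \<Theta>(2)[OF arg0[OF i]] by (simp add: \<theta>_def arg[simplified])
        next
          case 3
          then have "x j \<in> U i" by (auto simp: U_def)
          then show ?thesis using 3 finU[of i] by (simp add: Q_def W_def poly_prod prod_zero_iff)
        qed
      qed
      then have "G 0 (x j) = poly (P 0) (x j) + (\<Sum>i\<le>?N. if i + m \<le> j then poly (Q i) (x j) else 0)"
        by (auto simp: G_def intro!: sum.cong)
      \<comment> \<open>The range i + m \<le> j reads i < j + 1 - m. For j < m truncated subtraction
        makes the sum empty and leaves P 0, which interpolates at these nodes.\<close>
      also have "(\<Sum>i\<le>?N. if i + m \<le> j then poly (Q i) (x j) else 0) =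
          (\<Sum>i<j + 1 - m. poly (P (Suc i)) (x j) - poly (P i) (x j))"
        using j mn by (intro sum.mono_neutral_cong_right) (auto simp: exch)
      also have "\<dots> = poly (P (j + 1 - m)) (x j) - poly (P 0) (x j)"
        by (rule sum_lessThan_telescope)
      finally have "G 0 (x j) = poly (P (j + 1 - m)) (x j)" by simp
      also have "\<dots> = f (x j)"
        unfolding P_def
      proof (rule poly_lagrange_poly_node)
        have "j \<in> {j + 1 - m..<j + 1 - m + m}" using m by auto
        then show "x j \<in> x ` {j + 1 - m..<j + 1 - m + m}" by (rule imageI)
      qed simp
      finally show ?thesis .
    qed
    define I where "I i = {x i..x (i + m)}" for i
    have term_bound: "\<bar>leibniz (\<theta> i) (\<lambda>j. poly ((pderiv ^^ j) (Q i))) m y\<bar> \<le> C0 * (indicator (I i) y * \<bar>D i\<bar>)"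
      if i: "i \<le> ?N" for i y
    proof -
      have degW: "degree (W i) = m - 1" unfolding W_def using degree_prod_linear[OF finU] cardU[OF i] by simp
      \<comment> \<open>Removes the Leibniz term with l = 0, the one whose step factor is not
        confined to the gap.\<close>
      have Qm: "poly ((pderiv ^^ m) (Q i)) y = 0"
      proof -
        have "degree (Q i) \<le> m - 1" unfolding Q_def using degW degree_smult_le[of "D i * L i" "W i"] by simp
        then show ?thesis using m by (subst poly_pderiv_iterate_degree_le) (auto intro: coeff_eq_0)
      qed
      show ?thesis
      proof (cases "y \<in> {x (k i)<..<x (Suc (k i))}")
        case False
        then have "y \<le> x (k i) \<or> x (Suc (k i)) \<le> y" by auto
        then have "\<theta> i (Suc l) y = 0" for l
          using arg0[OF i] arg1[OF i] \<Theta>(4) unfolding \<theta>_def arg by auto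
        then have z: "real (m choose l) * (\<theta> i l y * poly ((pderiv ^^ (m - l)) (Q i)) y) = 0" for l
          using Qm by (cases l) auto
        have "leibniz (\<theta> i) (\<lambda>j. poly ((pderiv ^^ j) (Q i))) m y = 0"
          unfolding leibniz_def by (rule sum.neutral) (use z in blast)
        then show ?thesis using C0 by simp
      next
        case True
        have yI: "y \<in> I i"
        proof -
          have "x i \<le> x (k i)" "x (Suc (k i)) \<le> x (i + m)" using k(1)[of i] i mn by (auto intro!: x_le)
          then show ?thesis using True by (auto simp: I_def)
        qed
        have UI: "U i \<subseteq> {x i..x (i + m)}" unfolding U_def using i mn by (auto intro!: x_le)
        have bd: "\<bar>\<theta> i l y * poly ((pderiv ^^ (m - l)) (Q i)) y\<bar> \<le>
            real m ^ l * B l * (1 + real m) ^ (m - 1) * \<bar>D i\<bar>" if l: "l \<le> m" for l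
        proof -
          let ?q = "\<bar>poly ((pderiv ^^ (m - l)) (W i)) y\<bar>"
          let ?K = "(1 + real m) ^ (m - 1)"
          have "?q * L i ^ (m - l) \<le> ?K * L i ^ (m - 1)"
            using higher_pderiv_node_poly_bound[OF finU UI, of y "m - l" m] yI cardU[OF i]
            by (simp add: W_def L_def I_def)
          \<comment> \<open>The extra factor L from Q raises the right side to L^m = L^l L^(m-l);
            after cancelling L^(m-l) the remaining L^l is absorbed by c^l.\<close>
          then have "?q * L i ^ (m - l) * L i \<le> ?K * L i ^ (m - 1) * L i"
            using L[OF i] by (intro mult_right_mono) auto
          also have "\<dots> = ?K * (L i ^ l * L i ^ (m - l))"
            using m l by (simp add: power_add[symmetric] power_Suc2[symmetric])
          finally have "(?q * L i) * L i ^ (m - l) \<le> (?K * L i ^ l) * L i ^ (m - l)" by (simp add: mult_ac)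
          then have q: "?q * L i \<le> ?K * L i ^ l" using L[OF i] by (simp add: mult_le_cancel_right)
          have hp: "(pderiv ^^ j) (smult a q) = smult a ((pderiv ^^ j) q)" for j a and q :: "real poly"
            by (induction j) (auto simp: pderiv_smult)
          have "\<bar>\<theta> i l y * poly ((pderiv ^^ (m - l)) (Q i)) y\<bar> =
              c i ^ l * \<bar>\<Theta> l (c i * y + - c i * x (k i))\<bar> * (\<bar>D i\<bar> * (?q * L i))"
            unfolding Q_def hp \<theta>_def using c(1)[OF i] L[OF i] by (simp add: abs_mult power_abs mult_ac)
          also have "\<dots> \<le> c i ^ l * B l * (\<bar>D i\<bar> * (?K * L i ^ l))"
            by (rule mult_mono[OF mult_left_mono[OF B] mult_left_mono[OF q]])
              (use c(1)[OF i] L[OF i] B0 in auto)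
          also have "\<dots> = (c i * L i) ^ l * (B l * ?K * \<bar>D i\<bar>)" by (simp add: power_mult_distrib mult_ac)
          also have "\<dots> \<le> real m ^ l * (B l * ?K * \<bar>D i\<bar>)"
            using c[OF i] L[OF i] B0 by (intro mult_right_mono power_mono) auto
          finally show ?thesis by (simp add: mult_ac)
        qed
        have "\<bar>leibniz (\<theta> i) (\<lambda>j. poly ((pderiv ^^ j) (Q i))) m y\<bar> \<le>
            (\<Sum>l\<le>m. \<bar>real (m choose l) * (\<theta> i l y * poly ((pderiv ^^ (m - l)) (Q i)) y)\<bar>)"
          unfolding leibniz_def by (rule sum_abs)
        also have "\<dots> \<le> (\<Sum>l\<le>m. real (m choose l) * (real m ^ l * B l * (1 + real m) ^ (m - 1) * \<bar>D i\<bar>))"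
          unfolding abs_mult[of "real _"] abs_of_nat by (intro sum_mono mult_left_mono bd) auto
        also have "\<dots> = C0 * \<bar>D i\<bar>" unfolding C0_def sum_distrib_right by (simp add: mult_ac)
        finally show ?thesis using yI by simp
      qed
    qed
    have P0: "poly ((pderiv ^^ m) (P 0)) y = 0" for y
    proof -
      have "degree (P 0) \<le> card (x ` {0..<0 + m}) - 1" unfolding P_def by (rule degree_lagrange_poly) simp
      also have "\<dots> \<le> m - 1" using card_image_le[of "{0..<0 + m}" x] by auto
      finally show ?thesis using m by (subst poly_pderiv_iterate_degree_le) (auto intro: coeff_eq_0)
    qed
    have pt: "\<bar>G m y\<bar> powr p \<le> C powr p * (\<Sum>i\<le>?N. indicator (I i) y * \<bar>D i\<bar> powr p)" for y
    proof -
      let ?S = "{i. i \<le> ?N \<and> y \<in> I i}"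
      have "\<bar>G m y\<bar> \<le> (\<Sum>i\<le>?N. \<bar>leibniz (\<theta> i) (\<lambda>j. poly ((pderiv ^^ j) (Q i))) m y\<bar>)"
        unfolding G_def P0 by (simp add: sum_abs)
      also have "\<dots> \<le> (\<Sum>i\<le>?N. C0 * (indicator (I i) y * \<bar>D i\<bar>))"
        by (intro sum_mono term_bound) auto
      also have "\<dots> = C0 * (\<Sum>i\<in>?S. \<bar>D i\<bar>)"
        unfolding sum_distrib_left[symmetric]
        by (subst sum.mono_neutral_cong_right[where S = ?S and h = "\<lambda>i. \<bar>D i\<bar>"]) (auto simp: indicator_def)
      finally have "\<bar>G m y\<bar> powr p \<le> (C0 * (\<Sum>i\<in>?S. \<bar>D i\<bar>)) powr p"
        using p by (intro powr_mono2) auto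
      also have "\<dots> = C0 powr p * (\<Sum>i\<in>?S. \<bar>D i\<bar>) powr p"
        by (simp add: powr_mult)
      also have "\<dots> \<le> (C0 + 1) powr p * (real (Suc m) powr p * (\<Sum>i\<in>?S. \<bar>D i\<bar> powr p))"
        using C0 p card_overlap_le[OF x mn, of y]
        by (intro mult_mono powr_mono2 powr_sum_le) (auto simp: I_def)
      also have "\<dots> = C powr p * (\<Sum>i\<in>?S. \<bar>D i\<bar> powr p)"
        unfolding C_def using C0 by (subst powr_mult) auto
      also have "(\<Sum>i\<in>?S. \<bar>D i\<bar> powr p) = (\<Sum>i\<le>?N. indicator (I i) y * \<bar>D i\<bar> powr p)"
        by (rule sum.mono_neutral_cong_left) (auto simp: indicator_def)
      finally show ?thesis .
    qed
    let ?V = "\<Sum>i=0..n - m. (x (i + m) - x i) * \<bar>divided_difference f (x ` {i..i + m})\<bar> powr p"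
    have "G m \<in> Lp_ball lborel p (C powr p * ?V)"
    proof -
      have Gm: "continuous_on UNIV (G m)" using deriv_chain_continuous_on[OF chain[of "Suc m"]] by simp
      then have [measurable]: "G m \<in> borel_measurable borel" by (rule borel_measurable_continuous_onI)
      have iI: "integrable lborel (\<lambda>y. indicator (I i) y * \<bar>D i\<bar> powr p)" for i
        by (simp add: I_def emeasure_lborel_Icc_eq)
      then have iS: "integrable lborel (\<lambda>y. C powr p * (\<Sum>i\<le>?N. indicator (I i) y * \<bar>D i\<bar> powr p))"
        by (intro integrable_mult_right Bochner_Integration.integrable_sum) auto
      have iG: "integrable lborel (\<lambda>y. \<bar>G m y\<bar> powr p)"
      proof (rule Bochner_Integration.integrable_bound[OF iS])
        show "AE y in lborel. norm (\<bar>G m y\<bar> powr p) \<le>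
            norm (C powr p * (\<Sum>i\<le>?N. indicator (I i) y * \<bar>D i\<bar> powr p))"
          using order_trans[OF pt abs_ge_self] by (intro AE_I2) (simp only: real_norm_def abs_of_nonneg[OF powr_ge_zero])
      qed measurable
      have "(LINT y|lborel. \<bar>G m y\<bar> powr p) \<le> (LINT y|lborel. C powr p * (\<Sum>i\<le>?N. indicator (I i) y * \<bar>D i\<bar> powr p))"
        using iG iS pt by (rule integral_mono)
      also have "\<dots> = C powr p * (\<Sum>i\<le>?N. LINT y|lborel. indicator (I i) y * \<bar>D i\<bar> powr p)"
      proof -
        have "(LINT y|lborel. (\<Sum>i\<le>?N. indicator (I i) y * \<bar>D i\<bar> powr p)) =
            (\<Sum>i\<le>?N. LINT y|lborel. indicator (I i) y * \<bar>D i\<bar> powr p)"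
          by (rule Bochner_Integration.integral_sum) (rule iI)
        then show ?thesis by (simp only: integral_mult_right_zero)
      qed
      also have "(\<Sum>i\<le>?N. LINT y|lborel. indicator (I i) y * \<bar>D i\<bar> powr p) = ?V"
        unfolding atMost_atLeast0 using L by (intro sum.cong) (auto simp: I_def D_def L_def less_imp_le)
      finally show ?thesis using iG by (simp add: Lp_ball_def)
    qed
    moreover have "divided_difference ((prim ^^ m) (G m)) S = divided_difference f S"
      if S: "S \<subseteq> x ` {..n}" "card S = Suc m" for S
    proof -
      have "finite S" using S by (intro card_ge_0_finite) simp
      then have "divided_difference ((prim ^^ m) (G m)) S = divided_difference (G 0) S"
        using chain S by (intro divided_difference_prim_iterate)
      also have "\<dots> = divided_difference f S"
        using S interp by (intro divided_difference_cong) auto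
      finally show ?thesis .
    qed
    ultimately show ?thesis by blast
  qed
  ultimately show ?thesis by blast
qed

section \<open>Necessity\<close>

lemma sobolev_deriv_chain:
  assumes "F \<in> homogeneous_sobolev m p"
  shows "deriv_chain (m - 1) (\<lambda>k. (deriv ^^ k) F)" "continuous_on UNIV ((deriv ^^ (m - 1)) F)"
  using assms
  by (auto simp: homogeneous_sobolev_def deriv_chain_def differentiable_on_def
      DERIV_deriv_iff_real_differentiable intro: absolutely_continuous_on_UNIV_imp_continuous)

text \<open>Any two weak derivatives have the same interval integrals, namely the increments of
  F^(m-1), so they agree almost everywhere and the choice operator is harmless.\<close>

lemma sobolev_seminorm_eq:
  assumes m: "m \<ge> 1" and F: "F \<in> homogeneous_sobolev m p" and g: "has_weak_derivative m F g"
  shows "sobolev_seminorm m p F = Lp_norm p g"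
proof -
  define g' where "g' = (SOME g. has_weak_derivative m F g)"
  have g': "has_weak_derivative m F g'" unfolding g'_def by (rule someI[of _ g]) (rule g)
  have loc: "locally_integrable g" "locally_integrable g'" using g g' by (auto simp: has_weak_derivative_def)
  note inc = weak_derivative_increment[OF _ m sobolev_deriv_chain[OF F]]
  have ae: "AE x in lebesgue. g' x = g x"
    by (rule AE_eq_if_interval_integrals_eq[OF loc(2,1)]) (simp add: inc[OF g, symmetric] inc[OF g', symmetric])
  note [measurable] = loc[THEN locally_integrable_measurable]
  have "(LINT x|lebesgue. \<bar>g' x\<bar> powr p) = (LINT x|lebesgue. \<bar>g x\<bar> powr p)"
    by (rule integral_cong_AE) (use ae in \<open>auto elim!: eventually_mono\<close>)
  then show ?thesis by (simp add: sobolev_seminorm_def Lp_norm_def g'_def)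
qed

text \<open>Jensen's inequality, obtained by integrating the tangent line of t^p at the mean A of
  |g|. The case A = 0 is separate because the tangent is available at positive points.\<close>

lemma set_integral_powr_le:
  fixes g :: "real \<Rightarrow> real"
  assumes p: "1 < p" and ab: "a < b"
    and g: "set_integrable lebesgue {a..b} g" "set_integrable lebesgue {a..b} (\<lambda>x. \<bar>g x\<bar> powr p)"
  shows "(b - a) * ((LINT x:{a..b}|lebesgue. \<bar>g x\<bar>) / (b - a)) powr p \<le> (LINT x:{a..b}|lebesgue. \<bar>g x\<bar> powr p)"
proof -
  define A where "A = (LINT x:{a..b}|lebesgue. \<bar>g x\<bar>) / (b - a)"
  have gi: "set_integrable lebesgue {a..b} (\<lambda>x. \<bar>g x\<bar>)" using g(1) by (rule set_integrable_abs)
  have "0 \<le> (LINT x:{a..b}|lebesgue. \<bar>g x\<bar>)"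
    unfolding set_lebesgue_integral_def by (intro integral_nonneg_AE) auto
  then have A0: "0 \<le> A" using ab by (simp add: A_def)
  show ?thesis
  proof (cases "A = 0")
    case True
    have "0 \<le> (LINT x:{a..b}|lebesgue. \<bar>g x\<bar> powr p)"
      unfolding set_lebesgue_integral_def by (intro integral_nonneg_AE) auto
    then show ?thesis using True unfolding A_def[symmetric] by simp
  next
    case False
    then have A: "0 < A" using A0 by simp
    define c d where "c = p * A powr (p - 1)" and "d = A powr p - p * A powr (p - 1) * A"
    have ic: "set_integrable lebesgue {a..b} (\<lambda>_. d)"
      using borel_integrable_atLeastAtMost'[OF continuous_on_const, of a b d]
      by (simp add: set_integrable_lebesgue_eq_lborel)
    have icd: "(LINT x:{a..b}|lebesgue. d) = (b - a) * d"
    proof -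
      have "(LINT x:{a..b}|lebesgue. d) = (LINT x:{a..b}|lborel. d)"
        unfolding set_lebesgue_integral_def by (rule LINT_lebesgue_eq_lborel) measurable
      then show ?thesis using ab by (simp add: set_lebesgue_integral_def)
    qed
    have "(b - a) * A powr p = c * ((b - a) * A) + (b - a) * d" by (simp add: c_def d_def algebra_simps)
    also have "(b - a) * A = (LINT x:{a..b}|lebesgue. \<bar>g x\<bar>)" using ab by (simp add: A_def)
    also have "c * (LINT x:{a..b}|lebesgue. \<bar>g x\<bar>) + (b - a) * d = (LINT x:{a..b}|lebesgue. c * \<bar>g x\<bar> + d)"
      using gi ic by (subst set_integral_add) (auto simp: icd)
    also have "\<dots> \<le> (LINT x:{a..b}|lebesgue. \<bar>g x\<bar> powr p)"
    proof (rule set_integral_mono)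
      show "set_integrable lebesgue {a..b} (\<lambda>x. c * \<bar>g x\<bar> + d)"
        using gi ic by (intro set_integral_add) auto
      show "c * \<bar>g x\<bar> + d \<le> \<bar>g x\<bar> powr p" for x
        using powr_tangent_le[OF p A, of "\<bar>g x\<bar>"] by (simp add: c_def d_def algebra_simps)
    qed (rule g(2))
    finally show ?thesis unfolding A_def .
  qed
qed

text \<open>The recursion gives a difference of two divided differences of order m - 1; each is
  F^(m-1) / (m-1)! at a point of [a, b], and the increment between these points is an integral of
  g.\<close>

lemma abs_divided_difference_le:
  assumes m: "m \<ge> 1" and F: "F \<in> homogeneous_sobolev m p" and g: "has_weak_derivative m F g"
    and S: "finite S" "card S = Suc m" "S \<subseteq> {a..b}" "a \<in> S" "b \<in> S"
  shows "(b - a) * \<bar>divided_difference F S\<bar> \<le> (LINT x:{a..b}|lebesgue. \<bar>g x\<bar>)"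
proof -
  note chain = sobolev_deriv_chain[OF F]
  let ?u = "(deriv ^^ (m - 1)) F"
  have loc: "set_integrable lebesgue {s..t} g" for s t
    using g by (simp add: has_weak_derivative_def locally_integrable_def)
  have ab: "a < b"
  proof -
    have "a \<noteq> b"
    proof
      assume "a = b"
      then have "S \<subseteq> {a}" using S(3) by simp
      then have "card S \<le> 1" using card_mono[of "{a}" S] by simp
      then show False using S(2) m by simp
    qed
    then show ?thesis using S(3,4) by force
  qed
  have inc: "\<bar>?u t - ?u s\<bar> \<le> (LINT x:{a..b}|lebesgue. \<bar>g x\<bar>)" if "a \<le> s" "s \<le> t" "t \<le> b" for s t
  proof -
    have "\<bar>?u t - ?u s\<bar> \<le> (LINT x:{s..t}|lebesgue. \<bar>g x\<bar>)"
      using weak_derivative_increment[OF g m chain that(2)] set_integral_norm_bound[OF loc[of s t]] by simp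
    also have "\<dots> \<le> (LINT x:{a..b}|lebesgue. \<bar>g x\<bar>)"
      using set_integrable_abs[OF loc[of a b]] set_integrable_abs[OF loc[of s t]] that
      unfolding set_lebesgue_integral_def set_integrable_def
      by (intro integral_mono) (auto simp: indicator_def)
    finally show ?thesis .
  qed
  have mv: "\<exists>\<xi>\<in>{a..b}. ?u \<xi> = fact (m - 1) * divided_difference F (S - {c})" if "c \<in> S" for c
    using divided_difference_mean_value[OF chain(1), of "S - {c}" a b] S m that by auto
  obtain \<xi> \<eta> where \<xi>: "\<xi> \<in> {a..b}" "?u \<xi> = fact (m - 1) * divided_difference F (S - {a})"
    and \<eta>: "\<eta> \<in> {a..b}" "?u \<eta> = fact (m - 1) * divided_difference F (S - {b})"
    using mv[OF S(4)] mv[OF S(5)] by blast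
  have "(b - a) * \<bar>divided_difference F S\<bar> = \<bar>(b - a) * divided_difference F S\<bar>"
    using ab by (simp add: abs_mult)
  also have "\<dots> = \<bar>divided_difference F (S - {a}) - divided_difference F (S - {b})\<bar>"
    using divided_difference_recursion[OF S(1,4,5), of F] ab by simp
  \<comment> \<open>The gain 1 / (m-1)! is discarded.\<close>
  also have "\<dots> \<le> fact (m - 1) * \<bar>divided_difference F (S - {a}) - divided_difference F (S - {b})\<bar>"
    using mult_right_mono[OF fact_ge_1[of "m - 1"] abs_ge_zero[of "divided_difference F (S - {a}) - divided_difference F (S - {b})"]]
    by simp
  also have "\<dots> = \<bar>?u \<xi> - ?u \<eta>\<bar>"
    unfolding \<xi>(2) \<eta>(2) right_diff_distrib[symmetric] by (simp add: abs_mult)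
  also have "\<dots> \<le> (LINT x:{a..b}|lebesgue. \<bar>g x\<bar>)"
  proof (cases "\<xi> \<le> \<eta>")
    case True
    then show ?thesis using inc[of \<xi> \<eta>] \<xi> \<eta> by (simp add: abs_minus_commute)
  next
    case False
    then show ?thesis using inc[of \<eta> \<xi>] \<xi> \<eta> by simp
  qed
  finally show ?thesis .
qed

lemma variational_sum_le:
  assumes m: "m \<ge> 1" and p: "1 < p" and F: "F \<in> homogeneous_sobolev m p"
    and x: "strict_mono_on {..n} x" and mn: "m \<le> n"
  shows "(\<Sum>i=0..n - m. (x (i + m) - x i) * \<bar>divided_difference F (x ` {i..i + m})\<bar> powr p) powr (1 / p)
    \<le> real (Suc m) * sobolev_seminorm m p F"
proof -
  obtain g where g: "has_weak_derivative m F g" "g \<in> Lp_functions p"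
    using F by (auto simp: homogeneous_sobolev_def)
  have gp: "integrable lebesgue (\<lambda>x. \<bar>g x\<bar> powr p)" using g(2) by (simp add: Lp_functions_def)
  have loc: "set_integrable lebesgue {s..t} g" for s t
    using g by (simp add: has_weak_derivative_def locally_integrable_def)
  have gpi: "set_integrable lebesgue {s..t} (\<lambda>x. \<bar>g x\<bar> powr p)" for s t :: real
    unfolding set_integrable_def by (intro integrable_mult_indicator gp) auto
  define G where "G = (LINT x|lebesgue. \<bar>g x\<bar> powr p)"
  have G0: "0 \<le> G" unfolding G_def by (intro integral_nonneg_AE) auto
  have each: "(x (i + m) - x i) * \<bar>divided_difference F (x ` {i..i + m})\<bar> powr p \<le>
      (LINT y:{x i..x (i + m)}|lebesgue. \<bar>g y\<bar> powr p)" if i: "i \<in> {0..n - m}" for i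
  proof -
    let ?S = "x ` {i..i + m}" and ?a = "x i" and ?b = "x (i + m)"
    have im: "i + m \<le> n" using i mn by auto
    have le: "x j \<le> x l" if "j \<le> l" "l \<le> n" for j l
      using strict_mono_onD[OF x, of j l] that by (cases "j = l") auto
    have ab: "?a < ?b" using strict_mono_onD[OF x, of i "i + m"] im m by auto
    have inj: "inj_on x {i..i + m}"
      by (rule inj_on_subset[OF strict_mono_on_imp_inj_on[OF x]]) (use im in auto)
    have "(?b - ?a) * \<bar>divided_difference F ?S\<bar> \<le> (LINT y:{?a..?b}|lebesgue. \<bar>g y\<bar>)"
    proof (rule abs_divided_difference_le[OF m F g(1)])
      show "card ?S = Suc m" using inj by (simp add: card_image)
      show "?S \<subseteq> {?a..?b}" using im by (auto intro!: le)
    qed auto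
    then have "\<bar>divided_difference F ?S\<bar> \<le> (LINT y:{?a..?b}|lebesgue. \<bar>g y\<bar>) / (?b - ?a)"
      using ab by (simp add: field_simps)
    then have "(?b - ?a) * \<bar>divided_difference F ?S\<bar> powr p \<le>
        (?b - ?a) * ((LINT y:{?a..?b}|lebesgue. \<bar>g y\<bar>) / (?b - ?a)) powr p"
      using ab p by (intro mult_left_mono powr_mono2) auto
    also have "\<dots> \<le> (LINT y:{?a..?b}|lebesgue. \<bar>g y\<bar> powr p)"
      by (rule set_integral_powr_le[OF p ab loc gpi])
    finally show ?thesis .
  qed
  let ?T = "\<Sum>i=0..n - m. (x (i + m) - x i) * \<bar>divided_difference F (x ` {i..i + m})\<bar> powr p"
  have T0: "0 \<le> ?T"
  proof (intro sum_nonneg mult_nonneg_nonneg)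
    fix i assume "i \<in> {0..n - m}"
    then have im: "i + m \<le> n" using mn by auto
    show "0 \<le> x (i + m) - x i" using strict_mono_onD[OF x, of i "i + m"] im m by auto
  qed auto
  have "?T \<le> (\<Sum>i=0..n - m. LINT y:{x i..x (i + m)}|lebesgue. \<bar>g y\<bar> powr p)"
    by (rule sum_mono) (rule each)
  also have "\<dots> \<le> real (Suc m) * G"
    unfolding G_def
  proof (rule sum_set_integral_le[OF _ gp])
    fix y
    have "(\<Sum>i=0..n - m. indicat_real {x i..x (i + m)} y) = real (card {i. i \<le> n - m \<and> y \<in> {x i..x (i + m)}})"
      unfolding indicator_def of_bool_def
      by (subst sum.inter_filter[symmetric]) (auto intro!: arg_cong[where f = card])
    then show "(\<Sum>i=0..n - m. indicat_real {x i..x (i + m)} y) \<le> real (Suc m)"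
      using card_overlap_le[OF x mn, of y] by simp
  qed auto
  finally have "?T powr (1 / p) \<le> (real (Suc m) * G) powr (1 / p)"
    using T0 p by (intro powr_mono2) auto
  also have "\<dots> = real (Suc m) powr (1 / p) * G powr (1 / p)" by (simp add: powr_mult)
  \<comment> \<open>Replacing the exponent 1/p by 1 makes the constant independent of p.\<close>
  also have "\<dots> \<le> real (Suc m) powr 1 * G powr (1 / p)"
    using p by (intro mult_right_mono powr_mono) auto
  also have "G powr (1 / p) = sobolev_seminorm m p F"
    by (simp add: sobolev_seminorm_eq[OF m F g(1)] Lp_norm_def G_def)
  finally show ?thesis by simp
qed

section \<open>Extension from an arbitrary set\<close>

text \<open>One of the two sets is empty or {0}. Integrals over fixed sets let linearity and limits
  pass through without distinguishing the sign of z.\<close>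

lemma prim_eq_set_integral:
  assumes "\<And>a b. set_integrable lborel {a..b} h"
  shows "prim h z = (LINT t:{0..z}|lborel. h t) - (LINT t:{z..0}|lborel. h t)"
proof -
  have 0: "prim h 0 = 0" by (simp add: prim_def zero_ereal_def)
  have null: "(LINT t:{s..0}|lborel. h t) = 0" "(LINT t:{0..s'}|lborel. h t) = 0"
    if "0 \<le> s" "s' \<le> 0" for s s' :: real
  proof -
    have "(LINT t:{}|lborel. h t) = 0" by (simp add: set_lebesgue_integral_def)
    have "(LINT t:{0..0}|lborel. h t) = 0" using prim_diff[OF assms, of 0 0] by simp
    moreover have "{s..0} = {} \<or> {s..0} = {0..0}" "{0..s'} = {} \<or> {0..s'} = {0..0}" using that by auto
    ultimately show "(LINT t:{s..0}|lborel. h t) = 0" "(LINT t:{0..s'}|lborel. h t) = 0"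
      using \<open>(LINT t:{}|lborel. h t) = 0\<close> by metis+
  qed
  show ?thesis
  proof (cases "0 \<le> z")
    case True
    then show ?thesis using prim_diff[OF assms True] 0 null(1)[OF True order_refl] by simp
  next
    case False
    then show ?thesis using prim_diff[OF assms, of z 0] 0 null(2)[OF order_refl, of z] by simp
  qed
qed

lemma set_integrable_continuous_Icc:
  fixes u :: "real \<Rightarrow> real"
  assumes "continuous_on UNIV u"
  shows "set_integrable lborel {a..b} u"
  by (rule borel_integrable_atLeastAtMost'[OF continuous_on_subset[OF assms]]) simp

lemma prim_midpoint:
  assumes "\<And>s t. set_integrable lborel {s..t} a" "\<And>s t. set_integrable lborel {s..t} b"
  shows "prim (\<lambda>x. (a x + b x) / 2) = (\<lambda>x. (prim a x + prim b x) / 2)"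
proof
  fix z
  have i: "set_integrable lborel {s..t} (\<lambda>x. (a x + b x) / 2)" for s t
    using assms by (intro set_integrable_divide set_integral_add) auto
  have "(LINT x:{s..t}|lborel. (a x + b x) / 2) =
      ((LINT x:{s..t}|lborel. a x) + (LINT x:{s..t}|lborel. b x)) / 2" for s t
    using assms by (simp add: set_integral_divide_zero set_integral_add)
  then show "prim (\<lambda>x. (a x + b x) / 2) z = (prim a z + prim b z) / 2"
    unfolding prim_eq_set_integral[OF i] prim_eq_set_integral[OF assms(1)] prim_eq_set_integral[OF assms(2)]
    by (simp add: field_simps)
qed

text \<open>Midpoints stay in the ball, and this is the form of linearity that
  \<open>Lp_moment_compactness\<close> asks for.\<close>

lemma prim_iterate_midpoint:
  assumes p: "1 < p" and a: "a \<in> Lp_ball lborel p K" and b: "b \<in> Lp_ball lborel p K"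
  shows "(prim ^^ j) (\<lambda>x. (a x + b x) / 2) = (\<lambda>x. ((prim ^^ j) a x + (prim ^^ j) b x) / 2)"
proof (induction j)
  case (Suc j)
  have i: "set_integrable lborel {s..t} ((prim ^^ j) c)" if "c \<in> Lp_ball lborel p K" for s t c
    using that p Lp_ball_set_integrable[OF that p] set_integrable_continuous_Icc continuous_on_prim_iterate[OF that p]
    by (cases j) auto
  show ?case unfolding funpow.simps comp_def Suc by (rule prim_midpoint[OF i[OF a] i[OF b]])
qed simp

lemma prim_tendsto:
  assumes "\<And>n a b. set_integrable lborel {a..b} (hs n)" "\<And>a b. set_integrable lborel {a..b} h"
    and "\<And>a b. (\<lambda>n. LINT t:{a..b}|lborel. hs n t) \<longlonglongrightarrow> (LINT t:{a..b}|lborel. h t)"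
  shows "(\<lambda>n. prim (hs n) z) \<longlonglongrightarrow> prim h z"
  unfolding prim_eq_set_integral[OF assms(1)] prim_eq_set_integral[OF assms(2)]
  by (intro tendsto_diff assms(3))

lemma abs_prim_le:
  assumes int: "\<And>a b. set_integrable lborel {a..b} h" and z: "\<bar>z\<bar> \<le> R"
    and J: "(LINT t:{-R..R}|lborel. \<bar>h t\<bar>) \<le> J"
  shows "\<bar>prim h z\<bar> \<le> J"
proof -
  have "\<bar>LINT t:{a..b}|lborel. h t\<bar> \<le> J" if "-R \<le> a" "b \<le> R" for a b
  proof -
    have "\<bar>LINT t:{a..b}|lborel. h t\<bar> \<le> (LINT t:{a..b}|lborel. \<bar>h t\<bar>)"
      using set_integral_norm_bound[OF int[of a b]] by simp
    also have "\<dots> \<le> (LINT t:{-R..R}|lborel. \<bar>h t\<bar>)"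
      using set_integrable_abs[OF int[of a b]] set_integrable_abs[OF int[of "-R" R]] that
      unfolding set_lebesgue_integral_def set_integrable_def
      by (intro integral_mono) (auto simp: indicator_def)
    finally show ?thesis using J by linarith
  qed
  moreover have "prim h z = (LINT t:{0..z}|lborel. h t) \<or> prim h z = - (LINT t:{z..0}|lborel. h t)"
  proof -
    have 0: "prim h 0 = 0" by (simp add: prim_def zero_ereal_def)
    show ?thesis using prim_diff[OF int, of 0 z] prim_diff[OF int, of z 0] 0 by (cases "0 \<le> z") auto
  qed
  ultimately show ?thesis using z by (auto simp: abs_le_iff)
qed

text \<open>The first primitive converges by L_1 convergence on bounded intervals, each later one by
  dominated convergence from pointwise convergence of its predecessor.\<close>

lemma prim_iterate_tendsto:
  assumes p: "1 < p" and hs: "\<And>n. hs n \<in> Lp_ball lborel p K" and h: "h \<in> Lp_ball lborel p K"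
    and lim: "AE x in lborel. (\<lambda>n. hs n x) \<longlonglongrightarrow> h x"
  shows "(\<lambda>n. (prim ^^ Suc j) (hs n) z) \<longlonglongrightarrow> (prim ^^ Suc j) h z"
proof -
  \<comment> \<open>Provides the dominating constants. At the first level |h| \<le> 1 + |h|^p
    integrates over [-R, R] to at most 2|R| + K; every further level multiplies by the
    length.\<close>
  have bdd: "\<exists>J. \<forall>n z. \<bar>z\<bar> \<le> R \<longrightarrow> \<bar>(prim ^^ Suc j) (hs n) z\<bar> \<le> J" for R j
  proof (induction j)
    case 0
    have "\<bar>prim (hs n) z\<bar> \<le> 2 * \<bar>R\<bar> + K" if "\<bar>z\<bar> \<le> R" for n z
    proof (rule abs_prim_le[OF Lp_ball_set_integrable[OF hs p] that])
      note D = Lp_ballD[OF hs[of n]]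
      have "(LINT t:{-R..R}|lborel. \<bar>hs n t\<bar>) \<le> (LINT t|lborel. indicator {-R..R} t + \<bar>hs n t\<bar> powr p)"
        unfolding set_lebesgue_integral_def
      proof (rule integral_mono)
        show "integrable lborel (\<lambda>t. indicator {-R..R} t *\<^sub>R \<bar>hs n t\<bar>)"
          using set_integrable_abs[OF Lp_ball_set_integrable[OF hs p]] by (simp add: set_integrable_def)
        show "integrable lborel (\<lambda>t. indicator {-R..R} t + \<bar>hs n t\<bar> powr p)"
          using D(2) by (intro Bochner_Integration.integrable_add integrable_real_indicator)
            (auto simp: emeasure_lborel_Icc_eq)
        show "indicat_real {-R..R} t *\<^sub>R \<bar>hs n t\<bar> \<le> indicator {-R..R} t + \<bar>hs n t\<bar> powr p" for t
          using le_const_add_powr[OF p, of 1 "\<bar>hs n t\<bar>"] by (auto simp: indicator_def)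
      qed
      also have "\<dots> = (LINT t|lborel. indicator {-R..R} t) + (LINT t|lborel. \<bar>hs n t\<bar> powr p)"
        using D(2) by (intro Bochner_Integration.integral_add integrable_real_indicator)
          (auto simp: emeasure_lborel_Icc_eq)
      also have "\<dots> \<le> 2 * \<bar>R\<bar> + K" using D(3) by (intro add_mono) (auto simp: content_real_if)
      finally show "(LINT t:{-R..R}|lborel. \<bar>hs n t\<bar>) \<le> 2 * \<bar>R\<bar> + K" .
    qed
    then show ?case by auto
  next
    case (Suc j)
    then obtain J where J: "\<And>n z. \<bar>z\<bar> \<le> R \<Longrightarrow> \<bar>(prim ^^ Suc j) (hs n) z\<bar> \<le> J" by blast
    have "\<bar>prim ((prim ^^ Suc j) (hs n)) z\<bar> \<le> 2 * \<bar>R\<bar> * \<bar>J\<bar>" if z: "\<bar>z\<bar> \<le> R" for n z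
    proof (rule abs_prim_le[OF set_integrable_continuous_Icc[OF continuous_on_prim_iterate[OF hs p]] z])
      let ?u = "(prim ^^ Suc j) (hs n)"
      have R: "0 \<le> R" using z by linarith
      have "(LINT t:{-R..R}|lborel. \<bar>?u t\<bar>) \<le> (LINT t:{-R..R}|lborel. \<bar>J\<bar>)"
      proof (rule set_integral_mono)
        show "set_integrable lborel {-R..R} (\<lambda>t. \<bar>?u t\<bar>)"
          by (rule set_integrable_abs[OF set_integrable_continuous_Icc[OF continuous_on_prim_iterate[OF hs p]]])
        show "set_integrable lborel {-R..R} (\<lambda>t. \<bar>J\<bar>)"
          by (rule set_integrable_continuous_Icc) simp
        show "\<bar>?u t\<bar> \<le> \<bar>J\<bar>" if "t \<in> {-R..R}" for t
          using J[of t n] that by (auto simp: abs_le_iff)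
      qed
      also have "\<dots> = 2 * \<bar>R\<bar> * \<bar>J\<bar>" using R by (simp add: set_lebesgue_integral_def)
      finally show "(LINT t:{-R..R}|lborel. \<bar>?u t\<bar>) \<le> 2 * \<bar>R\<bar> * \<bar>J\<bar>" .
    qed
    then show ?case unfolding funpow.simps(2)[of "Suc j"] comp_def by blast
  qed
  show ?thesis
  proof (induction j arbitrary: z)
    case 0
    have "(\<lambda>n. LINT t:{a..b}|lborel. hs n t) \<longlonglongrightarrow> (LINT t:{a..b}|lborel. h t)" for a b :: real
      by (rule Lp_ball_tendsto_set_integral[OF hs h lim p]) (auto simp: emeasure_lborel_Icc_eq)
    then show ?case
      using prim_tendsto[of hs h z] Lp_ball_set_integrable[OF hs p] Lp_ball_set_integrable[OF h p] by simp
  next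
    case (Suc j)
    let ?u = "\<lambda>n. (prim ^^ Suc j) (hs n)" and ?v = "(prim ^^ Suc j) h"
    have c: "continuous_on UNIV (?u n)" "continuous_on UNIV ?v" for n
      using continuous_on_prim_iterate[OF hs p] continuous_on_prim_iterate[OF h p] by auto
    note [measurable] = c[THEN borel_measurable_continuous_onI]
    have "(\<lambda>n. LINT t:{a..b}|lborel. ?u n t) \<longlonglongrightarrow> (LINT t:{a..b}|lborel. ?v t)" for a b
    proof -
      obtain J where J: "\<And>n z. \<bar>z\<bar> \<le> \<bar>a\<bar> + \<bar>b\<bar> \<Longrightarrow> \<bar>?u n z\<bar> \<le> J"
        using bdd[of "\<bar>a\<bar> + \<bar>b\<bar>" j] by blast
      show ?thesis unfolding set_lebesgue_integral_def
      proof (rule integral_dominated_convergence[where w = "\<lambda>t. J * indicator {a..b} t"])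
        show "integrable lborel (\<lambda>t. J * indicator {a..b} t)"
          by (intro integrable_mult_right integrable_real_indicator) (auto simp: emeasure_lborel_Icc_eq)
        show "AE t in lborel. (\<lambda>n. indicator {a..b} t *\<^sub>R ?u n t) \<longlonglongrightarrow> indicator {a..b} t *\<^sub>R ?v t"
          using Suc by (intro AE_I2 tendsto_scaleR tendsto_const)
        show "AE t in lborel. norm (indicat_real {a..b} t *\<^sub>R ?u n t) \<le> J * indicator {a..b} t" for n
          using J[of _ n] by (intro AE_I2) (auto simp: indicator_def)
      qed measurable
    qed
    then have "(\<lambda>n. prim (?u n) z) \<longlonglongrightarrow> prim ?v z"
      by (intro prim_tendsto set_integrable_continuous_Icc c)
    then show ?case by simp
  qed
qed

lemma finite_set_strict_mono_enumeration:
  fixes T :: "real set"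
  assumes "finite T" "card T = Suc n"
  shows "\<exists>x. strict_mono_on {..n} x \<and> x ` {..n} = T"
proof (intro exI conjI)
  let ?x = "\<lambda>i. sorted_list_of_set T ! i"
  have len: "length (sorted_list_of_set T) = Suc n" using assms by simp
  show "strict_mono_on {..n} ?x"
    using sorted_wrt_nth_less[OF strict_sorted_list_of_set[of T]] len
    by (auto simp: strict_mono_on_def)
  have "?x ` {..n} = set (sorted_list_of_set T)"
    unfolding set_conv_nth len by (auto simp: less_Suc_eq_le)
  then show "?x ` {..n} = T" using assms by simp
qed

text \<open>T bounds the sums before the p-th root, which matches the radius of
  \<open>Lp_ball\<close>. The moment conditions are indexed by the points of E outside the fixed set
  of m points.\<close>

lemma sobolev_extension_exists:
  assumes m: "m \<ge> 1"
  shows "\<exists>C\<ge>1. \<forall>p E f T. 1 < p \<longrightarrow> (infinite E \<or> m + 1 \<le> card E) \<longrightarrow>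
    (\<forall>n x. m \<le> n \<longrightarrow> strict_mono_on {..n} x \<longrightarrow> x ` {..n} \<subseteq> E \<longrightarrow>
      (\<Sum>i=0..n - m. (x (i + m) - x i) * \<bar>divided_difference f (x ` {i..i + m})\<bar> powr p) \<le> T) \<longrightarrow>
    (\<exists>F\<in>homogeneous_sobolev m p. (\<forall>y\<in>E. F y = f y) \<and> sobolev_seminorm m p F \<le> C * T powr (1 / p))"
proof -
  obtain C where C: "1 \<le> C" and sol: "\<And>p f n x. 1 < p \<Longrightarrow> m \<le> n \<Longrightarrow> strict_mono_on {..n} x \<Longrightarrow>
    \<exists>h\<in>Lp_ball lborel p (C powr p *
        (\<Sum>i=0..n - m. (x (i + m) - x i) * \<bar>divided_difference f (x ` {i..i + m})\<bar> powr p)).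
      \<forall>S\<subseteq>x ` {..n}. card S = Suc m \<longrightarrow>
        divided_difference ((prim ^^ m) h) S = divided_difference f S"
    using finite_moment_solution[OF m] by blast
  have "\<exists>F\<in>homogeneous_sobolev m p. (\<forall>y\<in>E. F y = f y) \<and> sobolev_seminorm m p F \<le> C * T powr (1 / p)"
    if p: "1 < p" and E: "infinite E \<or> m + 1 \<le> card E"
      and T: "\<And>n x. m \<le> n \<Longrightarrow> strict_mono_on {..n} x \<Longrightarrow> x ` {..n} \<subseteq> E \<Longrightarrow>
        (\<Sum>i=0..n - m. (x (i + m) - x i) * \<bar>divided_difference f (x ` {i..i + m})\<bar> powr p) \<le> T"
    for p E f T
  proof -
    let ?K = "C powr p * T"
    \<comment> \<open>One point more than the m fixed ones, so that finite subproblems always have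
      the m + 1 nodes that \<open>finite_moment_solution\<close> expects, even for an empty set of
      conditions.\<close>
    obtain S1 where S1: "finite S1" "card S1 = m + 1" "S1 \<subseteq> E"
    proof (cases "finite E")
      case True
      then have "m + 1 \<le> card E" using E by simp
      then show ?thesis using that obtain_subset_with_card_n by metis
    next
      case False
      then show ?thesis using that infinite_arbitrarily_large[of E "m + 1"] by blast
    qed
    obtain z where z: "z \<in> S1" using S1(2) by (cases "S1 = {}") auto
    define S0 where "S0 = S1 - {z}"
    have S0: "finite S0" "card S0 = m" "S0 \<subseteq> E" using S1 z by (auto simp: S0_def)
    have "\<exists>h\<in>Lp_ball lborel p ?K. \<forall>y\<in>E - S0.
        divided_difference ((prim ^^ m) h) (insert y S0) = divided_difference f (insert y S0)"
    proof (rule Lp_moment_compactness[OF p])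
      fix y and a b :: "real \<Rightarrow> real" assume "a \<in> Lp_ball lborel p ?K" "b \<in> Lp_ball lborel p ?K"
      from prim_iterate_midpoint[OF p this, of m]
      show "divided_difference ((prim ^^ m) (\<lambda>x. (a x + b x) / 2)) (insert y S0) =
          (divided_difference ((prim ^^ m) a) (insert y S0) + divided_difference ((prim ^^ m) b) (insert y S0)) / 2"
        using divided_difference_cmult[of "1/2" "\<lambda>x. (prim ^^ m) a x + (prim ^^ m) b x" "insert y S0"]
        by (simp add: divided_difference_add)
    next
      fix y and hs :: "nat \<Rightarrow> real \<Rightarrow> real" and h
      assume "\<And>n. hs n \<in> Lp_ball lborel p ?K" "h \<in> Lp_ball lborel p ?K"
        "AE x in lborel. (\<lambda>n. hs n x) \<longlonglongrightarrow> h x"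
      from prim_iterate_tendsto[OF p this, of "m - 1"]
      have "(\<lambda>n. (prim ^^ m) (hs n) w) \<longlonglongrightarrow> (prim ^^ m) h w" for w using m by simp
      then show "(\<lambda>n. divided_difference ((prim ^^ m) (hs n)) (insert y S0)) \<longlonglongrightarrow>
          divided_difference ((prim ^^ m) h) (insert y S0)"
        unfolding divided_difference_def divide_inverse by (intro tendsto_sum tendsto_mult tendsto_const)
    next
      fix S assume S: "finite S" "S \<subseteq> E - S0"
      define V where "V = S1 \<union> S"
      have V: "finite V" "V \<subseteq> E" using S1 S by (auto simp: V_def)
      have "m + 1 \<le> card V" using card_mono[OF V(1), of S1] S1(2) by (simp add: V_def)
      then obtain n where n: "card V = Suc n" "m \<le> n" by (cases "card V") auto
      obtain x where x: "strict_mono_on {..n} x" "x ` {..n} = V"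
        using finite_set_strict_mono_enumeration[OF V(1) n(1)] by blast
      obtain h where h: "h \<in> Lp_ball lborel p (C powr p *
          (\<Sum>i=0..n - m. (x (i + m) - x i) * \<bar>divided_difference f (x ` {i..i + m})\<bar> powr p))"
        "\<And>W. W \<subseteq> x ` {..n} \<Longrightarrow> card W = Suc m \<Longrightarrow>
          divided_difference ((prim ^^ m) h) W = divided_difference f W"
        using sol[OF p n(2) x(1), of f] by blast
      have "C powr p * (\<Sum>i=0..n - m. (x (i + m) - x i) * \<bar>divided_difference f (x ` {i..i + m})\<bar> powr p) \<le> ?K"
        using T[OF n(2) x(1)] x(2) V(2) by (intro mult_left_mono) auto
      then have "h \<in> Lp_ball lborel p ?K" using Lp_ballD[OF h(1)] by (simp add: Lp_ball_def)
      moreover have "divided_difference ((prim ^^ m) h) (insert y S0) = divided_difference f (insert y S0)"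
        if "y \<in> S" for y
      proof (rule h(2))
        show "insert y S0 \<subseteq> x ` {..n}" unfolding x(2) V_def S0_def using that by auto
        show "card (insert y S0) = Suc m" using S0 S that by auto
      qed
      ultimately show "\<exists>h\<in>Lp_ball lborel p ?K. \<forall>y\<in>S.
          divided_difference ((prim ^^ m) h) (insert y S0) = divided_difference f (insert y S0)" by blast
    qed
    then obtain h where h: "h \<in> Lp_ball lborel p ?K"
      "\<And>y. y \<in> E - S0 \<Longrightarrow> divided_difference f (insert y S0) = divided_difference ((prim ^^ m) h) (insert y S0)"
      by (metis (no_types))
    \<comment> \<open>On E the defect f - \<open>(prim ^^ m) h\<close> is one polynomial of degree
      less than m, namely its interpolant on S0.\<close>
    define q where "q = lagrange_poly (\<lambda>x. f x - (prim ^^ m) h x) S0"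
    have q: "degree q < m"
      using degree_lagrange_poly[OF S0(1), of "\<lambda>x. f x - (prim ^^ m) h x"] S0(2) m by (simp add: q_def)
    define F where "F = (\<lambda>x. poly q x + (prim ^^ m) h x)"
    have F: "F \<in> homogeneous_sobolev m p" "has_weak_derivative m F h"
      unfolding F_def by (rule iterated_primitive_sobolev[OF m p h(1) q])+
    have "F y = f y" if "y \<in> E" for y
      using divided_difference_eq_imp_eq_lagrange_poly[OF S0(1), of y f "(prim ^^ m) h"] h(2)[of y] that
      by (simp add: F_def q_def)
    moreover have "sobolev_seminorm m p F \<le> C * T powr (1 / p)"
    proof -
      note D = Lp_ballD[OF h(1)]
      have [measurable]: "h \<in> borel_measurable borel" using D(1) by simp
      have N0: "0 \<le> (LINT x|lborel. \<bar>h x\<bar> powr p)" by (intro integral_nonneg_AE) auto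
      have "sobolev_seminorm m p F = (LINT x|lborel. \<bar>h x\<bar> powr p) powr (1 / p)"
        unfolding sobolev_seminorm_eq[OF m F] Lp_norm_def by (subst LINT_lebesgue_eq_lborel) auto
      also have "\<dots> \<le> ?K powr (1 / p)" using D(3) N0 p by (intro powr_mono2) auto
      also have "\<dots> = C * T powr (1 / p)" using C p by (simp add: powr_mult powr_powr)
      finally show ?thesis .
    qed
    ultimately show ?thesis using F(1) by blast
  qed
  then show ?thesis using C by blast
qed

theorem theorem1p3:
  fixes m :: nat
  assumes "m \<ge> 1"
  shows "\<exists>C::real. C \<ge> 1 \<and>
    (\<forall>(p::real) (E::real set) (f::real \<Rightarrow> real).
       1 < p \<longrightarrow> closed E \<longrightarrow> (infinite E \<or> m + 1 \<le> card E) \<longrightarrow>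
       ((\<exists>F\<in>homogeneous_sobolev m p. \<forall>x\<in>E. F x = f x) \<longleftrightarrow> variational_functional m p f E < top) \<and>
       ennreal (1 / C) * variational_functional m p f E \<le> trace_seminorm m p E f \<and>
       trace_seminorm m p E f \<le> ennreal C * variational_functional m p f E)"
proof -
  obtain C0 where C0: "1 \<le> C0" and ext: "\<And>p E f T. 1 < p \<Longrightarrow> infinite E \<or> m + 1 \<le> card E \<Longrightarrow>
    (\<And>n x. m \<le> n \<Longrightarrow> strict_mono_on {..n} x \<Longrightarrow> x ` {..n} \<subseteq> E \<Longrightarrow>
      (\<Sum>i=0..n - m. (x (i + m) - x i) * \<bar>divided_difference f (x ` {i..i + m})\<bar> powr p) \<le> T) \<Longrightarrow>
    \<exists>F\<in>homogeneous_sobolev m p. (\<forall>y\<in>E. F y = f y) \<and> sobolev_seminorm m p F \<le> C0 * T powr (1 / p)"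
    using sobolev_extension_exists[OF assms] by blast
  \<comment> \<open>\<open>C0\<close> serves the extension, m + 1 the necessity estimate.\<close>
  define C where "C = max C0 (real (Suc m))"
  have C: "1 \<le> C" "C0 \<le> C" "real (Suc m) \<le> C" using C0 by (auto simp: C_def)
  have "((\<exists>F\<in>homogeneous_sobolev m p. \<forall>x\<in>E. F x = f x) \<longleftrightarrow> variational_functional m p f E < top) \<and>
       ennreal (1 / C) * variational_functional m p f E \<le> trace_seminorm m p E f \<and>
       trace_seminorm m p E f \<le> ennreal C * variational_functional m p f E"
    if p: "1 < p" and E: "infinite E \<or> m + 1 \<le> card E" for p E f
  proof -
    let ?V = "variational_functional m p f E"
    let ?\<Sigma> = "\<lambda>n x. \<Sum>i=0..n - m. (x (i + m) - x i) * \<bar>divided_difference f (x ` {i..i + m})\<bar> powr p"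
    have V_ge: "ennreal (?\<Sigma> n x powr (1 / p)) \<le> ?V"
      if "m \<le> n" "strict_mono_on {..n} x" "x ` {..n} \<subseteq> E" for n x
      unfolding variational_functional_def
      using that by (intro SUP_upper2[of "(n, x)"]) auto
    have upper: "?V \<le> ennreal (C * sobolev_seminorm m p F)"
      if F: "F \<in> homogeneous_sobolev m p" "\<forall>x\<in>E. F x = f x" for F
      unfolding variational_functional_def
    proof (rule SUP_least, clarsimp)
      fix n x assume n: "m \<le> n" and x: "strict_mono_on {..n} x" and xE: "x ` {..n} \<subseteq> E"
      have "divided_difference f (x ` {i..i + m}) = divided_difference F (x ` {i..i + m})"
        if "i \<in> {0..n - m}" for i
      proof (rule divided_difference_cong)
        fix z assume "z \<in> x ` {i..i + m}"
        moreover have "{i..i + m} \<subseteq> {..n}" using that n by auto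
        ultimately have "z \<in> E" using xE by blast
        then show "f z = F z" using F(2) by simp
      qed
      then have "?\<Sigma> n x = (\<Sum>i=0..n - m. (x (i + m) - x i) * \<bar>divided_difference F (x ` {i..i + m})\<bar> powr p)"
        by (intro sum.cong) auto
      then have "?\<Sigma> n x powr (1 / p) \<le> real (Suc m) * sobolev_seminorm m p F"
        using variational_sum_le[OF assms p F(1) x n] by simp
      also have "\<dots> \<le> C * sobolev_seminorm m p F"
        using C(3) by (intro mult_right_mono) (simp_all add: sobolev_seminorm_def Lp_norm_def)
      finally show "ennreal (?\<Sigma> n x powr (1 / p)) \<le> ennreal (C * sobolev_seminorm m p F)"
        by (rule ennreal_leI)
    qed
    have lower: "\<exists>F\<in>homogeneous_sobolev m p. (\<forall>x\<in>E. F x = f x) \<and>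
        ennreal (sobolev_seminorm m p F) \<le> ennreal C * ?V" if fin: "?V < top"
    proof -
      define L where "L = enn2real ?V"
      have L: "?V = ennreal L" "0 \<le> L" using fin by (auto simp: L_def)
      \<comment> \<open>The extension lemma takes a bound on the sums themselves, so it is applied
        with T = L^p, whose p-th root returns L.\<close>
      have "\<exists>F\<in>homogeneous_sobolev m p. (\<forall>y\<in>E. F y = f y) \<and>
          sobolev_seminorm m p F \<le> C0 * (L powr p) powr (1 / p)"
      proof (rule ext[OF p E])
        fix n x assume n: "m \<le> n" and x: "strict_mono_on {..n} x" and xE: "x ` {..n} \<subseteq> E"
        have \<Sigma>0: "0 \<le> ?\<Sigma> n x"
        proof (intro sum_nonneg mult_nonneg_nonneg)
          fix i assume "i \<in> {0..n - m}"
          then have im: "i + m \<le> n" using n by auto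
          show "0 \<le> x (i + m) - x i" using strict_mono_onD[OF x, of i "i + m"] im assms by auto
        qed auto
        have "?\<Sigma> n x powr (1 / p) \<le> L" using V_ge[OF n x xE] L by (simp add: ennreal_le_iff)
        then have "(?\<Sigma> n x powr (1 / p)) powr p \<le> L powr p" using p by (intro powr_mono2) auto
        then show "?\<Sigma> n x \<le> L powr p" using \<Sigma>0 p by (simp add: powr_powr)
      qed
      then obtain F where F: "F \<in> homogeneous_sobolev m p" "\<forall>y\<in>E. F y = f y"
        "sobolev_seminorm m p F \<le> C0 * L" using L p by (auto simp: powr_powr)
      have "C0 * L \<le> C * L" using C(2) L(2) by (rule mult_right_mono)
      then have "ennreal (sobolev_seminorm m p F) \<le> ennreal (C * L)"
        using F(3) by (intro ennreal_leI) linarith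
      then show ?thesis using F C L by (auto simp: ennreal_mult)
    qed
    have "(\<exists>F\<in>homogeneous_sobolev m p. \<forall>x\<in>E. F x = f x) \<longleftrightarrow> ?V < top"
      using upper lower le_less_trans[OF _ ennreal_less_top] by blast
    moreover have "ennreal (1 / C) * ?V \<le> trace_seminorm m p E f"
      unfolding trace_seminorm_def
    proof (rule INF_greatest, clarsimp)
      fix F assume F: "F \<in> homogeneous_sobolev m p" "\<forall>x\<in>E. F x = f x"
      have "ennreal (1 / C) * ?V \<le> ennreal (1 / C) * ennreal (C * sobolev_seminorm m p F)"
        by (intro mult_left_mono upper[OF F]) simp
      also have "\<dots> = ennreal (1 / C * (C * sobolev_seminorm m p F))"
        using C by (subst ennreal_mult') auto
      also have "1 / C * (C * sobolev_seminorm m p F) = sobolev_seminorm m p F" using C by simp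
      finally show "ennreal (1 / C) * ?V \<le> ennreal (sobolev_seminorm m p F)" .
    qed
    moreover have "trace_seminorm m p E f \<le> ennreal C * ?V"
    proof (cases "?V < top")
      case True
      then obtain F where "F \<in> homogeneous_sobolev m p" "\<forall>x\<in>E. F x = f x"
        "ennreal (sobolev_seminorm m p F) \<le> ennreal C * ?V" using lower by blast
      then show ?thesis unfolding trace_seminorm_def by (intro INF_lower2[of F]) auto
    next
      case False
      then have "?V = top" using top.not_eq_extremum by blast
      then show ?thesis using C by (simp add: ennreal_mult_top)
    qed
    ultimately show ?thesis by blast
  qed
  then show ?thesis using C(1) by blast
qed

end
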